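(* Let $\Gamma$ be a countable disconnected oriented graph. Then $\Gamma$ is homomorphism homogeneous if and only if all of its weakly connected components are isomorphic to the same homogeneous tournament. In particular, in that case $\Gamma$ is isomorphic to one of $k\cdot I_1$, $k\cdot C_3$, $k\cdot(\mathbb{Q},<)$, $k\cdot S(2)$, $k\cdot T^\infty$, for some $1<k\le\omega$.
   Context: An oriented graph is a pair $\Gamma=(V,E)$ with $V$ a non-empty set and $E\subseteq V^2$ an asymmetric relation; write $x\to y$ for $(x,y)\in E$, $x\sim y$ if $x\to y$ or $y\to x$. Weakly connected components are the classes of the equivalence relation "joined by a finite sequence $x=z_0\sim\dots\sim z_k=y$" (as induced subgraphs); disconnected means more than one component. Countable means finite or countably infinite. A homomorphism is an arc-preserving map; $\Gamma$ is homomorphism homogeneous if every homomorphism between finite induced subgraphs extends to an endomorphism; homogeneous if every isomorphism between finite induced subgraphs extends to an automorphism. A tournament has an arc between any two distinct vertices. $I_1$: one vertex, no arcs; $C_3$: directed 3-cycle; $(\mathbb{Q},<)$: $x\to y$ iff $x<y$; $S(2)$: a countable dense subset of the unit circle with no two antipodal points, with $x\to y$ iff the counterclockwise angle from $x$ to $y$ is less than $\pi$; $T^\infty$: the Fraïssé limit of all finite tournaments. $k\cdot\Delta$ denotes the oriented graph with exactly $k$ weakly connected components, each isomorphic to $\Delta$. $\omega$ denotes the first infinite cardinal. *)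

theory Defs
  imports "HOL-Analysis.Analysis" "HOL-Library.Extended_Nat" "HOL-Real_Asymp.Real_Asymp"
begin

type_synonym 'a graph = "'a set \<times> 'a rel"

abbreviation verts :: "'a graph \<Rightarrow> 'a set" where "verts \<equiv> fst"
abbreviation arcs :: "'a graph \<Rightarrow> 'a rel" where "arcs \<equiv> snd"

definition oriented_graph :: "'a graph \<Rightarrow> bool" where
  "oriented_graph G \<longleftrightarrow> verts G \<noteq> {} \<and> arcs G \<subseteq> verts G \<times> verts G \<and> asym (arcs G)"

definition tournament :: "'a graph \<Rightarrow> bool" where
  "tournament G \<longleftrightarrow> oriented_graph G \<and>
     (\<forall>x\<in>verts G. \<forall>y\<in>verts G. x \<noteq> y \<longrightarrow> (x, y) \<in> arcs G \<or> (y, x) \<in> arcs G)"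

definition induced :: "'a graph \<Rightarrow> 'a set \<Rightarrow> 'a graph" where
  "induced G A = (A, arcs G \<inter> (A \<times> A))"


subsection \<open>Weakly connected components\<close>

definition weakly_joined :: "'a graph \<Rightarrow> 'a rel" where
  "weakly_joined G = {(x, y) \<in> verts G \<times> verts G. (x, y) \<in> (arcs G \<union> (arcs G)\<inverse>)\<^sup>*}"

definition weak_components :: "'a graph \<Rightarrow> 'a graph set" where
  "weak_components G = induced G ` (verts G // weakly_joined G)"

definition disconnected :: "'a graph \<Rightarrow> bool" where
  "disconnected G \<longleftrightarrow> (\<exists>C\<in>weak_components G. \<exists>D\<in>weak_components G. C \<noteq> D)"


subsection \<open>Homomorphisms and homogeneity\<close>

definition graph_hom :: "('a \<Rightarrow> 'b) \<Rightarrow> 'a graph \<Rightarrow> 'b graph \<Rightarrow> bool" where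
  "graph_hom f G H \<longleftrightarrow> f ` verts G \<subseteq> verts H \<and>
     (\<forall>x\<in>verts G. \<forall>y\<in>verts G. (x, y) \<in> arcs G \<longrightarrow> (f x, f y) \<in> arcs H)"

definition graph_iso :: "('a \<Rightarrow> 'b) \<Rightarrow> 'a graph \<Rightarrow> 'b graph \<Rightarrow> bool" where
  "graph_iso f G H \<longleftrightarrow> bij_betw f (verts G) (verts H) \<and>
     (\<forall>x\<in>verts G. \<forall>y\<in>verts G. (x, y) \<in> arcs G \<longleftrightarrow> (f x, f y) \<in> arcs H)"

definition isomorphic_graphs :: "'a graph \<Rightarrow> 'b graph \<Rightarrow> bool" where
  "isomorphic_graphs G H \<longleftrightarrow> (\<exists>f. graph_iso f G H)"

definition hom_homogeneous :: "'a graph \<Rightarrow> bool" where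
  "hom_homogeneous G \<longleftrightarrow>
     (\<forall>A B f. finite A \<and> A \<subseteq> verts G \<and> finite B \<and> B \<subseteq> verts G \<and>
        graph_hom f (induced G A) (induced G B) \<longrightarrow>
        (\<exists>g. graph_hom g G G \<and> (\<forall>x\<in>A. g x = f x)))"

definition homogeneous :: "'a graph \<Rightarrow> bool" where
  "homogeneous G \<longleftrightarrow>
     (\<forall>A B f. finite A \<and> A \<subseteq> verts G \<and> finite B \<and> B \<subseteq> verts G \<and>
        graph_iso f (induced G A) (induced G B) \<longrightarrow>
        (\<exists>g. graph_iso g G G \<and> (\<forall>x\<in>A. g x = f x)))"


subsection \<open>Disjoint unions of copies\<close>

text \<open>The number of copies ranges over the cardinals up to \<open>\<omega>\<close>, encoded as extended natural
  numbers with \<open>\<infinity>\<close> for \<open>\<omega>\<close>.  The copies are indexed by the natural numbers below \<open>k\<close>.\<close>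

definition copies :: "enat \<Rightarrow> 'a graph \<Rightarrow> (nat \<times> 'a) graph" where
  "copies k G = ({i. enat i < k} \<times> verts G,
     {((i, x), (i, y)) | i x y. enat i < k \<and> (x, y) \<in> arcs G})"

text \<open>For a tournament, the weakly connected components of \<open>copies k G\<close> are exactly the \<open>k\<close>
  layers, each of them isomorphic to \<open>G\<close>.\<close>

lemma weak_components_copies:
  fixes G :: "'a graph" and k :: enat
  assumes G: "tournament G"
  defines "layer \<equiv> \<lambda>i. induced (copies k G) ({i} \<times> verts G)"
  shows "bij_betw layer {i. enat i < k} (weak_components (copies k G))"
    and "\<And>C. C \<in> weak_components (copies k G) \<Longrightarrow> isomorphic_graphs C G"
proof -
  let ?H = "copies k G"
  have ne: "verts G \<noteq> {}" and sub: "arcs G \<subseteq> verts G \<times> verts G"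
    and tot: "\<And>x y. x \<in> verts G \<Longrightarrow> y \<in> verts G \<Longrightarrow> x \<noteq> y \<Longrightarrow> (x, y) \<in> arcs G \<or> (y, x) \<in> arcs G"
    using G by (auto simp: tournament_def oriented_graph_def)
  have same: "fst p = fst q" if "(p, q) \<in> (arcs ?H \<union> (arcs ?H)\<inverse>)\<^sup>*" for p q
    using that by induction (auto simp: copies_def)
  have cls: "weakly_joined ?H `` {(i, x)} = {i} \<times> verts G"
    if "enat i < k" "x \<in> verts G" for i x
  proof -
    have "((i, x), (i, y)) \<in> (arcs ?H \<union> (arcs ?H)\<inverse>)\<^sup>*" if "y \<in> verts G" for y
      using tot[OF \<open>x \<in> verts G\<close> that] \<open>enat i < k\<close>
      by (cases "x = y") (auto simp: copies_def intro!: r_into_rtrancl)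
    then show ?thesis
      using that same by (fastforce simp: weakly_joined_def copies_def)
  qed
  have "verts ?H // weakly_joined ?H = (\<lambda>i. {i} \<times> verts G) ` {i. enat i < k}"
  proof -
    have "verts ?H // weakly_joined ?H =
        (\<lambda>p. weakly_joined ?H `` {p}) ` ({i. enat i < k} \<times> verts G)"
      by (auto simp: quotient_def copies_def)
    also have "\<dots> = (\<lambda>p. {fst p} \<times> verts G) ` ({i. enat i < k} \<times> verts G)"
      by (intro image_cong refl) (metis cls mem_Collect_eq mem_Times_iff prod.collapse)
    also have "\<dots> = (\<lambda>i. {i} \<times> verts G) ` (fst ` ({i. enat i < k} \<times> verts G))"
      by (simp only: image_image)
    also have "fst ` ({i. enat i < k} \<times> verts G) = {i. enat i < k}"
      using ne by simp
    finally show ?thesis .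
  qed
  then have comps: "weak_components ?H = layer ` {i. enat i < k}"
    by (simp add: weak_components_def layer_def image_image)
  moreover have "inj layer"
    using ne by (auto simp: inj_def layer_def induced_def)
  ultimately show "bij_betw layer {i. enat i < k} (weak_components ?H)"
    by (auto simp: bij_betw_def intro: inj_on_subset)
  fix C assume "C \<in> weak_components ?H"
  then obtain i where "enat i < k" "C = layer i"
    using comps by auto
  then have "graph_iso snd C G"
    by (auto simp: graph_iso_def bij_betw_def inj_on_def layer_def induced_def copies_def)
  then show "isomorphic_graphs C G"
    by (auto simp: isomorphic_graphs_def)
qed


subsection \<open>The tournaments in the classification\<close>

definition I1 :: "nat graph" where
  "I1 = ({0}, {})"

definition C3 :: "nat graph" where
  "C3 = ({0, 1, 2}, {(0, 1), (1, 2), (2, 0)})"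

definition rat_order :: "rat graph" where
  "rat_order = (UNIV, {(x, y). x < y})"

text \<open>For points \<open>x, y\<close> of the unit circle, \<open>Arg2pi (y / x) \<in> {0..<2 * pi}\<close> is the counterclockwise
  angle from \<open>x\<close> to \<open>y\<close>.\<close>

definition circular_graph :: "complex set \<Rightarrow> complex graph" where
  "circular_graph D = (D, {(x, y) \<in> D \<times> D. x \<noteq> y \<and> Arg2pi (y / x) < pi})"

definition S2_vertex_set :: "complex set \<Rightarrow> bool" where
  "S2_vertex_set D \<longleftrightarrow> D \<subseteq> sphere 0 1 \<and> countable D \<and> sphere 0 1 \<subseteq> closure D \<and> (\<forall>z\<in>D. - z \<notin> D)"

text \<open>All sets satisfying \<^const>\<open>S2_vertex_set\<close> give isomorphic graphs; one of them is fixed.\<close>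

definition S2 :: "complex graph" where
  "S2 = circular_graph (SOME D. S2_vertex_set D)"

lemma ex_S2_vertex_set: "\<exists>D. S2_vertex_set D"
proof
  let ?D = "{z :: complex. \<exists>n. odd n \<and> z ^ n = 1}"
  have "?D \<subseteq> sphere 0 1"
    by (auto simp: norm_power[symmetric] dest: power_eq_1_iff)
  moreover have "countable ?D"
  proof -
    have "finite {z :: complex. z ^ n = 1}" if "odd n" for n
      using that by (intro finite_roots_unity) (auto elim: oddE)
    moreover have "?D = (\<Union>n\<in>{n. odd n}. {z. z ^ n = 1})"
      by auto
    ultimately show ?thesis
      by (simp only:, intro countable_UN) (auto intro: countable_finite)
  qed
  moreover have "- z \<notin> ?D" if z: "z \<in> ?D" for z
  proof
    assume "- z \<in> ?D"
    then obtain m n where "odd m" "odd n" "z ^ n = 1" "(- z) ^ m = 1"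
      using z by auto
    then have "z ^ (n * m) = 1" and "z ^ m = - 1"
      by (simp_all add: power_mult minus_equation_iff eq_commute[of "- 1"])
    then have "(- 1 :: complex) ^ n = 1"
      by (metis mult.commute power_mult)
    then show False
      using \<open>odd n\<close> by simp
  qed
  moreover have "w \<in> closure ?D" if w: "w \<in> sphere 0 1" for w
  proof -
    obtain t where t: "w = cis t"
      using w rcis_cmod_Arg[of w] by (intro that[of "Arg w"]) (simp add: rcis_def)
    define s where "s m = 2 * pi * real_of_int \<lfloor>t * (2 * real m + 1) / (2 * pi)\<rfloor> / (2 * real m + 1)"
      for m :: nat
    have "cis (s m) ^ (2 * m + 1) = 1" for m
    proof -
      have "real (2 * m + 1) * s m = 2 * pi * real_of_int \<lfloor>t * (2 * real m + 1) / (2 * pi)\<rfloor>"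
        using of_nat_0_le_iff[of m] by (simp add: s_def add.commute[of 1] del: of_nat_0_le_iff)
      then have "cis (s m) ^ (2 * m + 1) = cis (2 * pi * real_of_int \<lfloor>t * (2 * real m + 1) / (2 * pi)\<rfloor>)"
        by (simp only: Complex.DeMoivre)
      then show ?thesis
        by (simp add: cis_multiple_2pi)
    qed
    then have "cis (s m) \<in> ?D" for m
      by (auto intro!: exI[of _ "2 * m + 1"])
    moreover have "s \<longlonglongrightarrow> t"
      unfolding s_def by real_asymp
    then have "(\<lambda>m. cis (s m)) \<longlonglongrightarrow> w"
      unfolding t by (intro tendsto_intros)
    ultimately show ?thesis
      unfolding closure_sequential by (intro exI[of _ "\<lambda>m. cis (s m)"]) auto
  qed
  ultimately show "S2_vertex_set ?D"
    by (auto simp: S2_vertex_set_def)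
qed


subsection \<open>The generic tournament\<close>

text \<open>Ages are represented by graphs on the natural numbers, which realise every finite
  isomorphism type.\<close>

definition age :: "'a graph \<Rightarrow> nat graph set" where
  "age G = {H. oriented_graph H \<and> finite (verts H) \<and>
     (\<exists>A\<subseteq>verts G. isomorphic_graphs H (induced G A))}"

definition fraisse_limit :: "'a graph \<Rightarrow> nat graph set \<Rightarrow> bool" where
  "fraisse_limit G K \<longleftrightarrow> oriented_graph G \<and> countable (verts G) \<and> homogeneous G \<and> age G = K"

text \<open>A Fraisse limit is unique up to isomorphism; one with vertices in \<^typ>\<open>nat\<close> is fixed.\<close>

definition T_inf :: "nat graph" where
  "T_inf = (SOME G. fraisse_limit G {H. tournament H \<and> finite (verts H)})"

text \<open>A Fraisse limit of the finite tournaments is obtained by orienting the pairs \<open>x < y\<close>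
  according to the \<open>x\<close>-th binary digit of \<open>y\<close>.\<close>

lemma ex_fraisse_limit_tournaments:
  "\<exists>G :: nat graph. fraisse_limit G {H. tournament H \<and> finite (verts H)}"
proof
  define r :: "nat \<Rightarrow> nat \<Rightarrow> bool" where
    "r x y \<longleftrightarrow> (x < y \<and> bit y x) \<or> (y < x \<and> \<not> bit x y)" for x y
  let ?G = "(UNIV, {(x, y). r x y}) :: nat graph"
  have tot: "x \<noteq> y \<Longrightarrow> r x y \<longleftrightarrow> \<not> r y x" and irr: "\<not> r x x" for x y
    by (auto simp: r_def)
  have tG: "tournament ?G"
    unfolding tournament_def oriented_graph_def by (auto intro!: asymI) (metis tot irr)+
  have EP: "\<exists>v. v \<notin> A \<and> (\<forall>a\<in>A. r a v \<longleftrightarrow> Q a)" if "finite A" for A Q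
  proof -
    obtain N where N: "\<forall>a\<in>A. a < N"
      using \<open>finite A\<close> finite_nat_set_iff_bounded by blast
    define v :: nat where "v = horner_sum of_bool 2 (map (\<lambda>i. i = N \<or> Q i) [0..<Suc N])"
    have bits: "bit v i \<longleftrightarrow> i \<le> N \<and> (i = N \<or> Q i)" for i
      unfolding v_def by (auto simp: bit_horner_sum_bit_iff nth_append)
    have "N < v"
    proof -
      have "2 ^ N \<le> v"
        using bits[of N] by (metis bit_iff_odd div_less even_zero linorder_not_le order_refl)
      then show ?thesis
        using less_exp[of N] by linarith
    qed
    then show ?thesis
      using N bits by (intro exI[of _ v]) (auto simp: r_def)
  qed
  define P where "P p \<longleftrightarrow> (\<forall>a b c d. (a, b) \<in> p \<longrightarrow> (c, d) \<in> p \<longrightarrow>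
      (a = c \<longleftrightarrow> b = d) \<and> (r a c \<longleftrightarrow> r b d))" for p :: "(nat \<times> nat) set"
  have forth: "\<exists>q. finite q \<and> P q \<and> p \<subseteq> q \<and> v \<in> Domain q" if "finite p" "P p" for p v
  proof (cases "v \<in> Domain p")
    case False
    obtain w where w: "w \<notin> Range p" "\<And>b. b \<in> Range p \<Longrightarrow> r b w \<longleftrightarrow> (\<exists>a. (a, b) \<in> p \<and> r a v)"
      using EP[of "Range p" "\<lambda>b. \<exists>a. (a, b) \<in> p \<and> r a v"] finite_Range[OF \<open>finite p\<close>] by blast
    have 1: "r b w \<longleftrightarrow> r a v" if "(a, b) \<in> p" for a b
      using w(2)[of b] that \<open>P p\<close> unfolding P_def by blast
    have 2: "r w b \<longleftrightarrow> r v a" if "(a, b) \<in> p" for a b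
      using 1[OF that] tot[of b w] tot[of a v] that w(1) False by blast
    have "P (insert (v, w) p)"
      unfolding P_def
    proof (intro allI impI)
      fix a b c d assume "(a, b) \<in> insert (v, w) p" "(c, d) \<in> insert (v, w) p"
      then consider "a = v" "b = w" "c = v" "d = w" | "a = v" "b = w" "(c, d) \<in> p"
        | "c = v" "d = w" "(a, b) \<in> p" | "(a, b) \<in> p" "(c, d) \<in> p" by blast
      then show "(a = c \<longleftrightarrow> b = d) \<and> (r a c \<longleftrightarrow> r b d)"
      proof cases
        case 1 then show ?thesis using irr by blast
      next
        case 2 then show ?thesis using \<open>\<And>a b. (a, b) \<in> p \<Longrightarrow> r w b \<longleftrightarrow> r v a\<close>[of c d] False w(1) by blast
      next
        case 3 then show ?thesis using \<open>\<And>a b. (a, b) \<in> p \<Longrightarrow> r b w \<longleftrightarrow> r a v\<close>[of a b] False w(1) by blast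
      next
        case 4 then show ?thesis using \<open>P p\<close> unfolding P_def by blast
      qed
    qed
    then show ?thesis
      using that by (intro exI[of _ "insert (v, w) p"]) auto
  qed (use that in auto)
  have conv: "P (p\<inverse>) \<longleftrightarrow> P p" for p
    unfolding P_def by blast
  have both: "\<exists>q. finite q \<and> P q \<and> p \<subseteq> q \<and> v \<in> Domain q \<and> v \<in> Range q"
    if p: "finite p" "P p" for p v
  proof -
    obtain q where q: "finite q" "P q" "p \<subseteq> q" "v \<in> Domain q"
      using forth[OF p] by blast
    then obtain q' where "finite q'" "P q'" "q\<inverse> \<subseteq> q'" "v \<in> Domain q'"
      using forth[of "q\<inverse>" v] conv by auto
    then show ?thesis
      using q conv by (intro exI[of _ "q'\<inverse>"]) auto
  qed
  have "homogeneous ?G"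
    unfolding homogeneous_def
  proof (intro allI impI)
    fix A B f
    assume f: "finite A \<and> A \<subseteq> verts ?G \<and> finite B \<and> B \<subseteq> verts ?G \<and>
      graph_iso f (induced ?G A) (induced ?G B)"
    define p0 where "p0 = (\<lambda>x. (x, f x)) ` A"
    have "inj_on f A" and fim: "f ` A = B"
      and fr: "\<And>x y. x \<in> A \<Longrightarrow> y \<in> A \<Longrightarrow> r x y \<longleftrightarrow> r (f x) (f y)"
      using f by (auto simp: graph_iso_def induced_def bij_betw_def)
    then have p0: "finite p0" "P p0"
      using f by (auto simp: p0_def P_def inj_on_def)
    have "\<exists>p. \<forall>n. (finite (p n) \<and> P (p n) \<and> (n = 0 \<longrightarrow> p n = p0)) \<and>
        (p n \<subseteq> p (Suc n) \<and> n \<in> Domain (p (Suc n)) \<and> n \<in> Range (p (Suc n)))"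
      by (rule dependent_nat_choice) (use p0 both in auto)
    then obtain p where p: "\<And>n. P (p n)" "p 0 = p0" "\<And>n. p n \<subseteq> p (Suc n)"
      "\<And>n. n \<in> Domain (p (Suc n))" "\<And>n. n \<in> Range (p (Suc n))"
      by blast
    have mono: "p m \<subseteq> p n" if "m \<le> n" for m n
      using p(3) that by (rule lift_Suc_mono_le)
    define q where "q = (\<Union>n. p n)"
    have Pq: "P q"
      unfolding P_def
    proof (intro allI impI)
      fix a b c d assume "(a, b) \<in> q" "(c, d) \<in> q"
      then obtain m n where "(a, b) \<in> p m" "(c, d) \<in> p n"
        by (auto simp: q_def)
      then have "(a, b) \<in> p (max m n)" "(c, d) \<in> p (max m n)"
        using mono[of m "max m n"] mono[of n "max m n"] by auto
      then show "(a = c \<longleftrightarrow> b = d) \<and> (r a c \<longleftrightarrow> r b d)"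
        using p(1) unfolding P_def by blast
    qed
    have "\<exists>y. (x, y) \<in> q" for x
      using p(4)[of x] by (auto simp: q_def)
    then obtain g where g: "\<And>x. (x, g x) \<in> q"
      by metis
    have surj: "\<exists>x. y = g x" for y
    proof -
      obtain x where "(x, y) \<in> q"
        using p(5)[of y] by (auto simp: q_def)
      then show ?thesis
        using g[of x] Pq unfolding P_def by blast
    qed
    have "inj g" and "\<And>x y. r x y \<longleftrightarrow> r (g x) (g y)"
      using g Pq unfolding P_def inj_def by blast+
    moreover have "surj g"
      using surj by (auto simp: surj_def)
    ultimately have "graph_iso g ?G ?G"
      by (simp add: graph_iso_def bij_betw_def)
    moreover have "g x = f x" if "x \<in> A" for x
    proof -
      have "(x, f x) \<in> q"
        using that p(2) by (auto simp: q_def p0_def intro!: exI[of _ 0])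
      then show ?thesis
        using g[of x] Pq unfolding P_def by blast
    qed
    ultimately show "\<exists>g. graph_iso g ?G ?G \<and> (\<forall>x\<in>A. g x = f x)"
      by blast
  qed
  moreover have "age ?G = {H. tournament H \<and> finite (verts H)}"
  proof (intro set_eqI iffI)
    fix H assume "H \<in> age ?G"
    then obtain A f where H: "oriented_graph H" "finite (verts H)" "graph_iso f H (induced ?G A)"
      by (auto simp: age_def isomorphic_graphs_def)
    have "(x, y) \<in> arcs H \<or> (y, x) \<in> arcs H" if "x \<in> verts H" "y \<in> verts H" "x \<noteq> y" for x y
    proof -
      have "f x \<noteq> f y" "f x \<in> A" "f y \<in> A"
        using H(3) that by (auto simp: graph_iso_def induced_def bij_betw_def inj_on_def)
      then show ?thesis
        using H(3) that tot[of "f x" "f y"] by (auto simp: graph_iso_def induced_def)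
    qed
    then show "H \<in> {H. tournament H \<and> finite (verts H)}"
      using H by (auto simp: tournament_def)
  next
    fix H :: "nat graph" assume "H \<in> {H. tournament H \<and> finite (verts H)}"
    then have H: "oriented_graph H" "finite (verts H)" "asym (arcs H)"
      and Htot: "\<And>x y. x \<in> verts H \<Longrightarrow> y \<in> verts H \<Longrightarrow> x \<noteq> y \<Longrightarrow> (x, y) \<in> arcs H \<or> (y, x) \<in> arcs H"
      by (auto simp: tournament_def oriented_graph_def)
    have Hasym: "(x, y) \<in> arcs H \<Longrightarrow> (y, x) \<notin> arcs H" for x y
      using H(3) by (auto dest: asymD)
    have "\<exists>f. inj_on f W \<and> (\<forall>x\<in>W. \<forall>y\<in>W. (x, y) \<in> arcs H \<longleftrightarrow> r (f x) (f y))"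
      if "W \<subseteq> verts H" for W
      using finite_subset[OF that H(2)] that
    proof (induction W rule: finite_induct)
      case (insert v W)
      then obtain f where f: "inj_on f W" "\<And>x y. x \<in> W \<Longrightarrow> y \<in> W \<Longrightarrow> (x, y) \<in> arcs H \<longleftrightarrow> r (f x) (f y)"
        by auto
      obtain w where w: "w \<notin> f ` W" "\<And>b. b \<in> f ` W \<Longrightarrow> r b w \<longleftrightarrow> (\<exists>a\<in>W. b = f a \<and> (a, v) \<in> arcs H)"
        using EP[of "f ` W" "\<lambda>b. \<exists>a\<in>W. b = f a \<and> (a, v) \<in> arcs H"] insert.hyps by blast
      have 1: "r (f a) w \<longleftrightarrow> (a, v) \<in> arcs H" if "a \<in> W" for a
        using w(2)[of "f a"] that f(1) by (auto dest: inj_onD)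
      have 2: "r w (f a) \<longleftrightarrow> (v, a) \<in> arcs H" if "a \<in> W" for a
      proof -
        have "v \<noteq> a" "w \<noteq> f a" "v \<in> verts H" "a \<in> verts H"
          using that insert w(1) by auto
        then show ?thesis
          using 1[OF that] tot[of w "f a"] Htot[of v a] Hasym by blast
      qed
      have "inj_on (f(v := w)) (insert v W)"
        using f(1) w(1) insert.hyps by (auto simp: inj_on_def)
      moreover have "\<forall>x\<in>insert v W. \<forall>y\<in>insert v W.
          (x, y) \<in> arcs H \<longleftrightarrow> r ((f(v := w)) x) ((f(v := w)) y)"
        using f(2) 1 2 irr Hasym[of v v] insert.hyps by auto
      ultimately show ?case
        by blast
    qed auto
    then obtain f where "inj_on f (verts H)"
      "\<forall>x\<in>verts H. \<forall>y\<in>verts H. (x, y) \<in> arcs H \<longleftrightarrow> r (f x) (f y)"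
      by blast
    then have "graph_iso f H (induced ?G (f ` verts H))"
      by (auto simp: graph_iso_def induced_def bij_betw_def)
    then show "H \<in> age ?G"
      using H by (auto simp: age_def isomorphic_graphs_def)
  qed
  ultimately show "fraisse_limit ?G {H. tournament H \<and> finite (verts H)}"
    using tG by (simp add: fraisse_limit_def tournament_def)
qed

end

theory Submission
  imports Defs
begin

text \<open>
  If a hom-homogeneous graph is disconnected, a non-adjacent pair inside a component could be sent to
  different components, so all components are tournaments; a map between finite subsets of
  two components then extends point by point, and back-and-forth makes the components isomorphic and
  homogeneous.

  The list of tournaments is Lachlan's theorem.  If the in- and out-neighbourhoods of all vertices
  are transitive, fixing a vertex and reversing its arcs turns the tournament into a two-coloured
  dense linear order.  Otherwise, up to reversal, some vertex dominates a 3-cycle, and every finite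
  tournament embeds: for an amalgamation class \<open>K\<close> of finite tournaments, those \<open>A\<close> all of whose
  extensions by a linear tournament lie in \<open>K\<close> form again an amalgamation class.  Hence if the vertex
  dominating a 3-cycle survives this operation, finite tournaments can be built
  vertex by vertex.  That it survives follows by Ramsey's theorem once all
  one-point extensions of linear sums of copies of it are known to lie in \<open>K\<close>; this
  is shown first for few in-neighbours in each copy and, using that case, in general.
\<close>

section \<open>Amalgamation classes of finite tournaments\<close>

text \<open>Statements are about abstract classes because each result is applied again to classes
  derived from the given one; even the induction that builds a tournament vertex by vertex
  (\<open>sparse_tournament\<close>) changes the class at each step. The difficulty is a circle:
  \<open>W\<close>, a 3-cycle with a dominating vertex, lies in \<open>linear_ext d K\<close> once
  the one-point extensions of stacks of \<open>W\<close> lie in \<open>K\<close>, but these are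
  already complicated tournaments. The bound \<open>d\<close> on in-neighbours breaks it, and 2 is
  the value that serves on both sides. A point with at most two in-neighbours in a copy of
  \<open>W\<close> has an out-neighbour in the 3-cycle, so the extension splits into two transitive
  sets. Conversely, an arbitrary one-point extension of a stack can be listed so that no vertex has
  more than two in-neighbours before it. Two transitive sets are harmless because linear tournaments
  lie in \<open>linear_ext d K\<close> for all positive \<open>d\<close> when \<open>K\<close>
  contains \<open>W\<close>. This rests on one-point extensions of linear tournaments, obtained by
  sorting with the help of 3-cycles inserted at any place.\<close>

definition tourn :: "'b set \<Rightarrow> ('b \<Rightarrow> 'b \<Rightarrow> bool) \<Rightarrow> bool" where
  "tourn S r \<longleftrightarrow> (\<forall>x\<in>S. \<forall>y\<in>S. (x \<noteq> y \<longrightarrow> r x y \<or> r y x) \<and> \<not> (r x y \<and> r y x))"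

text \<open>Overriding the arc lets one relation \<open>r\<close> describe two one-point extensions
  at once, with the pair of new points decided afterwards.\<close>

definition set_arc :: "('b \<Rightarrow> 'b \<Rightarrow> bool) \<Rightarrow> 'b \<Rightarrow> 'b \<Rightarrow> 'b \<Rightarrow> 'b \<Rightarrow> bool" where
  "set_arc r a b x y \<longleftrightarrow> (x = a \<and> y = b \<or> r x y \<and> \<not> (x = b \<and> y = a))"

text \<open>A finite tournament is given by its vertex set and a relation that matters only there.  When
  \<open>a\<close> and \<open>b\<close> have the same arcs with \<open>S\<close>, the amalgam may identify them, so nothing is required.\<close>

locale amalgamation_class =
  fixes K :: "nat set \<Rightarrow> (nat \<Rightarrow> nat \<Rightarrow> bool) \<Rightarrow> bool"
  assumes finite_class: "K S r \<Longrightarrow> finite S"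
    and tourn_class: "K S r \<Longrightarrow> tourn S r"
    and hereditary: "K T r' \<Longrightarrow> inj_on f S \<Longrightarrow> f ` S \<subseteq> T \<Longrightarrow>
      (\<And>x y. x \<in> S \<Longrightarrow> y \<in> S \<Longrightarrow> r x y \<longleftrightarrow> r' (f x) (f y)) \<Longrightarrow> K S r"
    and amalgamation: "K (insert a S) r \<Longrightarrow> K (insert b S) r \<Longrightarrow> a \<notin> S \<Longrightarrow> b \<notin> S \<Longrightarrow>
      s \<in> S \<Longrightarrow> r s a \<noteq> r s b \<Longrightarrow>
      K (insert a (insert b S)) (set_arc r a b) \<or> K (insert a (insert b S)) (set_arc r b a)"

text \<open>Sums, options and pairs are convenient vertex types, while a class lives on
  \<open>nat\<close>; \<open>to_nat\<close> transports it to every countable type.\<close>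

definition member :: "(nat set \<Rightarrow> (nat \<Rightarrow> nat \<Rightarrow> bool) \<Rightarrow> bool) \<Rightarrow>
    'b::countable set \<Rightarrow> ('b \<Rightarrow> 'b \<Rightarrow> bool) \<Rightarrow> bool" where
  "member K S r \<longleftrightarrow> K (to_nat ` S) (\<lambda>x y. r (from_nat x) (from_nat y))"

context amalgamation_class
begin

lemma member_finite: "member K S r \<Longrightarrow> finite S"
  unfolding member_def by (drule finite_class) (auto dest: finite_imageD simp: inj_on_subset[OF inj_to_nat])

lemma member_tourn: "member K S r \<Longrightarrow> tourn S r"
  unfolding member_def by (drule tourn_class) (fastforce simp: tourn_def)

lemma member_hereditary:
  assumes "member K T r'" "inj_on f S" "f ` S \<subseteq> T"
    and "\<And>x y. x \<in> S \<Longrightarrow> y \<in> S \<Longrightarrow> r x y \<longleftrightarrow> r' (f x) (f y)"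
  shows "member K S r"
  unfolding member_def
proof (rule hereditary)
  show "K (to_nat ` T) (\<lambda>x y. r' (from_nat x) (from_nat y))"
    using assms(1) by (simp add: member_def)
  show "inj_on (\<lambda>n. to_nat (f (from_nat n))) (to_nat ` S)"
    using assms(2) by (simp add: inj_on_def)
qed (use assms(3,4) in auto)

text \<open>\<open>to_nat\<close> need not be the identity on \<open>nat\<close>, so the agreement
  rests on closure under embeddings.\<close>

lemma member_nat: "member K S r \<longleftrightarrow> K S r" for S :: "nat set"
proof
  assume "member K S r"
  then show "K S r"
    unfolding member_def by (rule hereditary[where f = to_nat]) (auto simp: inj_on_def)
next
  assume "K S r"
  then show "member K S r"
    unfolding member_def by (rule hereditary[where f = from_nat]) (auto simp: inj_on_def)
qed

lemma member_cong:
  assumes "\<And>x y. x \<in> S \<Longrightarrow> y \<in> S \<Longrightarrow> r x y \<longleftrightarrow> r' x y"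
  shows "member K S r \<longleftrightarrow> member K S r'"
  by (intro iffI; erule member_hereditary[where f = "\<lambda>x. x"]) (simp_all add: assms)

lemma member_subset:
  assumes "member K T r" "S \<subseteq> T"
  shows "member K S r"
  using assms(1) by (rule member_hereditary[where f = "\<lambda>x. x"]) (use assms(2) in auto)

lemma member_amalgamation:
  assumes "member K (insert a S) r" "member K (insert b S) r" "a \<notin> S" "b \<notin> S"
    and "s \<in> S" "r s a \<noteq> r s b"
  shows "member K (insert a (insert b S)) (set_arc r a b) \<or>
    member K (insert a (insert b S)) (set_arc r b a)"
proof -
  let ?q = "\<lambda>x y. r (from_nat x) (from_nat y)" and ?S = "to_nat ` S"
  have "K (insert (to_nat a) ?S) ?q" "K (insert (to_nat b) ?S) ?q"
    using assms(1,2) by (simp_all add: member_def)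
  moreover have "to_nat a \<notin> ?S" "to_nat b \<notin> ?S" "to_nat s \<in> ?S"
    "?q (to_nat s) (to_nat a) \<noteq> ?q (to_nat s) (to_nat b)"
    using assms by auto
  ultimately have *: "K (insert (to_nat a) (insert (to_nat b) ?S)) (set_arc ?q (to_nat a) (to_nat b)) \<or>
      K (insert (to_nat a) (insert (to_nat b) ?S)) (set_arc ?q (to_nat b) (to_nat a))"
    by (rule amalgamation)
  have tr: "member K (insert a (insert b S)) (set_arc r c d)"
    if "K (insert (to_nat a) (insert (to_nat b) ?S)) (set_arc ?q (to_nat c) (to_nat d))" for c d
    unfolding member_def
  proof (rule hereditary[OF that, where f = "\<lambda>x. x"])
    fix x y assume "x \<in> to_nat ` insert a (insert b S)" "y \<in> to_nat ` insert a (insert b S)"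
    then obtain x' y' where "x' \<in> insert a (insert b S)" "y' \<in> insert a (insert b S)"
        "x = to_nat x'" "y = to_nat y'"
      by (meson imageE)
    then show "set_arc r c d (from_nat x) (from_nat y) = set_arc ?q (to_nat c) (to_nat d) x y"
      by (simp add: set_arc_def)
  qed simp_all
  show ?thesis
    using * tr by blast
qed

end

text \<open>Small tournaments are given by the lists of out-neighbours of \<open>0, 1, 2, \<dots>\<close>.\<close>

definition adj :: "nat list list \<Rightarrow> nat \<Rightarrow> nat \<Rightarrow> bool" where
  "adj L x y \<longleftrightarrow> y \<in> set (L ! x)"

definition has :: "(nat set \<Rightarrow> (nat \<Rightarrow> nat \<Rightarrow> bool) \<Rightarrow> bool) \<Rightarrow> nat list list \<Rightarrow> bool" where
  "has K L \<longleftrightarrow> K {..<length L} (adj L)"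

text \<open>Sending the entries of \<open>xs\<close> to those of \<open>ys\<close> embeds the part
  of \<open>L\<close> on \<open>xs\<close> into \<open>M\<close>. The list form makes the condition
  decidable by evaluation.\<close>

definition matches :: "nat list list \<Rightarrow> nat list \<Rightarrow> nat list list \<Rightarrow> nat list \<Rightarrow> bool" where
  "matches L xs M ys \<longleftrightarrow> length xs = length ys \<and> distinct xs \<and> distinct ys \<and>
     (\<forall>y\<in>set ys. y < length M) \<and>
     (\<forall>p\<in>set (zip xs ys). \<forall>q\<in>set (zip xs ys). adj L (fst p) (fst q) \<longleftrightarrow> adj M (snd p) (snd q))"

section \<open>Amalgamation steps between explicitly listed tournaments\<close>

context amalgamation_class
begin

lemma has_matches:
  assumes "has K M" "matches L xs M ys"
  shows "K (set xs) (adj L)"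
proof (rule hereditary)
  define f where "f x = the (map_of (zip xs ys) x)" for x
  have len: "length xs = length ys" and d: "distinct xs" "distinct ys"
    using assms(2) by (auto simp: matches_def)
  have f: "(x, f x) \<in> set (zip xs ys)" if "x \<in> set xs" for x
    proof -
    have "map_of (zip xs ys) x \<noteq> None"
      using that map_fst_zip[OF len] by (metis map_of_eq_None_iff set_map)
    then show ?thesis
      by (auto simp: f_def dest: map_of_SomeD)
  qed
  show "K {..<length M} (adj M)"
    using assms(1) by (simp add: has_def)
  show "inj_on f (set xs)"
  proof (rule inj_onI)
    fix x y assume "x \<in> set xs" "y \<in> set xs" "f x = f y"
    have ex: "\<exists>i<length xs. xs ! i = z \<and> ys ! i = f z" if "z \<in> set xs" for z
      using f[OF that] len by (auto simp: in_set_zip)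
    obtain i where i: "i < length xs" "xs ! i = x" "ys ! i = f x"
      using ex[OF \<open>x \<in> set xs\<close>] by blast
    obtain j where j: "j < length xs" "xs ! j = y" "ys ! j = f y"
      using ex[OF \<open>y \<in> set xs\<close>] by blast
    have "ys ! i = ys ! j"
      by (simp only: i(3) j(3) \<open>f x = f y\<close>)
    then have "i = j"
      using i(1) j(1) d(2) len nth_eq_iff_index_eq by metis
    with i j show "x = y"
      by simp
  qed
  show "f ` set xs \<subseteq> {..<length M}"
    using f assms(2) by (auto simp: matches_def dest!: set_zip_rightD)
  show "adj L x y \<longleftrightarrow> adj M (f x) (f y)" if "x \<in> set xs" "y \<in> set xs" for x y
  proof -
    have "adj L (fst (x, f x)) (fst (y, f y)) \<longleftrightarrow> adj M (snd (x, f x)) (snd (y, f y))"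
      using f[OF that(1)] f[OF that(2)] assms(2) unfolding matches_def by blast
    then show ?thesis
      by simp
  qed
qed

text \<open>The vertices \<open>n\<close> and \<open>Suc n\<close> are amalgamated over
  \<open>{..<n}\<close>, and \<open>M\<close>, \<open>M'\<close> are the two possible results.
  \<open>L1\<close> and \<open>L2\<close> contain the two one-point extensions; the remaining
  hypotheses are finite checks.\<close>

lemma has_amalgam:
  assumes "has K L1" "has K L2"
    and "matches M [0..<Suc n] L1 ys" "matches M ([0..<n] @ [Suc n]) L2 zs"
    and "length M = Suc (Suc n)" "length M' = Suc (Suc n)" "adj M n (Suc n)" "\<not> adj M (Suc n) n"
    and "list_ex (\<lambda>s. adj M s n \<noteq> adj M s (Suc n)) [0..<n]"
    and "list_all (\<lambda>i. list_all (\<lambda>j. adj M' i j \<longleftrightarrow> set_arc (adj M) (Suc n) n i j) [0..<Suc (Suc n)]) [0..<Suc (Suc n)]"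
  shows "has K M \<or> has K M'"
proof -
  let ?S = "{..<n}"
  have S: "insert n (insert (Suc n) ?S) = {..<Suc (Suc n)}"
    by auto
  have *: "K (insert n ?S) (adj M)" "K (insert (Suc n) ?S) (adj M)"
    using has_matches[OF assms(1,3)] has_matches[OF assms(2,4)]
    by (simp_all add: atLeast0LessThan)
  obtain s where "s \<in> ?S" "adj M s n \<noteq> adj M s (Suc n)"
    using assms(9) unfolding list_ex_iff by force
  then have D: "K {..<Suc (Suc n)} (set_arc (adj M) n (Suc n)) \<or> K {..<Suc (Suc n)} (set_arc (adj M) (Suc n) n)"
    using amalgamation[OF *] by (simp add: S)
  then show ?thesis
  proof
    assume a: "K {..<Suc (Suc n)} (set_arc (adj M) (Suc n) n)"
    have "adj M' i j \<longleftrightarrow> set_arc (adj M) (Suc n) n i j" if "i < Suc (Suc n)" "j < Suc (Suc n)" for i j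
      using assms(10) that unfolding list_all_iff set_upt Ball_def atLeastLessThan_iff by blast
    then have "K {..<Suc (Suc n)} (adj M')"
      by (intro hereditary[OF a, where f = "\<lambda>x. x"]) auto
    then show ?thesis by (simp add: has_def assms)
  next
    assume a: "K {..<Suc (Suc n)} (set_arc (adj M) n (Suc n))"
    have "K {..<Suc (Suc n)} (adj M)"
      using assms(7,8) by (intro hereditary[OF a, where f = "\<lambda>x. x"]) (auto simp: set_arc_def)
    then show ?thesis by (simp add: has_def assms)
  qed
qed

end

lemmas adj_simps = matches_def adj_def set_arc_def upt_rec

context amalgamation_class
begin

lemma has_sub: "has K M \<Longrightarrow> matches L [0..<length L] M ys \<Longrightarrow> has K L"
  using has_matches[of M L "[0..<length L]" ys] by (simp add: has_def atLeast0LessThan)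

text \<open>Keeping only a subtournament of each amalgam holds the derivations below to at most six
  vertices, and lets the two alternatives coincide when \<open>T\<close> and \<open>T'\<close> are
  equal.\<close>

lemma has_step:
  assumes "has K A" "has K B"
    and "matches M [0..<Suc n] A ys" "matches M ([0..<n] @ [Suc n]) B zs"
    and "length M = Suc (Suc n)" "length M' = Suc (Suc n)" "adj M n (Suc n)" "\<not> adj M (Suc n) n"
    and "list_ex (\<lambda>s. adj M s n \<noteq> adj M s (Suc n)) [0..<n]"
    and "list_all (\<lambda>i. list_all (\<lambda>j. adj M' i j \<longleftrightarrow> set_arc (adj M) (Suc n) n i j)
          [0..<Suc (Suc n)]) [0..<Suc (Suc n)]"
    and "matches T [0..<length T] M us" "matches T' [0..<length T'] M' ws"
  shows "has K T \<or> has K T'"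
  using has_amalgam[OF assms(1-10)] assms(11,12) has_sub by blast

text \<open>The first amalgamation yields either the goal \<open>?Wm\<close> or the strong
  tournament \<open>?S4\<close> on four vertices. Amalgamating \<open>?S4\<close> with
  \<open>?Wp\<close> then produces \<open>?Wm\<close> for both orientations of the new arc.\<close>

lemma has_C3_dominating:
  assumes "has K [[1],[2],[0],[0,1,2]]"
  shows "has K [[1,3],[2,3],[0,3],[]]"
proof -
  let ?Wp = "[[1],[2],[0],[0,1,2]]"
  let ?L3 = "[[],[0],[0,1]]"
  let ?C3 = "[[2],[0],[1]]"
  let ?S4 = "[[3],[0],[0,1],[1,2]]"
  let ?Wm = "[[1,3],[2,3],[0,3],[]]"
  have L3: "has K ?Wp \<Longrightarrow> has K ?L3"
    by (erule has_sub[where ys = "[0,2,3]"]) (simp add: adj_simps)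
  have C3: "has K ?Wp \<Longrightarrow> has K ?C3"
    by (erule has_sub[where ys = "[0,2,1]"]) (simp add: adj_simps)
  have a: "has K ?C3 \<Longrightarrow> has K ?L3 \<Longrightarrow> has K ?Wm \<or> has K ?S4"
    using has_step[where M = "[[2,3],[0,3],[1,3],[]]" and M' = "[[2,3],[0,3],[1],[2]]" and n = 2
        and ys = "[0,1,2]" and zs = "[1,2,0]" and T = "?Wm" and T' = "?S4"
        and us = "[0,2,1,3]" and ws = "[2,3,0,1]" and A = "?C3" and B = "?L3"] by (simp add: adj_simps)
  have b: "has K ?S4 \<Longrightarrow> has K ?Wp \<Longrightarrow> has K ?Wm"
    using has_step[where M = "[[3,4],[0],[0,1,4],[1,2,4],[1]]" and M' = "[[3,4],[0],[0,1,4],[1,2],[1,3]]" and n = 3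
        and ys = "[0,1,2,3]" and zs = "[0,2,3,1]" and T = "?Wm" and T' = "?Wm"
        and us = "[0,3,2,4]" and ws = "[2,4,3,1]" and A = "?S4" and B = "?Wp"] by (simp add: adj_simps)
  show ?thesis
    using assms L3 C3 a b by blast
qed

text \<open>The intermediate tournaments come from a computer search over all amalgamation problems on at
  most six vertices.\<close>

lemma has_two_dominating_C3:
  assumes "has K [[1],[2],[0],[0,1,2]]"
  shows "has K [[1],[2],[0],[0,1,2],[0,1,2,3]]"
proof (rule ccontr)
  let ?L3 = "[[],[0],[0,1]]"
  let ?L4 = "[[],[0],[0,1],[0,1,2]]"
  let ?Wp = "[[1],[2],[0],[0,1,2]]"
  let ?S4 = "[[3],[0],[0,1],[1,2]]"
  let ?L2C3 = "[[1],[2],[0],[0,1,2],[0,1,2,3]]"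
  \<comment> \<open>\<open>?T2\<close> is \<open>?S4\<close> with a dominating vertex and
    \<open>?T3\<close> is a 3-cycle dominating one vertex and dominated by another;
    \<open>?T4\<close> is a linear tournament with the arc between its ends reversed.\<close>
  let ?T2 = "[[3],[0],[0,1],[1,2],[0,1,2,3]]"
  let ?T3 = "[[1,3],[],[0,1],[1,2],[0,1,2,3]]"
  let ?T4 = "[[4],[0],[0,1],[0,1,2],[1,2,3]]"
  let ?T6 = "[[2,4],[0],[1],[0,1,2],[1,2,3]]"
  let ?T7 = "[[1,2,4],[],[1],[0,1,2],[1,2,3]]"
  let ?T8 = "[[3,4],[0],[0,1],[1,2],[1,2,3]]"
  let ?T10 = "[[1,4],[3],[0,1],[0,2],[1,2,3]]"
  let ?T42 = "[[1,5],[3,4],[0,1],[0,2],[0,2,3],[1,2,3,4]]"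
  assume neg: "\<not> has K ?L2C3"
  have L3: "has K ?Wp \<Longrightarrow> has K ?L3"
    by (erule has_sub[where ys = "[0,2,3]"]) (simp add: adj_simps)
  have T6_L4: "has K ?T6 \<Longrightarrow> has K ?L4"
    by (erule has_sub[where ys = "[1,2,3,4]"]) (simp add: adj_simps)
  have T8_L4: "has K ?T8 \<Longrightarrow> has K ?L4"
    by (erule has_sub[where ys = "[1,2,3,4]"]) (simp add: adj_simps)
  have T2_S4: "has K ?T2 \<Longrightarrow> has K ?S4"
    by (erule has_sub[where ys = "[0,1,2,3]"]) (simp add: adj_simps)
  have T42_T4: "has K ?T42 \<Longrightarrow> has K ?T4"
    by (erule has_sub[where ys = "[0,2,3,4,5]"]) (simp add: adj_simps)
  have T42_T10: "has K ?T42 \<Longrightarrow> has K ?T10"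
    by (erule has_sub[where ys = "[0,1,2,3,5]"]) (simp add: adj_simps)
  have s0: "has K ?L3 \<Longrightarrow> has K ?L4 \<or> has K ?S4"
    using has_step[where M = "[[3],[0,3],[0,1,3],[]]" and M' = "[[3],[0,3],[0,1],[2]]" and n = 2
        and ys = "[0,1,2]" and zs = "[1,2,0]" and T = "?L4" and T' = "?S4"
        and us = "[3,0,1,2]" and ws = "[3,0,1,2]" and A = "?L3" and B = "?L3"] by (simp add: adj_simps)
  have s1: "has K ?L4 \<Longrightarrow> has K ?Wp \<Longrightarrow> has K ?L2C3 \<or> has K ?T2"
    using has_step[where M = "[[4],[0],[0,1,3,4],[0,1,4],[1]]" and M' = "[[4],[0],[0,1,3,4],[0,1],[1,3]]" and n = 3
        and ys = "[0,1,3,2]" and zs = "[0,2,3,1]" and T = "?L2C3" and T' = "?T2"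
        and us = "[0,4,1,3,2]" and ws = "[0,1,3,4,2]" and A = "?L4" and B = "?Wp"] by (simp add: adj_simps)
  have s2: "has K ?S4 \<Longrightarrow> has K ?T6 \<or> has K ?T8"
    using has_step[where M = "[[2,3,4],[0,4],[1],[1,2,4],[2]]" and M' = "[[2,3,4],[0,4],[1],[1,2],[2,3]]" and n = 3
        and ys = "[3,0,1,2]" and zs = "[2,3,0,1]" and T = "?T6" and T' = "?T8"
        and us = "[1,2,4,3,0]" and ws = "[1,2,3,4,0]" and A = "?S4" and B = "?S4"] by (simp add: adj_simps)
  have s3: "has K ?T2 \<Longrightarrow> has K ?T6 \<Longrightarrow> has K ?L2C3"
    using has_step[where M = "[[3],[0],[0,1,5],[1,2],[0,1,2,3,5],[0,1,3]]" and M' = "[[3],[0],[0,1,5],[1,2],[0,1,2,3],[0,1,3,4]]" and n = 4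
        and ys = "[0,1,2,3,4]" and zs = "[1,2,4,0,3]" and T = "?L2C3" and T' = "?L2C3"
        and us = "[0,3,1,5,4]" and ws = "[0,3,1,4,5]" and A = "?T2" and B = "?T6"] by (simp add: adj_simps)
  have s4: "has K ?T8 \<Longrightarrow> has K ?T2 \<Longrightarrow> has K ?T6 \<or> has K ?T42"
    using has_step[where M = "[[4,5],[0,4,5],[0,1],[0,1,2,5],[2,3,5],[2]]" and M' = "[[4,5],[0,4,5],[0,1],[0,1,2,5],[2,3],[2,4]]" and n = 4
        and ys = "[1,2,3,4,0]" and zs = "[1,2,3,4,0]" and T = "?T6" and T' = "?T42"
        and us = "[0,2,5,3,4]" and ws = "[4,2,5,0,1,3]" and A = "?T8" and B = "?T2"] by (simp add: adj_simps)
  have s5: "has K ?T10 \<Longrightarrow> has K ?T4 \<Longrightarrow> has K ?T7 \<or> has K ?T6"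
    using has_step[where M = "[[3,4],[0,5],[0,1,4,5],[1,2,5],[1,3,5],[0]]" and M' = "[[3,4],[0,5],[0,1,4,5],[1,2,5],[1,3],[0,4]]" and n = 4
        and ys = "[3,1,4,0,2]" and zs = "[0,2,3,4,1]" and T = "?T7" and T' = "?T6"
        and us = "[2,5,1,3,4]" and ws = "[4,5,1,2,3]" and A = "?T10" and B = "?T4"] by (simp add: adj_simps)
  have s6: "has K ?T4 \<Longrightarrow> has K ?T7 \<Longrightarrow> has K ?T3 \<or> has K ?T6"
    using has_step[where M = "[[4],[0],[0,1,5],[0,1,2],[1,2,3,5],[0,1,3]]" and M' = "[[4],[0],[0,1,5],[0,1,2],[1,2,3],[0,1,3,4]]" and n = 4
        and ys = "[0,1,2,3,4]" and zs = "[1,2,0,3,4]" and T = "?T3" and T' = "?T6"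
        and us = "[2,1,3,5,4]" and ws = "[4,0,1,5,2]" and A = "?T4" and B = "?T7"] by (simp add: adj_simps)
  have s7: "has K ?T3 \<Longrightarrow> has K ?T2 \<Longrightarrow> has K ?L2C3"
    using has_step[where M = "[[5],[0,4,5],[0,1],[0,1,2,4,5],[0,2,5],[2]]" and M' = "[[5],[0,4,5],[0,1],[0,1,2,4,5],[0,2],[2,4]]" and n = 4
        and ys = "[1,0,2,4,3]" and zs = "[1,2,3,4,0]" and T = "?L2C3" and T' = "?L2C3"
        and us = "[0,5,2,4,3]" and ws = "[0,5,4,1,3]" and A = "?T3" and B = "?T2"] by (simp add: adj_simps)
  \<comment> \<open>Both alternatives of \<open>s0\<close> lead here: \<open>?L4\<close> forces
    \<open>?T2\<close>, which contains \<open>?S4\<close>.\<close>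
  have "has K ?S4"
    using assms neg L3 s0 s1 T2_S4 by blast
  then have "has K ?L4"
    using s2 T6_L4 T8_L4 by blast
  then have T2: "has K ?T2"
    using assms neg s1 by blast
  \<comment> \<open>\<open>?T6\<close> is an alternative in \<open>s2\<close>, \<open>s4\<close>,
    \<open>s5\<close> and \<open>s6\<close>, so excluding it makes each of these steps
    deterministic.\<close>
  then have nT6: "\<not> has K ?T6"
    using neg s3 by blast
  then have "has K ?T42"
    using \<open>has K ?S4\<close> T2 s2 s4 by blast
  then have "has K ?T3"
    using nT6 T42_T4 T42_T10 s5 s6 by blast
  then show False
    using T2 neg s7 by blast
qed

end

section \<open>Classes derived from an amalgamation class\<close>

fun ordsum :: "('b \<Rightarrow> 'b \<Rightarrow> bool) \<Rightarrow> ('c \<Rightarrow> 'c \<Rightarrow> bool) \<Rightarrow> 'b + 'c \<Rightarrow> 'b + 'c \<Rightarrow> bool" where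
  "ordsum r q (Inl x) (Inl y) = r x y"
| "ordsum r q (Inl x) (Inr y) = True"
| "ordsum r q (Inr x) (Inl y) = False"
| "ordsum r q (Inr x) (Inr y) = q x y"

fun join :: "('b \<Rightarrow> 'b \<Rightarrow> bool) \<Rightarrow> (nat \<Rightarrow> 'b \<Rightarrow> bool) \<Rightarrow> 'b + nat \<Rightarrow> 'b + nat \<Rightarrow> bool" where
  "join r t (Inl x) (Inl y) = r x y"
| "join r t (Inl x) (Inr i) = (\<not> t i x)"
| "join r t (Inr i) (Inl x) = t i x"
| "join r t (Inr i) (Inr j) = (i < j)"

text \<open>A set of lengths is allowed because singletons serve the induction on the length and
  \<open>UNIV\<close> collects all lengths in one class.\<close>

definition below :: "nat set \<Rightarrow> (nat set \<Rightarrow> (nat \<Rightarrow> nat \<Rightarrow> bool) \<Rightarrow> bool) \<Rightarrow> nat set \<Rightarrow> (nat \<Rightarrow> nat \<Rightarrow> bool) \<Rightarrow> bool" where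
  "below N K S r \<longleftrightarrow> (\<forall>n\<in>N. member K ({..<n} <+> S) (ordsum (<) r))"

text \<open>Lachlan's construction, restricted to extensions by vertices with at most \<open>d\<close> in-neighbours in
  the given tournament.\<close>

definition linear_ext :: "nat \<Rightarrow> (nat set \<Rightarrow> (nat \<Rightarrow> nat \<Rightarrow> bool) \<Rightarrow> bool) \<Rightarrow> nat set \<Rightarrow> (nat \<Rightarrow> nat \<Rightarrow> bool) \<Rightarrow> bool" where
  "linear_ext d K S r \<longleftrightarrow> (\<forall>k t. (\<forall>i<k. card {s \<in> S. \<not> t i s} \<le> d) \<longrightarrow>
     member K (S <+> {..<k}) (join r t))"

definition reverse_class :: "(nat set \<Rightarrow> (nat \<Rightarrow> nat \<Rightarrow> bool) \<Rightarrow> bool) \<Rightarrow> nat set \<Rightarrow> (nat \<Rightarrow> nat \<Rightarrow> bool) \<Rightarrow> bool" where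
  "reverse_class K S r \<longleftrightarrow> K S (\<lambda>x y. r y x)"

lemma insert_Plus: "insert a A <+> B = insert (Inl a) (A <+> B)" "A <+> insert b B = insert (Inr b) (A <+> B)"
  by auto

lemma set_arc_ordsum: "set_arc (ordsum r q) (Inr a) (Inr b) = ordsum r (set_arc q a b)"
proof (intro ext)
  show "set_arc (ordsum r q) (Inr a) (Inr b) x y = ordsum r (set_arc q a b) x y" for x y
    by (cases x; cases y) (auto simp: set_arc_def)
qed

lemma set_arc_join: "set_arc (join r t) (Inl a) (Inl b) = join (set_arc r a b) t"
proof (intro ext)
  show "set_arc (join r t) (Inl a) (Inl b) x y = join (set_arc r a b) t x y" for x y
    by (cases x; cases y) (auto simp: set_arc_def)
qed

lemma inj_on_map_sum: "inj_on f A \<Longrightarrow> inj_on g B \<Longrightarrow> inj_on (map_sum f g) (A <+> B)"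
  by (rule inj_onI) (auto dest: inj_onD)

context amalgamation_class
begin

lemma reverse_class: "amalgamation_class (reverse_class K)"
proof
  fix S r assume "reverse_class K S r"
  then have *: "K S (\<lambda>x y. r y x)"
    by (simp add: reverse_class_def)
  then show "finite S"
    by (rule finite_class)
  show "tourn S r"
    using tourn_class[OF *] unfolding tourn_def by blast
next
  fix T r' and f :: "nat \<Rightarrow> nat" and S r
  assume *: "reverse_class K T r'" "inj_on f S" "f ` S \<subseteq> T"
    "\<And>x y. x \<in> S \<Longrightarrow> y \<in> S \<Longrightarrow> r x y \<longleftrightarrow> r' (f x) (f y)"
  show "reverse_class K S r"
    using hereditary[OF *(1)[unfolded reverse_class_def] *(2,3)] *(4) by (simp add: reverse_class_def)
next
  fix a b s :: nat and S r
  assume *: "reverse_class K (insert a S) r" "reverse_class K (insert b S) r" "a \<notin> S" "b \<notin> S"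
    "s \<in> S" "r s a \<noteq> r s b"
  have neq: "s \<noteq> a" "s \<noteq> b" "a \<noteq> b"
    using * by auto
  have "tourn (insert a S) r" "tourn (insert b S) r"
    using *(1,2) tourn_class by (auto simp: reverse_class_def tourn_def)
  then have "r a s \<noteq> r b s"
    using *(5,6) neq unfolding tourn_def by blast
  then have "K (insert a (insert b S)) (set_arc (\<lambda>x y. r y x) a b) \<or>
      K (insert a (insert b S)) (set_arc (\<lambda>x y. r y x) b a)"
    using amalgamation[of a S "\<lambda>x y. r y x" b s] * by (simp add: reverse_class_def)
  moreover have "set_arc (\<lambda>x y. r y x) c d = (\<lambda>x y. set_arc r d c y x)" for c d
    by (intro ext) (auto simp: set_arc_def)
  ultimately show "reverse_class K (insert a (insert b S)) (set_arc r a b) \<or>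
      reverse_class K (insert a (insert b S)) (set_arc r b a)"
    by (auto simp: reverse_class_def)
qed

text \<open>If the two orientations failed for lengths \<open>n1\<close> and \<open>n2\<close>, the
  larger of the two would refute both, since the shorter linear tournament is contained in it; and
  this larger length is again in \<open>N\<close>.\<close>

lemma below_class:
  assumes "N \<noteq> {}"
  shows "amalgamation_class (below N K)"
proof
  obtain n0 where n0: "n0 \<in> N"
    using assms by blast
  {
    fix S r assume "below N K S r"
    then have "member K ({..<n0} <+> S) (ordsum (<) r)"
      using n0 by (simp add: below_def)
    then have fin: "finite ({..<n0} <+> S)" and t: "tourn ({..<n0} <+> S) (ordsum (<) r)"
      by (rule member_finite, rule member_tourn)
    show "finite S"
      using fin by (simp add: finite_Plus_iff)
    show "tourn S r"
      unfolding tourn_def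
    proof (intro ballI)
      fix x y assume "x \<in> S" "y \<in> S"
      then have "Inr x \<in> {..<n0} <+> S" "Inr y \<in> {..<n0} <+> S"
        by auto
      then show "(x \<noteq> y \<longrightarrow> r x y \<or> r y x) \<and> \<not> (r x y \<and> r y x)"
        using t unfolding tourn_def by (metis ordsum.simps(4) sum.inject(2))
    qed
  next
    fix T r' and f :: "nat \<Rightarrow> nat" and S r
    assume *: "below N K T r'" "inj_on f S" "f ` S \<subseteq> T"
      "\<And>x y. x \<in> S \<Longrightarrow> y \<in> S \<Longrightarrow> r x y \<longleftrightarrow> r' (f x) (f y)"
    show "below N K S r"
      unfolding below_def
    proof
      fix n assume "n \<in> N"
      then have m: "member K ({..<n} <+> T) (ordsum (<) r')"
        using *(1) by (simp add: below_def)
      show "member K ({..<n} <+> S) (ordsum (<) r)"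
      proof (rule member_hereditary[OF m, where f = "map_sum (\<lambda>x. x) f"])
        show "inj_on (map_sum (\<lambda>x. x) f) ({..<n} <+> S)"
          using *(2) by (simp add: inj_on_map_sum)
        show "map_sum (\<lambda>x. x) f ` ({..<n} <+> S) \<subseteq> {..<n} <+> T"
          using *(3) by auto
      qed (use *(4) in auto)
    qed
  next
    fix a b s :: nat and S r
    assume *: "below N K (insert a S) r" "below N K (insert b S) r" "a \<notin> S" "b \<notin> S"
      "s \<in> S" "r s a \<noteq> r s b"
    show "below N K (insert a (insert b S)) (set_arc r a b) \<or>
        below N K (insert a (insert b S)) (set_arc r b a)"
    proof (rule ccontr)
      assume "\<not> ?thesis"
      then obtain n1 n2 where n: "n1 \<in> N" "n2 \<in> N"
        and not: "\<not> member K ({..<n1} <+> insert a (insert b S)) (ordsum (<) (set_arc r a b))"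
          "\<not> member K ({..<n2} <+> insert a (insert b S)) (ordsum (<) (set_arc r b a))"
        by (auto simp: below_def)
      define n where "n = max n1 n2"
      have "n \<in> N"
        using n by (simp add: n_def max_def)
      then have "member K (insert (Inr a) ({..<n} <+> S)) (ordsum (<) r)"
        "member K (insert (Inr b) ({..<n} <+> S)) (ordsum (<) r)"
        using *(1,2) by (simp_all add: below_def insert_Plus)
      then have "member K (insert (Inr a) (insert (Inr b) ({..<n} <+> S))) (set_arc (ordsum (<) r) (Inr a) (Inr b)) \<or>
        member K (insert (Inr a) (insert (Inr b) ({..<n} <+> S))) (set_arc (ordsum (<) r) (Inr b) (Inr a))"
        by (rule member_amalgamation[where s = "Inr s"]) (use *(3-6) in auto)
      then have "member K ({..<n} <+> insert a (insert b S)) (ordsum (<) (set_arc r a b)) \<or>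
        member K ({..<n} <+> insert a (insert b S)) (ordsum (<) (set_arc r b a))"
        by (simp add: insert_Plus set_arc_ordsum)
      moreover have "{..<n1} <+> insert a (insert b S) \<subseteq> {..<n} <+> insert a (insert b S)"
        "{..<n2} <+> insert a (insert b S) \<subseteq> {..<n} <+> insert a (insert b S)"
        by (auto simp: n_def)
      ultimately show False
        using not member_subset by blast
    qed
  }
qed

text \<open>Failing extensions for the two orientations are concatenated into one linear tournament.
  The bound \<open>d\<close> concerns each added vertex separately, so it survives. An amalgam over
  the concatenation has one of the orientations and contains the extension supposed to fail for
  it.\<close>

lemma linear_ext_class: "amalgamation_class (linear_ext d K)"
proof
  fix S r assume *: "linear_ext d K S r"
  have "member K (S <+> {..<0}) (join r (\<lambda>_ _. True))"
    using *[unfolded linear_ext_def, rule_format, of 0] by simp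
  then have fin: "finite (S <+> {..<0::nat})" and t: "tourn (S <+> {..<0}) (join r (\<lambda>_ _. True))"
    by (rule member_finite, rule member_tourn)
  show "finite S"
    using fin by (simp add: finite_Plus_iff)
  show "tourn S r"
    unfolding tourn_def
  proof (intro ballI)
    fix x y assume "x \<in> S" "y \<in> S"
    then have "Inl x \<in> S <+> {..<0::nat}" "Inl y \<in> S <+> {..<0::nat}"
      by auto
    then show "(x \<noteq> y \<longrightarrow> r x y \<or> r y x) \<and> \<not> (r x y \<and> r y x)"
      using t unfolding tourn_def by (metis join.simps(1) sum.inject(1))
  qed
next
  fix T r' and f :: "nat \<Rightarrow> nat" and S r
  assume *: "linear_ext d K T r'" "inj_on f S" "f ` S \<subseteq> T"
    "\<And>x y. x \<in> S \<Longrightarrow> y \<in> S \<Longrightarrow> r x y \<longleftrightarrow> r' (f x) (f y)"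
  show "linear_ext d K S r"
    unfolding linear_ext_def
  proof (intro allI impI)
    fix k :: nat and t :: "nat \<Rightarrow> nat \<Rightarrow> bool"
    assume k: "\<forall>i<k. card {s \<in> S. \<not> t i s} \<le> d"
    \<comment> \<open>Vertices of \<open>T\<close> outside the image become out-neighbours, so the
      number of in-neighbours stays the same.\<close>
    define t' where "t' i y = (y \<in> f ` S \<longrightarrow> t i (inv_into S f y))" for i y
    have t': "t' i (f x) = t i x" if "x \<in> S" for i x
      using that *(2) by (simp add: t'_def)
    have "{y \<in> T. \<not> t' i y} = f ` {s \<in> S. \<not> t i s}" for i
      using *(3) t' by (auto simp: t'_def)
    then have "card {y \<in> T. \<not> t' i y} = card {s \<in> S. \<not> t i s}" for i
      using *(2) by (metis (no_types, lifting) card_image inj_on_subset mem_Collect_eq subsetI)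
    then have m: "member K (T <+> {..<k}) (join r' t')"
      using *(1) k by (simp add: linear_ext_def)
    show "member K (S <+> {..<k}) (join r t)"
    proof (rule member_hereditary[OF m, where f = "map_sum f (\<lambda>x. x)"])
      show "inj_on (map_sum f (\<lambda>x. x)) (S <+> {..<k})"
        using *(2) by (simp add: inj_on_map_sum)
      show "map_sum f (\<lambda>x. x) ` (S <+> {..<k}) \<subseteq> T <+> {..<k}"
        using *(3) by auto
    qed (use *(4) t' in auto)
  qed
next
  fix a b s :: nat and S r
  assume *: "linear_ext d K (insert a S) r" "linear_ext d K (insert b S) r" "a \<notin> S" "b \<notin> S"
    "s \<in> S" "r s a \<noteq> r s b"
  show "linear_ext d K (insert a (insert b S)) (set_arc r a b) \<or>
      linear_ext d K (insert a (insert b S)) (set_arc r b a)"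
  proof (rule ccontr)
    let ?S = "insert a (insert b S)"
    assume "\<not> ?thesis"
    then obtain k1 t1 k2 t2
      where t1: "\<And>i. i < k1 \<Longrightarrow> card {s \<in> ?S. \<not> t1 i s} \<le> d"
        and t2: "\<And>i. i < k2 \<Longrightarrow> card {s \<in> ?S. \<not> t2 i s} \<le> d"
        and not: "\<not> member K (?S <+> {..<k1}) (join (set_arc r a b) t1)"
          "\<not> member K (?S <+> {..<k2}) (join (set_arc r b a) t2)"
      unfolding linear_ext_def by blast
    define k where "k = k1 + k2"
    define t where "t i = (if i < k1 then t1 i else t2 (i - k1))" for i
    have "linear_ext d K (insert a S) r \<Longrightarrow> member K (insert a S <+> {..<0}) (join r t)"
      unfolding linear_ext_def by (drule spec[of _ 0]) auto
    then have "finite (insert a S <+> {..<0::nat})"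
      using *(1) member_finite by blast
    then have fin: "finite ?S"
      by (simp add: finite_Plus_iff)
    have le: "card {s \<in> ?S. \<not> t i s} \<le> d" if "i < k" for i
      using t1[of i] t2[of "i - k1"] that by (auto simp: t_def k_def)
    then have sub: "card {s \<in> S'. \<not> t i s} \<le> d" if "S' \<subseteq> ?S" "i < k" for i S'
    proof -
      have "card {s \<in> S'. \<not> t i s} \<le> card {s \<in> ?S. \<not> t i s}"
        using that(1) fin by (intro card_mono) auto
      then show ?thesis
        using le[OF that(2)] by linarith
    qed
    have "member K (insert a S <+> {..<k}) (join r t)" "member K (insert b S <+> {..<k}) (join r t)"
      using *(1,2)[unfolded linear_ext_def, rule_format, of k t] sub[of "insert a S"] sub[of "insert b S"]
      by blast+
    then have "member K (insert (Inl a) (S <+> {..<k})) (join r t)" "member K (insert (Inl b) (S <+> {..<k})) (join r t)"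
      by (simp_all only: insert_Plus)
    then have "member K (insert (Inl a) (insert (Inl b) (S <+> {..<k}))) (set_arc (join r t) (Inl a) (Inl b)) \<or>
      member K (insert (Inl a) (insert (Inl b) (S <+> {..<k}))) (set_arc (join r t) (Inl b) (Inl a))"
      by (rule member_amalgamation[where s = "Inl s"]) (use *(3-6) in auto)
    then consider "member K (?S <+> {..<k}) (join (set_arc r a b) t)"
      | "member K (?S <+> {..<k}) (join (set_arc r b a) t)"
      by (auto simp: insert_Plus set_arc_join)
    then show False
    proof cases
      case 1
      have "member K (?S <+> {..<k1}) (join (set_arc r a b) t1)"
      proof (rule member_hereditary[OF 1, where f = "\<lambda>x. x"])
        fix x y assume "x \<in> ?S <+> {..<k1}" "y \<in> ?S <+> {..<k1}"
        then show "join (set_arc r a b) t1 x y = join (set_arc r a b) t x y"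
          by (cases x; cases y) (auto simp: t_def)
      qed (auto simp: k_def)
      then show ?thesis using not by blast
    next
      case 2
      have "member K (?S <+> {..<k2}) (join (set_arc r b a) t2)"
      proof (rule member_hereditary[OF 2, where f = "map_sum (\<lambda>x. x) (\<lambda>i. i + k1)"])
        fix x y assume "x \<in> ?S <+> {..<k2}" "y \<in> ?S <+> {..<k2}"
        then show "join (set_arc r b a) t2 x y = join (set_arc r b a) t
            (map_sum (\<lambda>x. x) (\<lambda>i. i + k1) x) (map_sum (\<lambda>x. x) (\<lambda>i. i + k1) y)"
          by (cases x; cases y) (auto simp: t_def)
      qed (auto simp: k_def intro!: inj_on_map_sum)
      then show ?thesis using not by blast
    qed
  qed
qed

end

section \<open>Linear tournaments and inserted 3-cycles obtained from \<open>W\<close>\<close>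

fun point_ext :: "('b \<Rightarrow> 'b \<Rightarrow> bool) \<Rightarrow> ('b \<Rightarrow> bool) \<Rightarrow> 'b option \<Rightarrow> 'b option \<Rightarrow> bool" where
  "point_ext r t (Some x) (Some y) = r x y"
| "point_ext r t (Some x) None = (\<not> t x)"
| "point_ext r t None (Some x) = t x"
| "point_ext r t None None = False"

text \<open>A 3-cycle on 0, 1, 2 and a vertex 3 dominating it: the obstruction to transitive
  out-neighbourhoods. In \<open>W2\<close> a further vertex 4 dominates everything.\<close>

definition W :: "nat list list" where
  "W = [[1], [2], [0], [0, 1, 2]]"

definition W2 :: "nat list list" where
  "W2 = [[1], [2], [0], [0, 1, 2], [0, 1, 2, 3]]"

lemma length_W [simp]: "length W = 4" "length W2 = 5"
  by (simp_all add: W_def W2_def)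

lemma lt_4: "i < 4 \<longleftrightarrow> i = 0 \<or> i = 1 \<or> i = 2 \<or> i = 3" for i :: nat
  by auto

lemma adj_4:
  "x < 4 \<Longrightarrow> y < 4 \<Longrightarrow> adj W2 x y \<longleftrightarrow> adj W x y"
  "y < 4 \<Longrightarrow> adj W2 4 y"
  "x < 4 \<Longrightarrow> \<not> adj W2 x 4"
  "\<not> adj W2 4 4"
  by (auto simp: lt_4 adj_def W_def W2_def)

context amalgamation_class
begin

lemma has_member: "has K L \<longleftrightarrow> member K {..<length L} (adj L)"
  by (simp add: has_def member_nat)

text \<open>In the derived class \<open>below {n} K\<close> the member \<open>W\<close> yields
  \<open>W2\<close>. The top vertex of \<open>W2\<close> is then counted as the last vertex of the
  linear tournament, whose length grows by one.\<close>

lemma has_below: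
  assumes "has K W"
  shows "has (below {n} K) W"
proof (induction n)
  case 0
  have m: "member K {..<4} (adj W)"
    using assms by (simp add: has_member numeral_eq_Suc)
  have "member K ({..<0::nat} <+> {..<4::nat}) (ordsum (<) (adj W))"
    by (rule member_hereditary[OF m, where f = "case_sum id id"]) (auto simp: inj_on_def)
  then show ?case
    by (simp add: has_def below_def numeral_eq_Suc)
next
  case (Suc n)
  interpret below: amalgamation_class "below {n} K"
    by (rule below_class) simp
  have m: "member K ({..<n} <+> {..<5}) (ordsum (<) (adj W2))"
    using below.has_two_dominating_C3[folded W_def W2_def, OF Suc] by (simp add: has_def below_def numeral_eq_Suc)
  have "member K ({..<Suc n} <+> {..<4::nat}) (ordsum (<) (adj W))"
  proof (rule member_hereditary[OF m])
    define h :: "nat + nat \<Rightarrow> nat + nat" where "h = case_sum (\<lambda>i. if i < n then Inl i else Inr 4) Inr"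
    show "inj_on h ({..<Suc n} <+> {..<4::nat})"
      by (rule inj_onI) (auto simp: h_def split: if_splits)
    show "h ` ({..<Suc n} <+> {..<4}) \<subseteq> {..<n} <+> {..<5}"
      by (auto simp: h_def)
    fix x y :: "nat + nat" assume "x \<in> {..<Suc n} <+> {..<4}" "y \<in> {..<Suc n} <+> {..<4}"
    then show "ordsum (<) (adj W) x y \<longleftrightarrow>
        ordsum (<) (adj W2) (h x) (h y)"
      by (cases x; cases y) (auto simp: h_def adj_4)
  qed
  then show ?case
    by (simp add: has_def below_def numeral_eq_Suc)
qed

lemma member_linear:
  assumes "has K W"
  shows "member K {..<m} ((<) :: nat \<Rightarrow> nat \<Rightarrow> bool)"
proof -
  have "member K ({..<m} <+> {..<4::nat}) (ordsum (<) (adj W))"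
    using has_below[OF assms, of m] by (simp add: has_def below_def numeral_eq_Suc)
  then show ?thesis
    by (rule member_hereditary[where f = Inl]) auto
qed

text \<open>Three consecutive vertices \<open>i\<close>, \<open>i + 1\<close>, \<open>i + 2\<close>
  of a linear tournament are turned into a 3-cycle. The part dominating the cycle comes from
  \<open>has_below\<close> in \<open>K\<close>; the dominated part comes from
  \<open>has_below\<close> in the reversal of \<open>below UNIV K\<close>, which contains
  \<open>W\<close> by \<open>has_C3_dominating\<close>.\<close>

lemma member_linear_C3_linear:
  fixes i m :: nat
  assumes "has K W" "i + 2 < m"
  shows "member K {..<m} (set_arc (<) (i + 2) i)"
proof -
  let ?K1 = "below UNIV K"
  interpret K1: amalgamation_class ?K1
    by (rule below_class) simp
  have W1: "has ?K1 W"
    using has_below[OF assms(1)] by (simp add: has_def below_def numeral_eq_Suc)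
  have "?K1 {..<4} (adj [[1,3],[2,3],[0,3],[]])"
    using K1.has_C3_dominating[folded W_def, OF W1] by (simp add: has_def numeral_eq_Suc)
  then have "?K1 {..<4} (\<lambda>x y. adj W y x)"
  \<comment> \<open>Exchanging 1 and 2 turns the direction of the 3-cycle around.\<close>
  proof (rule K1.hereditary[where f = "\<lambda>x. [0, 2, 1, 3] ! x"])
    show "inj_on ((!) [0, 2, 1, 3::nat]) {..<4}"
      by (rule inj_onI) (auto simp: lt_4)
    show "(!) [0, 2, 1, 3] ` {..<4} \<subseteq> {..<4::nat}"
      by (auto simp: lt_4)
    fix x y :: nat assume "x \<in> {..<4}" "y \<in> {..<4}"
    then show "adj W y x \<longleftrightarrow> adj [[1,3],[2,3],[0,3],[]] ([0, 2, 1, 3] ! x) ([0, 2, 1, 3] ! y)"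
      by (auto simp: lt_4 adj_def W_def)
  qed
  then have W2: "has (reverse_class ?K1) W"
    by (simp add: has_def reverse_class_def numeral_eq_Suc)
  interpret K2: amalgamation_class "reverse_class ?K1"
    by (rule K1.reverse_class)
  have "member (reverse_class ?K1) ({..<m} <+> {..<4::nat}) (ordsum (<) (adj W))"
    using K2.has_below[OF W2, of m] by (simp add: has_def below_def numeral_eq_Suc)
  then have "?K1 (to_nat ` ({..<m} <+> {..<4::nat})) (\<lambda>x y. ordsum (<) (adj W) (from_nat y :: nat + nat) (from_nat x))"
    by (simp add: member_def reverse_class_def)
  then have "member K ({..<i} <+> to_nat ` ({..<m} <+> {..<4::nat}))
      (ordsum (<) (\<lambda>x y. ordsum (<) (adj W) (from_nat y :: nat + nat) (from_nat x)))"
    by (simp add: below_def)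
  then show ?thesis
  proof (rule member_hereditary)
    \<comment> \<open>In the reversed class the linear part runs backwards, hence
      \<open>m - x\<close>; the order 0, 2, 1 follows the reversed 3-cycle of
      \<open>W\<close>.\<close>
    define f :: "nat \<Rightarrow> nat + nat" where
      "f x = (if x < i then Inl x else if x \<le> i + 2 then Inr (to_nat (Inr ([0, 2, 1] ! (x - i)) :: nat + nat))
        else Inr (to_nat (Inl (m - x) :: nat + nat)))" for x
    have f1: "f x = Inl x" if "x < i" for x
      using that by (simp add: f_def)
    have f2: "f i = Inr (to_nat (Inr 0 :: nat + nat))" "f (Suc i) = Inr (to_nat (Inr 2 :: nat + nat))"
      "f (Suc (Suc i)) = Inr (to_nat (Inr 1 :: nat + nat))"
      by (simp_all add: f_def)
    have f3: "f x = Inr (to_nat (Inl (m - x) :: nat + nat))" if "i + 2 < x" for x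
      using that by (simp add: f_def)
    have cases: "x < i \<or> x = i \<or> x = Suc i \<or> x = Suc (Suc i) \<or> i + 2 < x" for x
      by linarith
    show "f ` {..<m} \<subseteq> {..<i} <+> to_nat ` ({..<m} <+> {..<4::nat})"
    proof
      fix z assume "z \<in> f ` {..<m}"
      then obtain x where "z = f x" "x < m" by blast
      then show "z \<in> {..<i} <+> to_nat ` ({..<m} <+> {..<4::nat})"
        using cases[of x] f1[of x] f2 f3[of x] by (auto intro!: imageI)
    qed
    show "inj_on f {..<m}"
    proof (rule inj_onI)
      fix x y assume "x \<in> {..<m}" "y \<in> {..<m}" "f x = f y"
      then show "x = y"
        using cases[of x] cases[of y] f1[of x] f1[of y] f2 f3[of x] f3[of y] by (elim disjE) auto
    qed
    fix x y assume "x \<in> {..<m}" "y \<in> {..<m}"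
    then show "set_arc (<) (i + 2) i x y \<longleftrightarrow>
        ordsum (<) (\<lambda>x y. ordsum (<) (adj W) (from_nat y :: nat + nat) (from_nat x)) (f x) (f y)"
      using cases[of x] cases[of y] f1[of x] f1[of y] f2 f3[of x] f3[of y]
      by (elim disjE) (auto simp: set_arc_def adj_def W_def)
  qed
qed

end

section \<open>One-point extensions of linear tournaments\<close>

definition pattern :: "(nat set \<Rightarrow> (nat \<Rightarrow> nat \<Rightarrow> bool) \<Rightarrow> bool) \<Rightarrow> bool list \<Rightarrow> bool" where
  "pattern K bs \<longleftrightarrow> member K (insert None (Some ` {..<length bs})) (point_ext (<) ((!) bs))"

context amalgamation_class
begin

text \<open>The two positions are completed to a 3-cycle by a further vertex \<open>p\<close>.  Whichever arc
  joins \<open>p\<close> and the added point, \<open>p\<close> and one of the two positions show the swapped pattern.\<close>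

lemma pattern_swap:
  assumes "has K W" "pattern K (pre @ [False, True] @ post)"
  shows "pattern K (pre @ [True, False] @ post)"
proof -
  define i where "i = length pre"
  define n where "n = i + 2 + length post"
  \<comment> \<open>\<open>t\<close> gives the arcs of the added point once the vertex
    \<open>i + 2\<close> has been inserted. Its entry there is a placeholder that
    \<open>set_arc\<close> overrides in both amalgams.\<close>
  define t where "t x = (pre @ [False, True, False] @ post) ! x" for x
  define p where "p = (!) (pre @ [False, True] @ post)"
  define q where "q = (!) (pre @ [True, False] @ post)"
  let ?S = "Some ` ({..<Suc n} - {i + 2})"
  let ?r = "point_ext (set_arc (<) (i + 2) i) t"
  have t: "\<not> t i" "t (Suc i)"
    by (simp_all add: t_def i_def nth_append)
  have small: "x < i \<or> x = i \<or> x = Suc i \<or> (\<exists>z. x = i + Suc (Suc z))" for x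
    by presburger
  have p: "p x = t (if x < i + 2 then x else Suc x)" for x
    using small[of x] nth_append_length_plus[of pre] by (elim disjE exE) (auto simp: t_def p_def i_def nth_append)
  have q: "q i" "\<not> q (Suc i)" "\<And>x. x < i \<Longrightarrow> q x = t x"
    by (auto simp: t_def q_def i_def nth_append)
  have q_above: "q x = t (Suc x)" if "i + 2 \<le> x" for x
    using small[of x] that by (auto simp: t_def q_def i_def nth_append)
  note q = q q_above
  have len: "length (pre @ [False, True] @ post) = n" "length (pre @ [True, False] @ post) = n"
    by (simp_all add: n_def i_def)
  have "member K {..<Suc n} (set_arc (<) (i + 2) i)"
    using assms(1) by (rule member_linear_C3_linear) (simp add: n_def)
  then have "member K (insert (Some (i + 2)) ?S) ?r"
    by (rule member_hereditary[where f = the]) (auto simp: n_def inj_on_def)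
  moreover have "member K (insert None ?S) ?r"
  proof (rule member_hereditary[OF assms(2)[unfolded pattern_def len, folded p_def]])
    define f where "f = map_option (\<lambda>x. if x < i + 2 then x else x - 1)"
    have f: "f None = None" "f (Some x) = Some (if x < i + 2 then x else x - 1)" for x
      by (simp_all add: f_def)
    show "inj_on f (insert None ?S)"
      by (rule inj_onI) (auto simp: f split: if_splits)
    show "f ` insert None ?S \<subseteq> insert None (Some ` {..<n})"
      by (auto simp: f n_def intro!: imageI) linarith
    fix x y assume "x \<in> insert None ?S" "y \<in> insert None ?S"
    then show "?r x y = point_ext (<) p (f x) (f y)"
      by (cases x; cases y) (auto simp: f p set_arc_def)
  qed
  ultimately consider "member K (insert (Some (i + 2)) (insert None ?S)) (set_arc ?r (Some (i + 2)) None)"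
    | "member K (insert (Some (i + 2)) (insert None ?S)) (set_arc ?r None (Some (i + 2)))"
    using member_amalgamation[of "Some (i + 2)" ?S ?r None "Some i"] t
    by (auto simp: set_arc_def n_def)
  then show ?thesis
  proof cases
    case 1
    show ?thesis
      unfolding pattern_def len q_def[symmetric]
    proof (rule member_hereditary[OF 1])
      \<comment> \<open>The new vertex \<open>i + 2\<close> dominates the added point, so
        \<open>i + 1\<close> and \<open>i + 2\<close> show the entries \<open>True\<close>,
        \<open>False\<close>.\<close>
      define f where "f = map_option (\<lambda>x. if x < i then x else Suc x)"
      have f: "f None = None" "\<And>x. x < i \<Longrightarrow> f (Some x) = Some x" "\<And>x. i \<le> x \<Longrightarrow> f (Some x) = Some (Suc x)"
        by (simp_all add: f_def)
      show "inj_on f (insert None (Some ` {..<n}))"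
        by (rule inj_onI) (auto simp: f_def split: if_splits)
      show "f ` insert None (Some ` {..<n}) \<subseteq> insert (Some (i + 2)) (insert None ?S)"
        by (auto simp: f_def n_def intro!: imageI)
      have c: "x < i \<or> x = i \<or> x = Suc i \<or> i + 2 \<le> x" for x
        by linarith
      have qf: "q x \<longleftrightarrow> set_arc ?r (Some (i + 2)) None None (f (Some x))"
        "(\<not> q x) \<longleftrightarrow> set_arc ?r (Some (i + 2)) None (f (Some x)) None" for x
        using c[of x] q t by (elim disjE; auto simp: f set_arc_def)+
      fix x y assume "x \<in> insert None (Some ` {..<n})" "y \<in> insert None (Some ` {..<n})"
      then show "point_ext (<) q x y = set_arc ?r (Some (i + 2)) None (f x) (f y)"
        by (cases x; cases y) (auto simp: qf f(1), auto simp: f_def set_arc_def split: if_splits)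
    qed
  next
    case 2
    show ?thesis
      unfolding pattern_def len q_def[symmetric]
    proof (rule member_hereditary[OF 2])
      \<comment> \<open>The added point dominates \<open>i + 2\<close>. As \<open>i + 2\<close>
        dominates \<open>i\<close>, these two vertices in this order show \<open>True\<close>,
        \<open>False\<close>.\<close>
      define f where "f = map_option (\<lambda>x. if x < i then x else if x = i then i + 2 else if x = Suc i then i else Suc x)"
      have f: "f None = None" "\<And>x. x < i \<Longrightarrow> f (Some x) = Some x" "\<And>x. i + 2 \<le> x \<Longrightarrow> f (Some x) = Some (Suc x)"
        "f (Some i) = Some (i + 2)" "f (Some (Suc i)) = Some i"
        by (simp_all add: f_def)
      show "inj_on f (insert None (Some ` {..<n}))"
        by (rule inj_onI) (auto simp: f_def split: if_splits)
      show "f ` insert None (Some ` {..<n}) \<subseteq> insert (Some (i + 2)) (insert None ?S)"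
        by (auto simp: f_def n_def intro!: imageI)
      have c: "x < i \<or> x = i \<or> x = Suc i \<or> i + 2 \<le> x" for x
        by linarith
      have qf: "q x \<longleftrightarrow> set_arc ?r None (Some (i + 2)) None (f (Some x))"
        "(\<not> q x) \<longleftrightarrow> set_arc ?r None (Some (i + 2)) (f (Some x)) None" for x
        using c[of x] q t by (elim disjE; auto simp: f set_arc_def)+
      fix x y assume "x \<in> insert None (Some ` {..<n})" "y \<in> insert None (Some ` {..<n})"
      then show "point_ext (<) q x y = set_arc ?r None (Some (i + 2)) (f x) (f y)"
        by (cases x; cases y) (auto simp: qf f(1), auto simp: f_def set_arc_def split: if_splits)
    qed
  qed
qed

lemma pattern_move:
  assumes "has K W" "pattern K (pre @ replicate a False @ [True] @ post)"
  shows "pattern K (pre @ [True] @ replicate a False @ post)"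
  using assms(2)
proof (induction a arbitrary: post)
  case (Suc a)
  have "pattern K ((pre @ replicate a False) @ [False, True] @ post)"
    using Suc.prems by (simp add: replicate_app_Cons_same)
  from pattern_swap[OF assms(1) this] have "pattern K (pre @ replicate a False @ [True] @ (False # post))"
    by simp
  from Suc.IH[OF this] show ?case
    by (simp add: replicate_app_Cons_same)
qed simp

lemma pattern_sort:
  assumes "has K W"
  shows "pattern K (pre @ replicate (length (filter Not bs)) False @ replicate (length (filter (\<lambda>b. b) bs)) True) \<Longrightarrow>
    pattern K (pre @ bs)"
proof (induction bs arbitrary: pre)
  case (Cons b bs)
  show ?case
  proof (cases b)
    case True
    then have "pattern K (pre @ [True] @ replicate (length (filter Not bs)) False @ replicate (length (filter (\<lambda>b. b) bs)) True)"
      using Cons.prems pattern_move[OF assms, of pre _ "replicate (length (filter (\<lambda>b. b) bs)) True"] by simp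
    then show ?thesis
      using Cons.IH[of "pre @ [True]"] True by simp
  next
    case False
    then show ?thesis
      using Cons.IH[of "pre @ [False]"] Cons.prems by simp
  qed
qed simp

text \<open>With all \<open>False\<close> entries first, the added vertex fits between its
  in-neighbours and its out-neighbours, and the whole is a linear tournament. Swaps reach every
  other arrangement with the same numbers of entries.\<close>

lemma pattern_all:
  assumes "has K W"
  shows "pattern K bs"
proof -
  let ?a = "length (filter Not bs)" and ?b = "length (filter (\<lambda>b. b) bs)"
  have "pattern K (replicate ?a False @ replicate ?b True)"
    unfolding pattern_def
  proof (rule member_hereditary[OF member_linear[OF assms, of "Suc (?a + ?b)"]])
    define f where "f = case_option ?a (\<lambda>x. if x < ?a then x else Suc x)"
    show "inj_on f (insert None (Some ` {..<length (replicate ?a False @ replicate ?b True)}))"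
      by (rule inj_onI) (auto simp: f_def split: if_splits)
    show "f ` insert None (Some ` {..<length (replicate ?a False @ replicate ?b True)}) \<subseteq> {..<Suc (?a + ?b)}"
      by (auto simp: f_def)
    fix x y assume "x \<in> insert None (Some ` {..<length (replicate ?a False @ replicate ?b True)})"
      "y \<in> insert None (Some ` {..<length (replicate ?a False @ replicate ?b True)})"
    then show "point_ext (<) ((!) (replicate ?a False @ replicate ?b True)) x y \<longleftrightarrow> f x < f y"
      by (cases x; cases y) (auto simp: f_def nth_append)
  qed
  then show ?thesis
    using pattern_sort[OF assms, of "[]" bs] by simp
qed

end

section \<open>Lachlan's Ramsey argument\<close>

lemma tourn_subset: "tourn T r \<Longrightarrow> S \<subseteq> T \<Longrightarrow> tourn S r"
  unfolding tourn_def by blast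

text \<open>Beside a chosen vertex at least \<open>2 ^ Suc k - 1\<close> others remain, so its
  out-neighbourhood or its in-neighbourhood has \<open>2 ^ k\<close> vertices. The chosen vertex is
  put first or last accordingly.\<close>

lemma transitive_subtournament:
  assumes "finite V" "tourn V r" "2 ^ k \<le> card V"
  shows "\<exists>f. f ` {..<k} \<subseteq> V \<and> (\<forall>j<k. \<forall>i<j. r (f i) (f j))"
  using assms
proof (induction k arbitrary: V)
  case (Suc k)
  obtain v where v: "v \<in> V"
    using Suc.prems by fastforce
  define A where "A = {w \<in> V. r v w}"
  define B where "B = {w \<in> V. r w v}"
  have V: "V = insert v (A \<union> B)" and fin: "finite A" "finite B"
    using v Suc.prems(1,2) by (auto simp: A_def B_def tourn_def)
  have "card V \<le> Suc (card A + card B)"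
    unfolding V by (metis card_Un_le le_SucI card_insert_if fin finite_Un not_less_eq_eq)
  have t: "tourn A r" "tourn B r"
    using Suc.prems(2) by (auto intro: tourn_subset simp: A_def B_def)
  from \<open>card V \<le> _\<close> consider "2 ^ k \<le> card A" | "2 ^ k \<le> card B"
    using Suc.prems(3) by fastforce
  then show ?case
  proof cases
    case 1
    then obtain f where f: "f ` {..<k} \<subseteq> A" "\<forall>j<k. \<forall>i<j. r (f i) (f j)"
      using Suc.IH[OF fin(1) t(1)] by blast
    have fA: "f i \<in> V" "r v (f i)" if "i < k" for i
      using f(1) that by (auto simp: A_def)
    have "case_nat v f ` {..<Suc k} \<subseteq> V"
      using fA v by (auto split: nat.splits)
    moreover have "r (case_nat v f i) (case_nat v f j)" if "j < Suc k" "i < j" for i j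
      using that f(2) fA by (auto split: nat.splits)
    ultimately show ?thesis
      by blast
  next
    case 2
    then obtain f where f: "f ` {..<k} \<subseteq> B" "\<forall>j<k. \<forall>i<j. r (f i) (f j)"
      using Suc.IH[OF fin(2) t(2)] by blast
    have fB: "f i \<in> V" "r (f i) v" if "i < k" for i
      using f(1) that by (auto simp: B_def)
    have "(f(k := v)) ` {..<Suc k} \<subseteq> V"
      using fB v by auto
    moreover have "r ((f(k := v)) i) ((f(k := v)) j)" if "j < Suc k" "i < j" for i j
      using that f(2) fB by (auto simp: less_Suc_eq)
    ultimately show ?thesis
      by blast
  qed
qed auto

definition stack :: "('b \<Rightarrow> 'b \<Rightarrow> bool) \<Rightarrow> nat \<times> 'b \<Rightarrow> nat \<times> 'b \<Rightarrow> bool" where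
  "stack r p q \<longleftrightarrow> fst p < fst q \<or> fst p = fst q \<and> r (snd p) (snd q)"

context amalgamation_class
begin

text \<open>The vertices of \<open>V\<close> are amalgamated with \<open>w\<close> one at a time,
  which decides only the arcs between \<open>w\<close> and \<open>V\<close>. The distinguishing
  vertices lie in \<open>U\<close>, where \<open>r\<close> never changes.\<close>

lemma ext_point:
  assumes "finite V" "member K (U \<union> V) r" "member K (insert w U) r" "w \<notin> U \<union> V" "U \<inter> V = {}"
    and "\<And>v. v \<in> V \<Longrightarrow> \<exists>u\<in>U. r u v \<noteq> r u w"
  shows "\<exists>r'. (\<forall>x y. r' x y \<noteq> r x y \<longrightarrow> x = w \<and> y \<in> V \<or> x \<in> V \<and> y = w) \<and> member K (insert w (U \<union> V)) r'"
  using assms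
proof (induction V rule: finite_induct)
  case empty
  then show ?case
    by (intro exI[of _ r]) auto
next
  case (insert v V)
  have "member K (U \<union> V) r"
    using insert.prems(1) by (rule member_subset) auto
  then obtain r' where r': "\<And>x y. r' x y \<noteq> r x y \<Longrightarrow> x = w \<and> y \<in> V \<or> x \<in> V \<and> y = w"
    "member K (insert w (U \<union> V)) r'"
    using insert.IH insert.prems by auto
  have m: "member K (insert v (U \<union> V)) r'"
  proof -
    have "r' x y = r x y" if "x \<in> insert v (U \<union> V)" "y \<in> insert v (U \<union> V)" for x y
      using r'(1)[of x y] that insert.prems(3) by auto
    then show ?thesis
      using insert.prems(1) member_cong[of "insert v (U \<union> V)" r' r] by simp
  qed
  obtain u where u: "u \<in> U" "r u v \<noteq> r u w"
    using insert.prems(5) by blast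
  then have "r' u v \<noteq> r' u w"
    using r'(1)[of u v] r'(1)[of u w] insert.prems(3,4) insert.hyps by auto
  then have "member K (insert v (insert w (U \<union> V))) (set_arc r' v w) \<or>
      member K (insert v (insert w (U \<union> V))) (set_arc r' w v)"
    using u(1) insert.prems(3,4) insert.hyps
    by (intro member_amalgamation[OF m r'(2), of u]) auto
  moreover have "\<forall>x y. set_arc r' c d x y \<noteq> r x y \<longrightarrow>
      x = w \<and> y \<in> insert v V \<or> x \<in> insert v V \<and> y = w" if "c = v \<and> d = w \<or> c = w \<and> d = v" for c d
    using r'(1) that unfolding set_arc_def by blast
  moreover have "insert v (insert w (U \<union> V)) = insert w (U \<union> insert v V)"
    by auto
  ultimately show ?case
    by metis
qed

text \<open>Pairwise different types over \<open>U\<close> allow all points of \<open>V\<close> to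
  be added together. The arcs inside \<open>V\<close> are not controlled, and it is these that the
  passage to a transitive subset will settle.\<close>

lemma ext_points:
  assumes "finite V" "member K U r" "\<And>v. v \<in> V \<Longrightarrow> member K (insert v U) r" "U \<inter> V = {}"
    and "\<And>v w. v \<in> V \<Longrightarrow> w \<in> V \<Longrightarrow> v \<noteq> w \<Longrightarrow> \<exists>u\<in>U. r u v \<noteq> r u w"
  shows "\<exists>r'. (\<forall>x y. r' x y \<noteq> r x y \<longrightarrow> x \<in> V \<and> y \<in> V) \<and> member K (U \<union> V) r'"
  using assms
proof (induction V rule: finite_induct)
  case empty
  then show ?case
    by (intro exI[of _ r]) auto
next
  case (insert w V)
  obtain r' where r': "\<And>x y. r' x y \<noteq> r x y \<Longrightarrow> x \<in> V \<and> y \<in> V" "member K (U \<union> V) r'"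
    using insert.IH insert.prems by auto
  have m: "member K (insert w U) r'"
  proof -
    have "r' x y = r x y" if "x \<in> insert w U" "y \<in> insert w U" for x y
      using r'(1)[of x y] that insert.prems(3) insert.hyps by auto
    then show ?thesis
      using insert.prems(2)[of w] member_cong[of "insert w U" r' r] by simp
  qed
  have dist: "\<exists>u\<in>U. r' u v \<noteq> r' u w" if v: "v \<in> V" for v
  proof -
    obtain u where "u \<in> U" "r u v \<noteq> r u w"
      using insert.prems(4)[of v w] v insert.hyps by auto
    then show ?thesis
      using r'(1)[of u v] r'(1)[of u w] insert.prems(3) by auto
  qed
  have "\<exists>r''. (\<forall>x y. r'' x y \<noteq> r' x y \<longrightarrow> x = w \<and> y \<in> V \<or> x \<in> V \<and> y = w) \<and>
      member K (insert w (U \<union> V)) r''"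
    by (rule ext_point[OF insert.hyps(1) r'(2) m _ _ dist]) (use insert in auto)
  then obtain r'' where "\<And>x y. r'' x y \<noteq> r' x y \<Longrightarrow> x = w \<and> y \<in> V \<or> x \<in> V \<and> y = w"
      "member K (insert w (U \<union> V)) r''"
    by blast
  then show ?case
    using r'(1) by (intro exI[of _ r'']) (simp, metis)
qed

text \<open>Many points are added to a linear sum of copies of \<open>C\<close>, one copy for every assignment of types
  to points; a transitive subset of the points then has the desired types over one of the copies.\<close>

lemma linear_ext_stack:
  assumes C: "finite C" "c0 \<in> C" and d: "0 < d"
    and ext: "\<And>N t. (\<And>n. n < N \<Longrightarrow> card {c \<in> C. \<not> t (n, c)} \<le> d) \<Longrightarrow>
      member K (insert None (Some ` ({..<N} \<times> C))) (point_ext (stack r) t)"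
  shows "linear_ext d K C r"
  unfolding linear_ext_def
proof (intro allI impI)
  fix k :: nat and t0 :: "nat \<Rightarrow> nat \<Rightarrow> bool"
  assume t0: "\<forall>i<k. card {c \<in> C. \<not> t0 i c} \<le> d"
  text \<open>Two distinct extra types are available, so that different points get different types.\<close>
  define t where "t i c = (if i < k then t0 i c else i = k \<or> c \<noteq> c0)" for i c
  have t: "card {c \<in> C. \<not> t i c} \<le> d" if "i < k + 2" for i
  proof (cases "i < k")
    case False
    then have "{c \<in> C. \<not> t i c} \<subseteq> {c0}"
      by (auto simp: t_def)
    then have "card {c \<in> C. \<not> t i c} \<le> 1"
      using card_mono[of "{c0}"] by fastforce
    then show ?thesis using d by linarith
  qed (use t0 in \<open>simp add: t_def\<close>)
  define F where "F = ({..<2 ^ k} :: nat set) \<rightarrow>\<^sub>E {..<k + 2}"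
  have "finite F"
    by (simp add: F_def finite_PiE)
  then obtain e where e: "bij_betw e {..<card F} F"
    using ex_bij_betw_nat_finite by (auto simp: atLeast0LessThan)
  have eF: "\<exists>n<card F. e n = \<sigma>" if "\<sigma> \<in> F" for \<sigma>
    using that bij_betw_imp_surj_on[OF e] by (metis imageE lessThan_iff)
  define T where "T v p = t (e (fst p) v) (snd p)" for v p
  let ?U = "Inl ` ({..<card F} \<times> C)" and ?V = "Inr ` {..<2 ^ k} :: ((nat \<times> nat) + nat) set"
  let ?r = "join (stack r) T"
  have ev: "e n v < k + 2" if "n < card F" "v < 2 ^ k" for n v
  proof -
    have "e n \<in> F"
      using bij_betw_apply[OF e] that by auto
    then show ?thesis
      using that(2) by (auto simp: F_def PiE_iff)
  qed
  have one: "member K (insert (Inr v) ?U) ?r" if "v < 2 ^ k" for v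
  proof -
    have "member K (insert None (Some ` ({..<card F} \<times> C))) (point_ext (stack r) (T v))"
      by (rule ext) (use that ev t in \<open>simp add: T_def\<close>)
    then show ?thesis
    proof (rule member_hereditary)
      let ?f = "case_sum Some (\<lambda>_. None)"
      show "inj_on ?f (insert (Inr v) ?U)"
        by (rule inj_onI) auto
      show "?f ` insert (Inr v) ?U \<subseteq> insert None (Some ` ({..<card F} \<times> C))"
        by auto
      fix x y assume "x \<in> insert (Inr v) ?U" "y \<in> insert (Inr v) ?U"
      then show "?r x y = point_ext (stack r) (T v) (?f x) (?f y)"
        by auto
    qed
  qed
  have dist: "\<exists>u\<in>?U. ?r u v \<noteq> ?r u w" if "v \<in> ?V" "w \<in> ?V" "v \<noteq> w" for v w
  proof -
    obtain i j where ij: "v = Inr i" "w = Inr j" "i < 2 ^ k" "j < 2 ^ k" "i \<noteq> j"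
      using \<open>v \<in> ?V\<close> \<open>w \<in> ?V\<close> \<open>v \<noteq> w\<close> by auto
    \<comment> \<open>In this copy \<open>i\<close> has type \<open>k\<close> and every other point
      type \<open>k + 1\<close>; the two types differ at \<open>c0\<close>.\<close>
    define \<sigma> where "\<sigma> = (\<lambda>x\<in>{..<2 ^ k}. if x = i then k else k + 1)"
    have "\<sigma> \<in> F"
      by (auto simp: F_def \<sigma>_def)
    then obtain n where n: "n < card F" "e n = \<sigma>"
      using eF by blast
    have "?r (Inl (n, c0)) v \<noteq> ?r (Inl (n, c0)) w"
      using ij n by (simp add: T_def t_def \<sigma>_def)
    then show ?thesis
      using n(1) C(2) by blast
  qed
  have "member K ?U ?r"
    using one[of 0] by (rule member_subset) auto
  then have "\<exists>r'. (\<forall>x y. r' x y \<noteq> ?r x y \<longrightarrow> x \<in> ?V \<and> y \<in> ?V) \<and> member K (?U \<union> ?V) r'"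
    by (rule ext_points[OF _ _ _ _ dist, rotated]) (use one in auto)
  then obtain r' where r': "\<And>x y. r' x y \<noteq> ?r x y \<Longrightarrow> x \<in> ?V \<and> y \<in> ?V" "member K (?U \<union> ?V) r'"
    by blast
  have "tourn ?V r'"
    using member_tourn[OF r'(2)] by (rule tourn_subset) auto
  moreover have "card ?V = 2 ^ k"
    by (simp add: card_image)
  ultimately obtain f where f: "f ` {..<k} \<subseteq> ?V" "\<And>i j. j < k \<Longrightarrow> i < j \<Longrightarrow> r' (f i) (f j)"
    using transitive_subtournament[of ?V r' k] by auto
  have neq: "f i \<noteq> f j" if "i < k" "j < k" "i \<noteq> j" for i j
    using f(2)[of i j] f(2)[of j i] f(1) that \<open>tourn ?V r'\<close> unfolding tourn_def
    by (metis image_subset_iff lessThan_iff linorder_neqE_nat)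
  \<comment> \<open>The copy looked for gives the \<open>i\<close>-th vertex of the transitive
    subset the type \<open>i\<close>; points outside the subset receive \<open>k\<close> as a
    default.\<close>
  define \<sigma> where "\<sigma> = (\<lambda>x\<in>{..<2 ^ k}. if \<exists>i<k. f i = Inr x then THE i. i < k \<and> f i = Inr x else k)"
  have fS: "\<exists>x. f i = Inr x \<and> x < 2 ^ k \<and> \<sigma> x = i" if "i < k" for i
  proof -
    obtain x where x: "f i = Inr x" "x < 2 ^ k"
      using f(1) \<open>i < k\<close> by blast
    have "(THE i. i < k \<and> f i = Inr x) = i"
      using neq x \<open>i < k\<close> by (intro the_equality) metis+
    then show ?thesis
      using x \<open>i < k\<close> by (auto simp: \<sigma>_def)
  qed
  have "\<sigma> x < k + 2" if "x < 2 ^ k" for x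
  proof (cases "\<exists>i<k. f i = Inr x")
    case True
    then obtain i where "i < k" "f i = Inr x" by blast
    then show ?thesis using fS[of i] by auto
  next
    case False
    then have "\<sigma> x = k"
      using that unfolding \<sigma>_def by (simp only: restrict_apply' lessThan_iff if_False)
    then show ?thesis by simp
  qed
  then have "\<sigma> \<in> F"
    by (simp add: F_def PiE_iff \<sigma>_def del: restrict_apply)
  then obtain n where n: "n < card F" "e n = \<sigma>"
    using eF by blast
  show "member K (C <+> {..<k}) (join r t0)"
  proof (rule member_hereditary[OF r'(2)])
    let ?g = "case_sum (\<lambda>c. Inl (n, c)) f"
    show "inj_on ?g (C <+> {..<k})"
    proof (rule inj_onI)
      fix x y assume "x \<in> C <+> {..<k}" "y \<in> C <+> {..<k}" "?g x = ?g y"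
      then show "x = y"
        using neq fS by (cases x; cases y) (auto, (metis Inl_Inr_False)+)
    qed
    show "?g ` (C <+> {..<k}) \<subseteq> ?U \<union> ?V"
      using n(1) f(1) by auto
    fix x y assume xy: "x \<in> C <+> {..<k}" "y \<in> C <+> {..<k}"
    show "join r t0 x y = r' (?g x) (?g y)"
    proof (cases x)
      case x: (Inl c)
      then have "r' (?g x) (?g y) = ?r (?g x) (?g y)"
        using r'(1)[of "?g x" "?g y"] by auto
      then show ?thesis
        using x xy fS n(2) by (cases y) (fastforce simp: stack_def T_def t_def)+
    next
      case x: (Inr i)
      show ?thesis
      proof (cases y)
        case y: (Inl c)
        then have "r' (?g x) (?g y) = ?r (?g x) (?g y)"
          using r'(1)[of "?g x" "?g y"] by auto
        then show ?thesis
          using x y xy fS n(2) by (fastforce simp: stack_def T_def t_def)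
      next
        case y: (Inr j)
        have ij: "i < k" "j < k"
          using x y xy by auto
        have "r' (f i) (f j) \<longleftrightarrow> i < j"
          using f(2)[of i j] f(2)[of j i] ij f(1) \<open>tourn ?V r'\<close> unfolding tourn_def
          by (metis image_subset_iff lessThan_iff linorder_neqE_nat)
        then show ?thesis
          using x y by simp
      qed
    qed
  qed
qed

end

lemma transitive_tournament_rank:
  assumes "finite X" "tourn X r" and trans: "transp_on X r"
  shows "\<exists>f. bij_betw f X {..<card X} \<and> (\<forall>x\<in>X. \<forall>y\<in>X. r x y \<longleftrightarrow> f x < f y)"
proof (intro exI conjI)
  define f where "f x = card {z \<in> X. r z x}" for x
  have irr: "\<not> r x x" if "x \<in> X" for x
    using assms(2) that unfolding tourn_def by blast
  have mono: "f x < f y" if "x \<in> X" "y \<in> X" "r x y" for x y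
    unfolding f_def
  proof (rule psubset_card_mono)
    show "{z \<in> X. r z x} \<subset> {z \<in> X. r z y}"
      using that transp_onD[OF trans _ that(1,2)] irr by blast
  qed (use assms(1) in simp)
  show iff: "\<forall>x\<in>X. \<forall>y\<in>X. r x y \<longleftrightarrow> f x < f y"
  proof (intro ballI)
    fix x y assume "x \<in> X" "y \<in> X"
    moreover have "x = y \<or> r x y \<or> r y x"
      using assms(2) calculation unfolding tourn_def by blast
    ultimately show "r x y \<longleftrightarrow> f x < f y"
      using mono[of x y] mono[of y x] irr by fastforce
  qed
  have inj: "inj_on f X"
  proof (rule inj_onI)
    fix x y assume "x \<in> X" "y \<in> X" "f x = f y"
    then show "x = y"
      using iff assms(2) unfolding tourn_def by (metis less_irrefl)
  qed
  have "f x < card X" if "x \<in> X" for x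
    unfolding f_def using that irr assms(1) by (intro psubset_card_mono) auto
  then have "f ` X \<subseteq> {..<card X}"
    by auto
  then have "f ` X = {..<card X}"
    using inj by (intro card_subset_eq) (simp_all add: card_image)
  then show "bij_betw f X {..<card X}"
    using inj by (simp add: bij_betw_def)
qed

context amalgamation_class
begin

text \<open>A stack of linear tournaments is itself linear, so its one-point extensions are patterns
  and \<open>pattern_all\<close> applies.\<close>

lemma linear_ext_linear:
  assumes "has K W" "0 < d"
  shows "linear_ext d K {..<m} (<)"
proof -
  interpret ext: amalgamation_class "linear_ext d K"
    by (rule linear_ext_class)
  \<comment> \<open>One vertex more than wanted, because \<open>linear_ext_stack\<close> asks for an
    element of the copied tournament.\<close>
  have "linear_ext d K {..<Suc m} (<)"
  proof (rule linear_ext_stack[OF _ _ assms(2)])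
    fix N :: nat and t :: "nat \<times> nat \<Rightarrow> bool"
    define M where "M = Suc m"
    define bs where "bs = map (\<lambda>x. t (x div M, x mod M)) [0..<N * M]"
    have len: "length bs = N * M"
      by (simp add: bs_def)
    have m: "member K (insert None (Some ` {..<N * M})) (point_ext (<) ((!) bs))"
      using pattern_all[OF assms(1), of bs] by (simp add: pattern_def len)
    show "member K (insert None (Some ` ({..<N} \<times> {..<Suc m}))) (point_ext (stack (<)) t)"
    proof (rule member_hereditary[OF m])
      define f where "f = map_option (\<lambda>(n, c). n * M + c)"
      have f: "f None = None" "f (Some (n, c)) = Some (n * M + c)" for n c
        by (simp_all add: f_def)
      have lt: "n * M + c < n' * M + c' \<longleftrightarrow> n < n' \<or> n = n' \<and> c < c'" if "c < M" "c' < M" for n n' c c'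
      proof -
        have *: "n * M + c < n' * M + c'" if "n < n'" "c < M" for n n' c c'
        proof -
          have "Suc n * M \<le> n' * M"
            using that by (intro mult_le_mono1) simp
          then show ?thesis using that(2) by simp
        qed
        show ?thesis
          using *[of n n' c c'] *[of n' n c' c] that by (cases n n' rule: linorder_cases) auto
      qed
      have bound: "n * M + c < N * M" if "n < N" "c < M" for n c
        using lt[of c 0 n N] that by (simp add: M_def)
      show "inj_on f (insert None (Some ` ({..<N} \<times> {..<Suc m})))"
      proof (rule inj_onI)
        fix x y assume "x \<in> insert None (Some ` ({..<N} \<times> {..<Suc m}))" "y \<in> insert None (Some ` ({..<N} \<times> {..<Suc m}))" "f x = f y"
        then show "x = y"
          using lt unfolding M_def[symmetric]
          by (auto simp: f) (metis less_irrefl linorder_neqE_nat)+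
      qed
      show "f ` insert None (Some ` ({..<N} \<times> {..<Suc m})) \<subseteq> insert None (Some ` {..<N * M})"
        using bound unfolding M_def[symmetric] by (auto simp: f intro!: imageI)
      have bs: "bs ! (n * M + c) = t (n, c)" if "n < N" "c < M" for n c
        using bound[OF that] that by (simp add: bs_def)
      fix x y assume "x \<in> insert None (Some ` ({..<N} \<times> {..<Suc m}))" "y \<in> insert None (Some ` ({..<N} \<times> {..<Suc m}))"
      then show "point_ext (stack (<)) t x y = point_ext (<) ((!) bs) (f x) (f y)"
        unfolding M_def[symmetric] by (auto simp: f bs lt stack_def)
    qed
  qed auto
  then show ?thesis
    by (rule ext.hereditary[where f = "\<lambda>x. x"]) auto
qed

text \<open>One transitive set is the base and the other is the linear tournament added to it. A
  bound larger than the base admits all arcs between the two.\<close>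

lemma member_two_transitive:
  assumes K: "has K W" and S: "finite S" "tourn S r" "S = X \<union> Y" "X \<inter> Y = {}"
    and X: "transp_on X r" and Y: "transp_on Y r"
  shows "member K S r"
proof -
  have fin: "finite X" "finite Y" and t: "tourn X r" "tourn Y r"
    using S by (auto intro: tourn_subset)
  obtain f where f: "bij_betw f X {..<card X}" "\<And>x y. x \<in> X \<Longrightarrow> y \<in> X \<Longrightarrow> r x y \<longleftrightarrow> f x < f y"
    using transitive_tournament_rank[OF fin(1) t(1) X] by blast
  obtain g where g: "bij_betw g Y {..<card Y}" "\<And>x y. x \<in> Y \<Longrightarrow> y \<in> Y \<Longrightarrow> r x y \<longleftrightarrow> g x < g y"
    using transitive_tournament_rank[OF fin(2) t(2) Y] by blast
  define p where "p i s = r (inv_into Y g i) (inv_into X f s)" for i s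
  have p: "p (g y) (f x) = r y x" if "x \<in> X" "y \<in> Y" for x y
    using that f(1) g(1) by (simp add: p_def bij_betw_inv_into_left)
  have "card {s \<in> {..<card X}. \<not> p i s} \<le> Suc (card X)" for i
  proof -
    have "card {s \<in> {..<card X}. \<not> p i s} \<le> card {..<card X}"
      by (intro card_mono) auto
    then show ?thesis
      by simp
  qed
  then have m: "member K ({..<card X} <+> {..<card Y}) (join (<) p)"
    using linear_ext_linear[OF K, of "Suc (card X)" "card X"] by (simp add: linear_ext_def)
  show ?thesis
  proof (rule member_hereditary[OF m])
    define h where "h z = (if z \<in> X then Inl (f z) else Inr (g z))" for z
    have h: "h x = Inl (f x)" "h y = Inr (g y)" if "x \<in> X" "y \<in> Y" for x y
      using that S(4) by (auto simp: h_def)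
    show "inj_on h S"
      using f(1) g(1) S(3) by (auto simp: h_def inj_on_def bij_betw_def)
    show "h ` S \<subseteq> {..<card X} <+> {..<card Y}"
      using f(1) g(1) S(3,4) by (auto simp: h_def bij_betw_def)
    have flip: "r x y \<longleftrightarrow> \<not> r y x" if "x \<in> X" "y \<in> Y" for x y
    proof -
      have "x \<in> S" "y \<in> S" "x \<noteq> y"
        using that S(3,4) by auto
      then show ?thesis
        using S(2) unfolding tourn_def by blast
    qed
    fix x y assume "x \<in> S" "y \<in> S"
    then consider "x \<in> X" "y \<in> X" | "x \<in> X" "y \<in> Y" | "x \<in> Y" "y \<in> X" | "x \<in> Y" "y \<in> Y"
      using S(3) by blast
    then show "r x y = join (<) p (h x) (h y)"
    proof cases
      case 1
      then show ?thesis
        using f(2)[OF 1] by (simp add: h_def)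
    next
      case 2
      then show ?thesis
        using p[OF 2] flip[OF 2] h[OF 2] by simp
    next
      case 3
      then show ?thesis
        using p[OF 3(2,1)] h[OF 3(2,1)] by simp
    next
      case 4
      then have "x \<notin> X" "y \<notin> X"
        using S(4) by auto
      then show ?thesis
        using g(2)[OF 4] by (simp add: h_def)
    qed
  qed
qed

section \<open>Survival of \<open>W\<close> in the derived class\<close>

lemma tourn_W: "tourn {..<4} (adj W)"
  by (auto simp: tourn_def lt_4 adj_def W_def)

lemma tourn_stack: "tourn C r \<Longrightarrow> tourn (A \<times> C) (stack r)"
  unfolding tourn_def stack_def by (auto simp: prod_eq_iff)

lemma tourn_point_ext: "tourn S r \<Longrightarrow> tourn (insert None (Some ` S)) (point_ext r t)"
  unfolding tourn_def by auto

text \<open>Each 3-cycle contains an out-neighbour of the added point; these out-neighbours together with the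
  added point form one transitive set, and the remaining vertices another.\<close>

lemma linear_ext_W:
  assumes "has K W"
  shows "linear_ext 2 K {..<4} (adj W)"
proof (rule linear_ext_stack[of _ 0])
  fix N and t :: "nat \<times> nat \<Rightarrow> bool"
  assume t: "\<And>n. n < N \<Longrightarrow> card {c \<in> {..<4}. \<not> t (n, c)} \<le> 2"
  have "\<exists>c<3. t (n, c)" if "n < N" for n
  proof (rule ccontr)
    assume "\<not> ?thesis"
    then have "card {..<3::nat} \<le> card {c \<in> {..<4}. \<not> t (n, c)}"
      by (intro card_mono) auto
    then show False
      using t[OF that] by simp
  qed
  then obtain p where p: "\<And>n. n < N \<Longrightarrow> p n < 3 \<and> t (n, p n)"
    by metis
  let ?S = "insert None (Some ` ({..<N} \<times> {..<4::nat}))"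
  let ?Y = "insert None (Some ` ((\<lambda>n. (n, p n)) ` {..<N}))"
  show "member K ?S (point_ext (stack (adj W)) t)"
  proof (rule member_two_transitive[OF assms])
    show "finite ?S" by simp
    show "tourn ?S (point_ext (stack (adj W)) t)"
      by (intro tourn_point_ext tourn_stack tourn_W)
    have "?Y \<subseteq> ?S"
      using p by fastforce
    then show "?S = (?S - ?Y) \<union> ?Y"
      by blast
    show "(?S - ?Y) \<inter> ?Y = {}"
      by blast
    \<comment> \<open>Deleting a vertex \<open>q\<close> of its 3-cycle leaves \<open>W\<close>
      transitive; this is what remains of each copy.\<close>
    have W: "adj W a c" if "adj W a b" "adj W b c" "a \<noteq> q" "b \<noteq> q" "c \<noteq> q" "q < 3" "a < 4" "b < 4" "c < 4" for a b c q
      using that by (auto simp: lt_4 adj_def W_def numeral_3_eq_3 less_Suc_eq)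
    show "transp_on (?S - ?Y) (point_ext (stack (adj W)) t)"
    proof (rule transp_onI)
      fix x y z assume xyz: "x \<in> ?S - ?Y" "y \<in> ?S - ?Y" "z \<in> ?S - ?Y"
        and r: "point_ext (stack (adj W)) t x y" "point_ext (stack (adj W)) t y z"
      obtain n1 c1 n2 c2 n3 c3 where eq: "x = Some (n1, c1)" "y = Some (n2, c2)" "z = Some (n3, c3)"
        and lt: "n1 < N" "n2 < N" "n3 < N" "c1 < 4" "c2 < 4" "c3 < 4" and neq: "c1 \<noteq> p n1" "c2 \<noteq> p n2" "c3 \<noteq> p n3"
      proof -
        have "\<exists>n c. z = Some (n, c) \<and> n < N \<and> c < 4 \<and> c \<noteq> p n" if "z \<in> ?S - ?Y" for z
          using that by (auto simp: image_iff)
        from this[OF xyz(1)] this[OF xyz(2)] this[OF xyz(3)] show ?thesis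
          using that by blast
    qed
    show "point_ext (stack (adj W)) t x z"
      using r lt neq p[of n1] W[of c1 c2 c3 "p n1"] by (auto simp: eq stack_def)
    qed
  next
    show "transp_on ?Y (point_ext (stack (adj W)) t)"
    proof (rule transp_onI)
      fix x y z assume xyz: "x \<in> ?Y" "y \<in> ?Y" "z \<in> ?Y"
        and r: "point_ext (stack (adj W)) t x y" "point_ext (stack (adj W)) t y z"
      \<comment> \<open>Only one vertex per copy is chosen, so inside \<open>?Y\<close> the arcs
        between chosen vertices follow the numbers of the copies, and the added point dominates them
        all.\<close>
      have irr: "\<not> adj W (p n) (p n)" if "n < N" for n
      proof -
        have "p n \<in> {..<4}"
          using p[OF that] by auto
        then show ?thesis
          using tourn_W unfolding tourn_def by blast
    qed
    show "point_ext (stack (adj W)) t x z"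
      using xyz r p irr by (auto simp: stack_def)
    qed
  qed
qed auto

end

text \<open>The induction hypothesis is used for \<open>linear_ext d K\<close> instead of
  \<open>K\<close>: the first \<open>n\<close> vertices form a member of the derived class, and this
  says in particular that the next vertex, having at most \<open>d\<close> in-neighbours among them,
  may be added as a linear tournament of length one.\<close>

lemma sparse_tournament:
  assumes lift: "\<And>K. amalgamation_class K \<Longrightarrow> has K W \<Longrightarrow> has (linear_ext d K) W"
    and "amalgamation_class K" "has K W" "tourn {..<n} r" "\<And>i. i < n \<Longrightarrow> card {j \<in> {..<i}. \<not> r i j} \<le> d"
  shows "K {..<n} r"
  using assms(2-)
proof (induction n arbitrary: K)
  case 0
  then interpret amalgamation_class K by simp
  show ?case
    using 0(2) unfolding has_def by (rule hereditary[where f = id]) auto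
next
  case (Suc n)
  interpret amalgamation_class K by fact
  have ext: "linear_ext d K {..<n} r"
  proof (rule Suc.IH)
    show "amalgamation_class (linear_ext d K)" "has (linear_ext d K) W"
      using linear_ext_class lift Suc.prems(1,2) by auto
    show "tourn {..<n} r"
      using Suc.prems(3) by (rule tourn_subset) auto
    show "card {j \<in> {..<i}. \<not> r i j} \<le> d" if "i < n" for i
      using Suc.prems(4) that by simp
  qed
  have m: "member K ({..<n} <+> {..<1}) (join r (\<lambda>_. r n))"
    using Suc.prems(4)[of n] by (intro ext[unfolded linear_ext_def, rule_format]) simp
  have "member K {..<Suc n} r"
  proof (rule member_hereditary[OF m])
    define f :: "nat \<Rightarrow> nat + nat" where "f x = (if x < n then Inl x else Inr 0)" for x
    show "inj_on f {..<Suc n}"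
      by (rule inj_onI) (auto simp: f_def split: if_splits)
    show "f ` {..<Suc n} \<subseteq> {..<n} <+> {..<1}"
      by (auto simp: f_def)
    fix x y assume "x \<in> {..<Suc n}" "y \<in> {..<Suc n}"
    moreover have "r x n \<longleftrightarrow> \<not> r n x" if "x < n"
      using Suc.prems(3) that unfolding tourn_def by (metis lessThan_iff less_Suc_eq nat_neq_iff)
    moreover have "\<not> r n n"
      using Suc.prems(3) unfolding tourn_def by blast
    ultimately show "r x y = join r (\<lambda>_. r n) (f x) (f y)"
      by (auto simp: f_def less_Suc_eq)
  qed
  then show ?case
    by (simp add: member_nat)
qed

text \<open>Listing the added point first and then the copies from last to first, every vertex has at most
  two in-neighbours among its predecessors.\<close>

lemma point_ext_stack_W:
  assumes "amalgamation_class K" "has K W"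
  shows "member K (insert None (Some ` ({..<N} \<times> {..<4}))) (point_ext (stack (adj W)) t)"
proof -
  interpret amalgamation_class K by fact
  let ?S = "insert None (Some ` ({..<N} \<times> {..<4::nat}))" and ?r = "point_ext (stack (adj W)) t"
  \<comment> \<open>Number 0 is the added point and number \<open>1 + 4 * m + c\<close> is the
    vertex \<open>c\<close> of copy \<open>N - 1 - m\<close>.\<close>
  define g where "g x = (if x = 0 then None else Some (N - 1 - (x - 1) div 4, (x - 1) mod 4))" for x :: nat
  define f where "f = case_option 0 (\<lambda>(n, c). 1 + 4 * (N - 1 - n) + c)"
  have gf: "g (f x) = x" if "x \<in> ?S" for x
    using that by (auto simp: g_def f_def)
  have f: "f x < 1 + 4 * N" if "x \<in> ?S" for x
    using that by (auto simp: f_def)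
  have g: "g x \<in> ?S" if "x < 1 + 4 * N" for x
    using that by (auto simp: g_def intro!: imageI)
  have "K {..<1 + 4 * N} (\<lambda>x y. ?r (g x) (g y))"
  proof (rule sparse_tournament[where d = 2 and K = K])
    show "has (linear_ext 2 K') W" if "amalgamation_class K'" "has K' W" for K'
      using amalgamation_class.linear_ext_W[OF that] by (simp add: has_def)
    have fg: "f (g x) = x" if "x < 1 + 4 * N" for x
      using that by (auto simp: f_def g_def)
    then have "inj_on g {..<1 + 4 * N}"
      by (metis inj_on_inverseI lessThan_iff)
    moreover have "tourn ?S ?r"
      by (intro tourn_point_ext tourn_stack tourn_W)
    ultimately show "tourn {..<1 + 4 * N} (\<lambda>x y. ?r (g x) (g y))"
      using g unfolding tourn_def inj_on_def by (metis lessThan_iff)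
    show "card {j \<in> {..<i}. \<not> ?r (g i) (g j)} \<le> 2" if "i < 1 + 4 * N" for i
    proof -
      \<comment> \<open>Later copies, listed earlier, are dominated. Inside a copy listed as 0, 1,
        2, 3, each of the vertices 1 and 2 has only its direct predecessor as an earlier
        in-neighbour, while 3 has none.\<close>
      have "j = 0 \<or> j = i - 1" if j: "j < i" "\<not> ?r (g i) (g j)" for j
      proof (rule ccontr)
        assume neq: "\<not> (j = 0 \<or> j = i - 1)"
        define n c n' c' where "n = (i - 1) div 4" "c = (i - 1) mod 4" "n' = (j - 1) div 4" "c' = (j - 1) mod 4"
        note defs = this
        have le: "n' \<le> n"
          unfolding defs using j(1) by (intro div_le_mono) simp
        have "n < N" "c < 4" "c' < 4"
          using \<open>i < 1 + 4 * N\<close> j(1) by (auto simp: defs)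
        have ij: "i = 1 + 4 * n + c" "j = 1 + 4 * n' + c'"
          using j(1) neq by (auto simp: defs)
        have gij: "g i = Some (N - 1 - n, c)" "g j = Some (N - 1 - n', c')"
          using j(1) neq by (auto simp: g_def defs)
        show False
        proof (cases "n' = n")
          case True
          then have "c' < c" "c' \<noteq> c - 1"
            using ij j(1) neq by auto
          then have "adj W c c'"
            using \<open>c < 4\<close> by (auto simp: lt_4 adj_def W_def numeral_3_eq_3 less_Suc_eq)
          then show ?thesis
            using j(2) True by (simp add: gij stack_def)
        next
          case False
          then have "N - 1 - n < N - 1 - n'"
            using le \<open>n < N\<close> by linarith
          then show ?thesis
            using j(2) by (simp add: gij stack_def)
        qed
      qed
      then have "{j \<in> {..<i}. \<not> ?r (g i) (g j)} \<subseteq> {0, i - 1}"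
        by auto
      then have "card {j \<in> {..<i}. \<not> ?r (g i) (g j)} \<le> card {0, i - 1}"
        by (intro card_mono) auto
      also have "\<dots> \<le> 2"
        by (simp add: card_insert_if)
      finally show ?thesis .
    qed
  qed fact+
  then have m: "member K {..<1 + 4 * N} (\<lambda>x y. ?r (g x) (g y))"
    by (simp add: member_nat)
  show ?thesis
  proof (rule member_hereditary[OF m])
    show "inj_on f ?S"
      using gf by (metis inj_on_inverseI)
  qed (use f gf in auto)
qed

text \<open>With the bound \<open>Suc n\<close> every tournament on \<open>n\<close> vertices counts
  as sparse. Lifting \<open>W\<close> for such a large bound is possible since
  \<open>point_ext_stack_W\<close> covers arbitrary types of the added point.\<close>

theorem class_of_all_tournaments:
  assumes "amalgamation_class K" "has K W" "tourn {..<n} r"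
  shows "K {..<n} r"
proof (rule sparse_tournament[where d = "Suc n" and K = K])
  show "has (linear_ext (Suc n) K') W" if "amalgamation_class K'" "has K' W" for K'
    using amalgamation_class.linear_ext_stack[OF that(1), of "{..<4}" 0 "Suc n" "adj W"]
      point_ext_stack_W[OF that] by (simp add: has_def)
  fix i assume "i < n"
  have "card {j \<in> {..<i}. \<not> r i j} \<le> card {..<i}"
    by (intro card_mono) auto
  then show "card {j \<in> {..<i}. \<not> r i j} \<le> Suc n"
    using \<open>i < n\<close> by simp
qed fact+

section \<open>Back-and-forth\<close>

definition partial_iso :: "('a \<Rightarrow> 'a \<Rightarrow> bool) \<Rightarrow> ('b \<Rightarrow> 'b \<Rightarrow> bool) \<Rightarrow> ('a \<times> 'b) set \<Rightarrow> bool" where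
  "partial_iso r s p \<longleftrightarrow>
     (\<forall>a b c d. (a, b) \<in> p \<longrightarrow> (c, d) \<in> p \<longrightarrow> (a = c \<longleftrightarrow> b = d) \<and> (r a c \<longleftrightarrow> s b d))"

abbreviation adjacent :: "'a graph \<Rightarrow> 'a \<Rightarrow> 'a \<Rightarrow> bool" where
  "adjacent G x y \<equiv> (x, y) \<in> arcs G"

lemma partial_iso_converse: "partial_iso s r (p\<inverse>) \<longleftrightarrow> partial_iso r s p"
  unfolding partial_iso_def by blast

lemma partial_iso_insert:
  assumes "partial_iso r s p" "r x x \<longleftrightarrow> s y y"
    and "\<And>a b. (a, b) \<in> p \<Longrightarrow> (a = x \<longleftrightarrow> b = y) \<and> (r a x \<longleftrightarrow> s b y) \<and> (r x a \<longleftrightarrow> s y b)"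
  shows "partial_iso r s (insert (x, y) p)"
  unfolding partial_iso_def
proof (intro allI impI)
  fix a b c d assume "(a, b) \<in> insert (x, y) p" "(c, d) \<in> insert (x, y) p"
  then consider "a = x" "b = y" "c = x" "d = y" | "a = x" "b = y" "(c, d) \<in> p"
    | "(a, b) \<in> p" "c = x" "d = y" | "(a, b) \<in> p" "(c, d) \<in> p"
    by blast
  then show "(a = c \<longleftrightarrow> b = d) \<and> (r a c \<longleftrightarrow> s b d)"
  proof cases
    case 1
    then show ?thesis using assms(2) by blast
  next
    case 2
    then show ?thesis using assms(3)[OF 2(3)] by blast
  next
    case 3
    then show ?thesis using assms(3)[OF 3(1)] by blast
  next
    case 4
    then show ?thesis using assms(1) unfolding partial_iso_def by blast
  qed
qed

text \<open>The invariant \<open>P\<close> can carry side conditions such as nonemptiness along with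
  the partial isomorphism. The enumerations by \<open>from_nat_into\<close> may repeat elements, so
  finite sets are covered too.\<close>

lemma back_and_forth:
  assumes X: "countable X" "X \<noteq> {}" and Y: "countable Y" and p0: "finite p0" "P p0"
    and P: "\<And>p. finite p \<Longrightarrow> P p \<Longrightarrow> p \<subseteq> X \<times> Y \<and> partial_iso r s p"
    and forth: "\<And>p x. finite p \<Longrightarrow> P p \<Longrightarrow> x \<in> X \<Longrightarrow> \<exists>y. P (insert (x, y) p)"
    and back_step: "\<And>p y. finite p \<Longrightarrow> P p \<Longrightarrow> y \<in> Y \<Longrightarrow> \<exists>x. P (insert (x, y) p)"
  shows "\<exists>g. bij_betw g X Y \<and> (\<forall>x\<in>X. \<forall>y\<in>X. r x y \<longleftrightarrow> s (g x) (g y)) \<and> (\<forall>(a, b)\<in>p0. g a = b)"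
proof -
  have Y': "Y \<noteq> {}"
    using P forth[OF p0] X(2) p0(1) by (metis all_not_in_conv finite_insert insert_subset mem_Times_iff)
  have step: "\<exists>q. (finite q \<and> P q) \<and> p \<subseteq> q \<and> from_nat_into X n \<in> Domain q \<and> from_nat_into Y n \<in> Range q"
    if p: "finite p" "P p" for p n
  proof -
    obtain y where y: "P (insert (from_nat_into X n, y) p)"
      using forth[OF p from_nat_into[OF X(2)]] by blast
    then obtain x where "P (insert (x, from_nat_into Y n) (insert (from_nat_into X n, y) p))"
      using back_step[OF _ y from_nat_into[OF Y']] p(1) by auto
    then show ?thesis
      using p(1) by (intro exI[of _ "insert (x, from_nat_into Y n) (insert (from_nat_into X n, y) p)"]) auto
  qed
  have "\<exists>p. \<forall>n. (finite (p n) \<and> P (p n) \<and> (n = 0 \<longrightarrow> p n = p0)) \<and>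
      (p n \<subseteq> p (Suc n) \<and> from_nat_into X n \<in> Domain (p (Suc n)) \<and> from_nat_into Y n \<in> Range (p (Suc n)))"
    by (rule dependent_nat_choice) (use p0 step in auto)
  then obtain p where p: "\<And>n. finite (p n)" "\<And>n. P (p n)" "p 0 = p0" "\<And>n. p n \<subseteq> p (Suc n)"
    "\<And>n. from_nat_into X n \<in> Domain (p (Suc n))" "\<And>n. from_nat_into Y n \<in> Range (p (Suc n))"
    by blast
  have mono: "p m \<subseteq> p n" if "m \<le> n" for m n
    using p(4) that by (rule lift_Suc_mono_le)
  define q where "q = (\<Union>n. p n)"
  have pq: "p n \<subseteq> q" for n
    by (auto simp: q_def)
  have iso: "partial_iso r s q"
    unfolding partial_iso_def
  proof (intro allI impI)
    fix a b c d assume "(a, b) \<in> q" "(c, d) \<in> q"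
    then obtain m n where "(a, b) \<in> p m" "(c, d) \<in> p n"
      by (auto simp: q_def)
    then have "(a, b) \<in> p (max m n)" "(c, d) \<in> p (max m n)"
      using mono[of m "max m n"] mono[of n "max m n"] by auto
    then show "(a = c \<longleftrightarrow> b = d) \<and> (r a c \<longleftrightarrow> s b d)"
      using P[OF p(1,2)] unfolding partial_iso_def by blast
  qed
  have sub: "q \<subseteq> X \<times> Y"
    using P[OF p(1,2)] by (auto simp: q_def)
  have "\<exists>y. (x, y) \<in> q" if "x \<in> X" for x
    using p(5) pq from_nat_into_surj[OF X(1) that] by (metis Domain.cases subsetD)
  then obtain g where g: "\<And>x. x \<in> X \<Longrightarrow> (x, g x) \<in> q"
    by metis
  have "\<exists>x\<in>X. y = g x" if yY: "y \<in> Y" for y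
  proof -
    obtain x where x: "(x, y) \<in> q"
      using p(6) pq from_nat_into_surj[OF Y yY] by (metis Range.cases subsetD)
    then have "x \<in> X"
      using sub by blast
    then show ?thesis
      using g x iso unfolding partial_iso_def by blast
  qed
  moreover have "g ` X \<subseteq> Y"
    using g sub by blast
  moreover have "inj_on g X"
    using g iso unfolding partial_iso_def inj_on_def by metis
  ultimately have "bij_betw g X Y"
    unfolding bij_betw_def by blast
  moreover have "\<forall>x\<in>X. \<forall>y\<in>X. r x y \<longleftrightarrow> s (g x) (g y)"
    using g iso unfolding partial_iso_def by blast
  moreover have "g a = b" if "(a, b) \<in> p0" for a b
  proof -
    have "(a, b) \<in> q"
      using that pq[of 0] p(3) by auto
    then show ?thesis
      using g[of a] sub iso unfolding partial_iso_def by blast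
  qed
  ultimately show ?thesis
    by blast
qed

section \<open>Graph isomorphisms and the extension of finite partial automorphisms\<close>

lemma graph_isoI:
  assumes "bij_betw g (verts G) (verts H)"
    and "\<And>x y. x \<in> verts G \<Longrightarrow> y \<in> verts G \<Longrightarrow> (x, y) \<in> arcs G \<longleftrightarrow> (g x, g y) \<in> arcs H"
  shows "graph_iso g G H"
  using assms by (simp add: graph_iso_def)

lemma graph_iso_inverse:
  assumes "graph_iso f G H"
  shows "graph_iso (inv_into (verts G) f) H G"
proof (rule graph_isoI)
  show "bij_betw (inv_into (verts G) f) (verts H) (verts G)"
    using assms by (simp add: graph_iso_def bij_betw_inv_into)
  fix x y assume "x \<in> verts H" "y \<in> verts H"
  moreover have "f ` verts G = verts H"
    using assms by (simp add: graph_iso_def bij_betw_def)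
  ultimately obtain x' y' where "x' \<in> verts G" "y' \<in> verts G" "x = f x'" "y = f y'"
    by (metis imageE)
  then show "(x, y) \<in> arcs H \<longleftrightarrow> (inv_into (verts G) f x, inv_into (verts G) f y) \<in> arcs G"
    using assms bij_betw_inv_into_left[of f "verts G" "verts H"] by (simp add: graph_iso_def)
qed

lemma graph_iso_compose: "graph_iso f G H \<Longrightarrow> graph_iso g H J \<Longrightarrow> graph_iso (g \<circ> f) G J"
  by (auto simp: graph_iso_def intro: bij_betw_trans dest: bij_betwE)

lemma isomorphic_graphs_trans: "isomorphic_graphs G H \<Longrightarrow> isomorphic_graphs H J \<Longrightarrow> isomorphic_graphs G J"
  unfolding isomorphic_graphs_def using graph_iso_compose by blast

lemma tournament_arc_iff:
  assumes "tournament G" "x \<in> verts G" "y \<in> verts G"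
  shows "(x, y) \<in> arcs G \<longleftrightarrow> x \<noteq> y \<and> (y, x) \<notin> arcs G"
  using assms unfolding tournament_def oriented_graph_def by (meson asymD)

lemma homogeneous_extend:
  assumes "homogeneous G" "finite p" "p \<subseteq> verts G \<times> verts G"
    and "partial_iso (adjacent G) (adjacent G) p"
  shows "\<exists>g. graph_iso g G G \<and> (\<forall>a b. (a, b) \<in> p \<longrightarrow> g a = b)"
proof -
  have "\<forall>x\<in>Domain p. \<exists>y. (x, y) \<in> p"
    by blast
  then obtain f where f: "\<And>x. x \<in> Domain p \<Longrightarrow> (x, f x) \<in> p"
    using bchoice[of "Domain p"] by metis
  have fp: "f a = b" if "(a, b) \<in> p" for a b
    using that f[of a] assms(4) unfolding partial_iso_def by blast
  have "graph_iso f (induced G (Domain p)) (induced G (Range p))"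
  proof (rule graph_isoI)
    have "inj_on f (Domain p)"
    proof (rule inj_onI)
      fix x y assume "x \<in> Domain p" "y \<in> Domain p" "f x = f y"
      then show "x = y"
        using f[of x] f[of y] assms(4) unfolding partial_iso_def by metis
    qed
    moreover have "f ` Domain p = Range p"
      using f fp by (fastforce simp: image_iff)
    ultimately show "bij_betw f (verts (induced G (Domain p))) (verts (induced G (Range p)))"
      by (simp add: bij_betw_def induced_def)
    fix x y assume "x \<in> verts (induced G (Domain p))" "y \<in> verts (induced G (Domain p))"
    then have xy: "(x, f x) \<in> p" "(y, f y) \<in> p"
      using f by (auto simp: induced_def)
    then have "(x, y) \<in> arcs G \<longleftrightarrow> (f x, f y) \<in> arcs G"
      using assms(4) unfolding partial_iso_def by blast
    then show "(x, y) \<in> arcs (induced G (Domain p)) \<longleftrightarrow> (f x, f y) \<in> arcs (induced G (Range p))"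
      using xy by (auto simp: induced_def)
  qed
  moreover have "finite (Domain p)" "finite (Range p)" "Domain p \<subseteq> verts G" "Range p \<subseteq> verts G"
    using assms(2,3) by (auto simp: finite_Domain finite_Range)
  ultimately obtain g where "graph_iso g G G" "\<forall>x\<in>Domain p. g x = f x"
    using assms(1) unfolding homogeneous_def by metis
  then show ?thesis
    using fp by (intro exI[of _ g]) auto
qed

section \<open>Weakly connected components\<close>

lemma equiv_weakly_joined: "equiv (verts G) (weakly_joined G)"
proof (rule equivI)
  let ?S = "arcs G \<union> (arcs G)\<inverse>"
  show "weakly_joined G \<subseteq> verts G \<times> verts G" "refl_on (verts G) (weakly_joined G)"
    by (auto simp: weakly_joined_def refl_on_def)
  have "sym (?S\<^sup>*)"
    by (intro sym_rtrancl symI) auto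
  then show "sym (weakly_joined G)"
    by (auto simp: weakly_joined_def sym_def)
  show "trans (weakly_joined G)"
    by (rule transI) (auto simp: weakly_joined_def)
qed

lemma weakly_joined_arc:
  assumes "oriented_graph G" "(x, y) \<in> arcs G"
  shows "(x, y) \<in> weakly_joined G" "(y, x) \<in> weakly_joined G"
  using assms by (auto simp: weakly_joined_def oriented_graph_def)

lemma weakly_joined_hom:
  assumes "oriented_graph G" "graph_hom g G G" "(x, y) \<in> weakly_joined G"
  shows "(g x, g y) \<in> weakly_joined G"
proof -
  let ?S = "arcs G \<union> (arcs G)\<inverse>"
  have arc: "(a, b) \<in> ?S \<Longrightarrow> (g a, g b) \<in> ?S" for a b
    using assms(1,2) by (auto simp: graph_hom_def oriented_graph_def)
  have "(x, y) \<in> ?S\<^sup>*"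
    using assms(3) by (simp add: weakly_joined_def)
  then have "(g x, g y) \<in> ?S\<^sup>*"
  proof induction
    case (step b c)
    then show ?case
      using arc rtrancl_into_rtrancl by metis
  qed simp
  then show ?thesis
    using assms(2,3) by (auto simp: weakly_joined_def graph_hom_def)
qed

lemma weak_component_cases:
  "C \<in> weak_components G \<longleftrightarrow> (\<exists>x\<in>verts G. C = induced G (weakly_joined G `` {x}))"
  by (auto simp: weak_components_def quotient_def)

lemma induced_simps [simp]: "verts (induced G A) = A" "(x, y) \<in> arcs (induced G A) \<longleftrightarrow> (x, y) \<in> arcs G \<and> x \<in> A \<and> y \<in> A"
  by (auto simp: induced_def)

lemma tournament_iso:
  assumes "tournament H" "graph_iso f G H" "arcs G \<subseteq> verts G \<times> verts G"
  shows "tournament G"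
proof -
  have f: "f x \<in> verts H" if "x \<in> verts G" for x
    using assms(2) that by (auto simp: graph_iso_def dest: bij_betwE)
  have a: "(x, y) \<in> arcs G \<longleftrightarrow> (f x, f y) \<in> arcs H" if "x \<in> verts G" "y \<in> verts G" for x y
    using assms(2) that by (simp add: graph_iso_def)
  have inj: "f x = f y \<longleftrightarrow> x = y" if "x \<in> verts G" "y \<in> verts G" for x y
    using assms(2) that by (auto simp: graph_iso_def bij_betw_def inj_on_def)
  have "verts G \<noteq> {}"
    using assms(1,2) by (auto simp: graph_iso_def bij_betw_def tournament_def oriented_graph_def)
  moreover have "asym (arcs G)"
  proof (rule asymI)
    fix x y assume "(x, y) \<in> arcs G"
    moreover have "x \<in> verts G" "y \<in> verts G"
      using calculation assms(3) by auto
    ultimately show "(y, x) \<notin> arcs G"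
      using a f tournament_arc_iff[OF assms(1)] by metis
  qed
  moreover have "(x, y) \<in> arcs G \<or> (y, x) \<in> arcs G" if "x \<in> verts G" "y \<in> verts G" "x \<noteq> y" for x y
    using that a f inj tournament_arc_iff[OF assms(1)] by metis
  ultimately show ?thesis
    using assms(3) by (simp add: tournament_def oriented_graph_def)
qed

section \<open>Hom-homogeneity and the components of a disconnected graph\<close>

locale disconnected_graph =
  fixes G :: "'a graph"
  assumes oriented: "oriented_graph G" and countable_verts: "countable (verts G)"
    and disconnected: "disconnected G"
begin

abbreviation "joined \<equiv> weakly_joined G"

lemmas equiv_joined = equiv_weakly_joined[of G]

lemma joined_sym: "(x, y) \<in> joined \<Longrightarrow> (y, x) \<in> joined"
  using equiv_joined by (meson equivE symD)

lemma joined_trans: "(x, y) \<in> joined \<Longrightarrow> (y, z) \<in> joined \<Longrightarrow> (x, z) \<in> joined"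
  using equiv_joined by (meson equivE transD)

lemma joined_refl: "x \<in> verts G \<Longrightarrow> (x, x) \<in> joined"
  by (simp add: weakly_joined_def)

lemma joined_verts: "(x, y) \<in> joined \<Longrightarrow> x \<in> verts G \<and> y \<in> verts G"
  by (simp add: weakly_joined_def)

lemma arc_verts: "(x, y) \<in> arcs G \<Longrightarrow> x \<in> verts G \<and> y \<in> verts G"
  using oriented by (auto simp: oriented_graph_def)

lemma arc_asym: "(x, y) \<in> arcs G \<Longrightarrow> (y, x) \<notin> arcs G"
  using oriented by (auto simp: oriented_graph_def dest: asymD)

lemma not_joined: "\<exists>z\<in>verts G. (x, z) \<notin> joined"
proof (rule ccontr)
  assume "\<not> ?thesis"
  then have "joined `` {y} = verts G" if "y \<in> verts G" for y
    using that joined_verts joined_sym joined_trans by blast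
  then show False
    using disconnected by (auto simp: disconnected_def weak_component_cases)
qed

lemma hom_homogeneous_adjacent:
  assumes hh: "hom_homogeneous G" and "(x, y) \<in> joined" "x \<noteq> y"
  shows "(x, y) \<in> arcs G \<or> (y, x) \<in> arcs G"
proof (rule ccontr)
  assume non: "\<not> ?thesis"
  obtain z where z: "z \<in> verts G" "(x, z) \<notin> joined"
    using not_joined by blast
  have v: "x \<in> verts G" "y \<in> verts G"
    using assms(2) joined_verts by auto
  define f where "f v = (if v = y then z else x)" for v
  have "graph_hom f (induced G {x, y}) (induced G {x, z})"
  proof -
    have "(u, w) \<notin> arcs G" if "u \<in> {x, y}" "w \<in> {x, y}" for u w
      using that non arc_asym by blast
    then show ?thesis
      unfolding graph_hom_def by (auto simp: f_def)
  qed
  then have "\<exists>g. graph_hom g G G \<and> (\<forall>v\<in>{x, y}. g v = f v)"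
    using v z(1) by (intro hh[unfolded hom_homogeneous_def, rule_format, of "{x, y}" "{x, z}" f]) simp
  then obtain g where g: "graph_hom g G G" "\<forall>v\<in>{x, y}. g v = f v"
    by blast
  then show False
    using weakly_joined_hom[OF oriented g(1) assms(2)] g(2) z(2) \<open>x \<noteq> y\<close> by (simp add: f_def)
qed

lemma hom_homogeneous_tournament:
  assumes "hom_homogeneous G" "x \<in> verts G"
  shows "tournament (induced G (joined `` {x}))"
proof -
  have "\<forall>u\<in>joined `` {x}. \<forall>v\<in>joined `` {x}. u \<noteq> v \<longrightarrow> (u, v) \<in> arcs G \<or> (v, u) \<in> arcs G"
    using hom_homogeneous_adjacent[OF assms(1)] joined_sym joined_trans by blast
  moreover have "oriented_graph (induced G (joined `` {x}))"
    using joined_refl[OF assms(2)] oriented by (auto simp: oriented_graph_def induced_def asym_iff)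
  ultimately show ?thesis
    by (auto simp: tournament_def)
qed

text \<open>The extending endomorphism need not be injective globally, but on a component that is a
  tournament preserving arcs already forces injectivity and reflection of arcs. Nonemptiness of
  \<open>p\<close> ties the image of the component of \<open>x\<close> to that of
  \<open>y\<close>.\<close>

lemma hom_homogeneous_step:
  assumes hh: "hom_homogeneous G" and p: "finite p" "p \<noteq> {}" "p \<subseteq> joined `` {x} \<times> joined `` {y}"
    "partial_iso (adjacent G) (adjacent G) p" and u: "u \<in> joined `` {x}"
  shows "\<exists>v\<in>joined `` {y}. partial_iso (adjacent G) (adjacent G) (insert (u, v) p)"
proof -
  have "\<forall>a\<in>Domain p. \<exists>b. (a, b) \<in> p"
    by blast
  then obtain f where f: "\<And>a. a \<in> Domain p \<Longrightarrow> (a, f a) \<in> p"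
    using bchoice[of "Domain p"] by metis
  have fp: "f a = b" if "(a, b) \<in> p" for a b
    using that f[of a] p(4) unfolding partial_iso_def by blast
  have fin: "finite (Domain p)" "finite (Range p)" and sub: "Domain p \<subseteq> verts G" "Range p \<subseteq> verts G"
    using p(1,3) joined_verts by (auto simp: finite_Domain finite_Range)
  have "graph_hom f (induced G (Domain p)) (induced G (Range p))"
    unfolding graph_hom_def
  proof (intro conjI ballI impI)
    show "f ` verts (induced G (Domain p)) \<subseteq> verts (induced G (Range p))"
      using fp by auto
    fix a b assume "a \<in> verts (induced G (Domain p))" "b \<in> verts (induced G (Domain p))"
      and "(a, b) \<in> arcs (induced G (Domain p))"
    then show "(f a, f b) \<in> arcs (induced G (Range p))"
      using f[of a] f[of b] p(4) unfolding partial_iso_def by auto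
  qed
  then obtain g where g: "graph_hom g G G" and gf: "\<And>a. a \<in> Domain p \<Longrightarrow> g a = f a"
    using hh fin sub unfolding hom_homogeneous_def by metis
  have gp: "g a = b" if "(a, b) \<in> p" for a b
    using gf[of a] fp[OF that] that by blast
  have gj: "(y, g a) \<in> joined" if "(x, a) \<in> joined" for a
  proof -
    obtain c d where cd: "(c, d) \<in> p"
      using p(2) by auto
    then have "(x, c) \<in> joined" "(y, d) \<in> joined"
      using p(3) by auto
    moreover have "(g c, g a) \<in> joined"
      using weakly_joined_hom[OF oriented g] calculation that joined_sym joined_trans by blast
    ultimately show ?thesis
      using gp[OF cd] joined_trans by simp
  qed
  have arc: "(g a, g b) \<in> arcs G" if "(a, b) \<in> arcs G" for a b
    using g that arc_verts unfolding graph_hom_def by blast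
  have "partial_iso (adjacent G) (adjacent G) (insert (u, g u) p)"
  proof (rule partial_iso_insert[OF p(4)])
    show "(u, u) \<in> arcs G \<longleftrightarrow> (g u, g u) \<in> arcs G"
      using arc_asym by blast
    fix a b assume ab: "(a, b) \<in> p"
    show "(a = u \<longleftrightarrow> b = g u) \<and> ((a, u) \<in> arcs G \<longleftrightarrow> (b, g u) \<in> arcs G) \<and> ((u, a) \<in> arcs G \<longleftrightarrow> (g u, b) \<in> arcs G)"
    proof (cases "a = u")
      case True
      then show ?thesis
        using gp[OF ab] arc_asym by blast
    next
      case False
      have "(a, u) \<in> joined"
        using ab p(3) u joined_sym joined_trans by blast
      then have "(a, u) \<in> arcs G \<or> (u, a) \<in> arcs G"
        using hom_homogeneous_adjacent[OF hh] False by blast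
      then show ?thesis
        using False gp[OF ab] arc[of a u] arc[of u a] arc_asym by metis
    qed
  qed
  then show ?thesis
    using gj u by auto
qed

lemma hom_homogeneous_extend:
  assumes hh: "hom_homogeneous G" and p: "finite p" "p \<noteq> {}" "p \<subseteq> joined `` {x} \<times> joined `` {y}"
    "partial_iso (adjacent G) (adjacent G) p"
  shows "\<exists>g. graph_iso g (induced G (joined `` {x})) (induced G (joined `` {y})) \<and> (\<forall>(a, b)\<in>p. g a = b)"
proof -
  let ?r = "\<lambda>u v. (u, v) \<in> arcs G"
  define P where "P p \<longleftrightarrow> p \<noteq> {} \<and> p \<subseteq> joined `` {x} \<times> joined `` {y} \<and> partial_iso ?r ?r p" for p
  have c: "countable (joined `` {z})" for z
    using countable_verts by (rule countable_subset[rotated]) (auto dest: joined_verts)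
  have "\<exists>g. bij_betw g (joined `` {x}) (joined `` {y}) \<and>
      (\<forall>u\<in>joined `` {x}. \<forall>v\<in>joined `` {x}. ?r u v \<longleftrightarrow> ?r (g u) (g v)) \<and> (\<forall>(a, b)\<in>p. g a = b)"
  proof (rule back_and_forth[where P = P])
    show "joined `` {x} \<noteq> {}"
      using p(2,3) by auto
    show "P p"
      using p by (simp add: P_def)
  next
    fix p u assume "finite p" "P p" "u \<in> joined `` {x}"
    then show "\<exists>v. P (insert (u, v) p)"
      using hom_homogeneous_step[OF hh, of p x y u] unfolding P_def by blast
  next
    fix p v assume p: "finite p" "P p" and v: "v \<in> joined `` {y}"
    have "p\<inverse> \<noteq> {}" "p\<inverse> \<subseteq> joined `` {y} \<times> joined `` {x}" "finite (p\<inverse>)"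
      using p by (auto simp: P_def)
    then obtain u where u: "u \<in> joined `` {x}" "partial_iso ?r ?r (insert (v, u) (p\<inverse>))"
      using hom_homogeneous_step[OF hh _ _ _ _ v, of "p\<inverse>" x] p(2)
      unfolding P_def partial_iso_converse by blast
    moreover have "insert (v, u) (p\<inverse>) = (insert (u, v) p)\<inverse>"
      by auto
    ultimately have "partial_iso ?r ?r (insert (u, v) p)"
      by (simp only: partial_iso_converse)
    then show "\<exists>u. P (insert (u, v) p)"
      using u(1) v p(2) unfolding P_def by blast
  qed (use c p in \<open>auto simp: P_def\<close>)
  then obtain g where g: "bij_betw g (joined `` {x}) (joined `` {y})"
      "\<forall>u\<in>joined `` {x}. \<forall>v\<in>joined `` {x}. ?r u v \<longleftrightarrow> ?r (g u) (g v)" "\<forall>(a, b)\<in>p. g a = b"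
    by blast
  have "graph_iso g (induced G (joined `` {x})) (induced G (joined `` {y}))"
  proof (rule graph_isoI)
    fix u v assume uv: "u \<in> verts (induced G (joined `` {x}))" "v \<in> verts (induced G (joined `` {x}))"
    then have "g u \<in> joined `` {y}" "g v \<in> joined `` {y}"
      using bij_betwE[OF g(1)] by simp_all
    then show "(u, v) \<in> arcs (induced G (joined `` {x})) \<longleftrightarrow> (g u, g v) \<in> arcs (induced G (joined `` {y}))"
      using uv g(2) by simp
  qed (use g(1) in simp)
  then show ?thesis
    using g(3) by blast
qed

text \<open>Any component may serve as \<open>D\<close>: a single pair of vertices is a partial
  isomorphism, as there are no loops, and it extends to an isomorphism of the two components.
  Homogeneity is the same extension inside one component; the empty map is extended by the
  identity.\<close>

lemma hom_homogeneous_components: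
  assumes hh: "hom_homogeneous G"
  shows "\<exists>D :: 'a graph. tournament D \<and> homogeneous D \<and> countable (verts D) \<and> (\<forall>C\<in>weak_components G. isomorphic_graphs C D)"
proof -
  obtain x where x: "x \<in> verts G"
    using oriented by (auto simp: oriented_graph_def)
  let ?D = "induced G (joined `` {x})"
  have "isomorphic_graphs C ?D" if C: "C \<in> weak_components G" for C
  proof -
    obtain y where y: "y \<in> verts G" "C = induced G (joined `` {y})"
      using C by (auto simp: weak_component_cases)
    have "partial_iso (adjacent G) (adjacent G) {(y, x)}"
      using arc_asym unfolding partial_iso_def by blast
    then show ?thesis
      using hom_homogeneous_extend[OF hh, of "{(y, x)}" y x] y x joined_refl
      by (auto simp: isomorphic_graphs_def)
  qed
  moreover have "homogeneous ?D"
    unfolding homogeneous_def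
  proof (intro allI impI)
    fix A B f
    assume f: "finite A \<and> A \<subseteq> verts ?D \<and> finite B \<and> B \<subseteq> verts ?D \<and>
      graph_iso f (induced ?D A) (induced ?D B)"
    show "\<exists>g. graph_iso g ?D ?D \<and> (\<forall>x\<in>A. g x = f x)"
    proof (cases "A = {}")
      case True
      then show ?thesis
        by (intro exI[of _ id]) (simp add: graph_iso_def)
    next
      case False
      define p where "p = (\<lambda>a. (a, f a)) ` A"
      have "inj_on f A" "f ` A = B"
        using f by (auto simp: graph_iso_def bij_betw_def)
      have fr: "(a, b) \<in> arcs G \<longleftrightarrow> (f a, f b) \<in> arcs G" if "a \<in> A" "b \<in> A" for a b
      proof -
        have "a \<in> joined `` {x}" "b \<in> joined `` {x}" "f a \<in> B" "f b \<in> B" "f a \<in> joined `` {x}" "f b \<in> joined `` {x}"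
          using that f \<open>f ` A = B\<close> by auto
        then show ?thesis
          using f that unfolding graph_iso_def by auto
      qed
      with \<open>inj_on f A\<close> have "partial_iso (adjacent G) (adjacent G) p"
        unfolding partial_iso_def p_def by (auto simp: inj_on_def)
      moreover have "finite p" "p \<noteq> {}" "p \<subseteq> joined `` {x} \<times> joined `` {x}"
        using f False \<open>f ` A = B\<close> by (auto simp: p_def)
      ultimately obtain g where "graph_iso g ?D ?D" "\<forall>(a, b)\<in>p. g a = b"
        using hom_homogeneous_extend[OF hh] by meson
      then show ?thesis
        by (intro exI[of _ g]) (auto simp: p_def)
    qed
  qed
  moreover have "countable (joined `` {x})"
    using countable_verts by (rule countable_subset[rotated]) (auto dest: joined_verts)
  ultimately show ?thesis
    using hom_homogeneous_tournament[OF hh x] by (intro exI[of _ ?D]) simp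
qed

text \<open>On the part of \<open>A\<close> in one component the map is an embedding, because there
  all pairs are adjacent, and its image stays in one component. Transported to \<open>D\<close>, it
  is a finite partial automorphism and extends by homogeneity. No arcs join different components, so
  the extensions can be glued.\<close>

lemma components_hom_homogeneous:
  assumes D: "tournament D" "homogeneous D" and iso: "\<And>C. C \<in> weak_components G \<Longrightarrow> isomorphic_graphs C D"
  shows "hom_homogeneous G"
  unfolding hom_homogeneous_def
proof (intro allI impI)
  fix A B f
  assume f: "finite A \<and> A \<subseteq> verts G \<and> finite B \<and> B \<subseteq> verts G \<and>
    graph_hom f (induced G A) (induced G B)"
  have fA: "f a \<in> verts G" if "a \<in> A" for a
    using f that by (auto simp: graph_hom_def)
  have farc: "(f a, f b) \<in> arcs G" if "a \<in> A" "b \<in> A" "(a, b) \<in> arcs G" for a b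
    using f that by (auto simp: graph_hom_def)
  have comp: "\<exists>\<phi>. graph_iso \<phi> (induced G (joined `` {x})) D" if "x \<in> verts G" for x
    using iso[of "induced G (joined `` {x})"] that unfolding weak_component_cases isomorphic_graphs_def by blast
  have ex: "\<exists>h. graph_hom h (induced G (joined `` {x})) G \<and> (\<forall>a\<in>A \<inter> joined `` {x}. h a = f a)" if x: "x \<in> verts G" for x
  proof (cases "A \<inter> joined `` {x} = {}")
    case True
    then show ?thesis
      using joined_verts by (intro exI[of _ id]) (auto simp: graph_hom_def)
  next
    case False
    then obtain a0 where a0: "a0 \<in> A" "(x, a0) \<in> joined"
      by auto
    let ?C = "joined `` {x}" and ?C' = "joined `` {f a0}"
    obtain \<phi> \<psi> where \<phi>: "graph_iso \<phi> (induced G ?C) D" and \<psi>: "graph_iso \<psi> (induced G ?C') D"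
      using comp x fA[OF a0(1)] by meson
    define \<theta> where "\<theta> = inv_into ?C' \<psi>"
    have \<theta>: "graph_iso \<theta> D (induced G ?C')"
      using graph_iso_inverse[OF \<psi>] by (simp add: \<theta>_def)
    have tC: "tournament (induced G ?C)"
      using tournament_iso[OF D(1) \<phi>] by (auto simp: induced_def)
    have arc: "(a, b) \<in> arcs G \<or> (b, a) \<in> arcs G" if "a \<in> ?C" "b \<in> ?C" "a \<noteq> b" for a b
      using tC that by (auto simp: tournament_def)
    have fC': "f a \<in> ?C'" if "a \<in> A" "a \<in> ?C" for a
    proof (cases "a = a0")
      case False
      then have "(f a, f a0) \<in> arcs G \<or> (f a0, f a) \<in> arcs G"
        using arc[of a a0] that a0 farc by auto
      then show ?thesis
        using weakly_joined_arc[OF oriented] by auto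
    qed (use fA that joined_refl in auto)
    define p where "p = (\<lambda>a. (\<phi> a, \<psi> (f a))) ` (A \<inter> ?C)"
    have \<phi>i: "\<phi> a \<in> verts D" "\<phi> a = \<phi> b \<longleftrightarrow> a = b" "(a, b) \<in> arcs G \<longleftrightarrow> (\<phi> a, \<phi> b) \<in> arcs D"
      if "a \<in> ?C" "b \<in> ?C" for a b
      using \<phi> that by (auto simp: graph_iso_def bij_betw_def inj_on_def)
    have \<psi>i: "\<psi> a \<in> verts D" "\<psi> a = \<psi> b \<longleftrightarrow> a = b" "(a, b) \<in> arcs G \<longleftrightarrow> (\<psi> a, \<psi> b) \<in> arcs D"
      if "a \<in> ?C'" "b \<in> ?C'" for a b
      using \<psi> that by (auto simp: graph_iso_def bij_betw_def inj_on_def)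
    have fiff: "(a = b \<longleftrightarrow> f a = f b) \<and> ((a, b) \<in> arcs G \<longleftrightarrow> (f a, f b) \<in> arcs G)"
      if "a \<in> A \<inter> ?C" "b \<in> A \<inter> ?C" for a b
      using that arc[of a b] farc[of a b] farc[of b a] arc_asym by (metis IntD1 IntD2)
    have "partial_iso (adjacent D) (adjacent D) p"
      unfolding partial_iso_def
    proof (intro allI impI)
      fix u u' v v' assume "(u, u') \<in> p" "(v, v') \<in> p"
      then obtain a b where ab: "a \<in> A \<inter> ?C" "b \<in> A \<inter> ?C" "u = \<phi> a" "u' = \<psi> (f a)" "v = \<phi> b" "v' = \<psi> (f b)"
        by (auto simp: p_def)
      then have "f a \<in> ?C'" "f b \<in> ?C'" "a \<in> ?C" "b \<in> ?C"
        using fC' by blast+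
      then show "(u = v \<longleftrightarrow> u' = v') \<and> ((u, v) \<in> arcs D \<longleftrightarrow> (u', v') \<in> arcs D)"
        using \<phi>i(2,3)[of a b] \<psi>i(2,3)[of "f a" "f b"] fiff[OF ab(1,2)] unfolding ab(3-6) by blast
    qed
    moreover have "finite p" "p \<subseteq> verts D \<times> verts D"
      using f \<phi>i(1)[of b b for b] \<psi>i(1)[of b b for b] fC' by (auto simp: p_def)
    ultimately obtain g where g: "graph_iso g D D" "\<And>u v. (u, v) \<in> p \<Longrightarrow> g u = v"
      using homogeneous_extend[OF D(2)] by meson
    define h where "h = \<theta> \<circ> (g \<circ> \<phi>)"
    have h: "graph_iso h (induced G ?C) (induced G ?C')"
      unfolding h_def by (intro graph_iso_compose[OF _ \<theta>] graph_iso_compose[OF \<phi> g(1)])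
    have hC': "h a \<in> ?C'" if "a \<in> ?C" for a
      using h that by (auto simp: graph_iso_def dest: bij_betwE)
    have "graph_hom h (induced G ?C) G"
      unfolding graph_hom_def
    proof (intro conjI ballI impI)
      show "h ` verts (induced G ?C) \<subseteq> verts G"
        using hC' joined_verts by auto
      fix a b assume "a \<in> verts (induced G ?C)" "b \<in> verts (induced G ?C)" "(a, b) \<in> arcs (induced G ?C)"
      then show "(h a, h b) \<in> arcs G"
        using h unfolding graph_iso_def by auto
    qed
    moreover have "h a = f a" if "a \<in> A \<inter> ?C" for a
    proof -
      have "g (\<phi> a) = \<psi> (f a)"
        using that by (intro g(2)) (auto simp: p_def)
      moreover have "\<theta> (\<psi> (f a)) = f a"
        using fC' that \<psi> unfolding \<theta>_def by (intro inv_into_f_f) (auto simp: graph_iso_def bij_betw_def)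
      ultimately show ?thesis
        by (simp add: h_def)
    qed
    ultimately show ?thesis
      by blast
  qed
  \<comment> \<open>One map is chosen per class instead of per vertex, so the two ends of an arc are
    moved by the same map.\<close>
  obtain h where h: "\<And>x. x \<in> verts G \<Longrightarrow> graph_hom (h (joined `` {x})) (induced G (joined `` {x})) G"
    "\<And>x a. x \<in> verts G \<Longrightarrow> a \<in> A \<inter> joined `` {x} \<Longrightarrow> h (joined `` {x}) a = f a"
  proof -
    have "\<forall>c\<in>verts G // joined. \<exists>k. graph_hom k (induced G c) G \<and> (\<forall>a\<in>A \<inter> c. k a = f a)"
      using ex by (auto elim!: quotientE)
    then obtain h where "\<forall>c\<in>verts G // joined. graph_hom (h c) (induced G c) G \<and> (\<forall>a\<in>A \<inter> c. h c a = f a)"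
      using bchoice[of "verts G // joined"] by metis
    then show ?thesis
      using that[of h] quotientI[of _ "verts G" joined] by blast
  qed
  define g where "g x = h (joined `` {x}) x" for x
  have "graph_hom g G G"
    unfolding graph_hom_def
  proof (intro conjI ballI impI)
    show "g ` verts G \<subseteq> verts G"
      using h(1) joined_refl by (fastforce simp: graph_hom_def g_def)
    fix x y assume xy: "x \<in> verts G" "y \<in> verts G" "(x, y) \<in> arcs G"
    then have "(x, y) \<in> joined"
      using weakly_joined_arc[OF oriented] by blast
    then have eq: "joined `` {x} = joined `` {y}" and "x \<in> joined `` {x}" "y \<in> joined `` {x}"
      using equiv_class_eq[OF equiv_joined] joined_refl xy by auto
    then show "(g x, g y) \<in> arcs G"
      using h(1)[OF xy(1)] xy(3) unfolding g_def graph_hom_def by auto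
  qed
  moreover have "\<forall>a\<in>A. g a = f a"
    using h(2) f joined_refl by (auto simp: g_def)
  ultimately show "\<exists>g. graph_hom g G G \<and> (\<forall>x\<in>A. g x = f x)"
    by blast
qed

end

section \<open>Presentation as a disjoint union of copies\<close>

context disconnected_graph
begin

lemma components_copies:
  assumes iso: "\<And>C. C \<in> weak_components G \<Longrightarrow> isomorphic_graphs C H"
  shows "\<exists>k>1. isomorphic_graphs G (copies k H)"
proof -
  define Q where "Q = verts G // joined"
  define cls where "cls x = joined `` {x}" for x
  have cls: "cls x \<in> Q" "x \<in> cls x" if "x \<in> verts G" for x
    using that joined_refl by (auto simp: Q_def cls_def quotientI)
  have Qcls: "cls x = c" "x \<in> verts G" if "c \<in> Q" "x \<in> c" for x c
    using that equiv_class_eq[OF equiv_joined] joined_verts by (auto simp: Q_def cls_def elim!: quotientE)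
  have "countable Q"
    using countable_verts by (simp add: Q_def quotient_def)
  obtain C D where CD: "C \<in> weak_components G" "D \<in> weak_components G" "C \<noteq> D"
    using disconnected unfolding disconnected_def by (elim bexE)
  obtain c where c: "c \<in> Q" "C = induced G c"
    using CD(1) unfolding weak_components_def Q_def by (rule imageE)
  obtain d where d: "d \<in> Q" "D = induced G d"
    using CD(2) unfolding weak_components_def Q_def by (rule imageE)
  have cd: "c \<in> Q" "d \<in> Q" "c \<noteq> d"
    using c d CD(3) by auto
  have "\<exists>k e. 1 < k \<and> bij_betw e {i. enat i < k} Q"
  proof (cases "finite Q")
    case True
    have "card {c, d} \<le> card Q"
      using True cd by (intro card_mono) auto
    then have "1 < enat (card Q)"
      using cd(3) by (simp add: one_enat_def)
    moreover obtain e where "bij_betw e {0..<card Q} Q"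
      using ex_bij_betw_nat_finite[OF True] by blast
    moreover have "{i. enat i < enat (card Q)} = {0..<card Q}"
      by auto
    ultimately show ?thesis
      by metis
  next
    case False
    then show ?thesis
      using bij_betw_from_nat_into[OF \<open>countable Q\<close> False]
      by (intro exI[of _ \<infinity>] exI[of _ "from_nat_into Q"]) (simp add: one_enat_def)
  qed
  then obtain k e where k: "1 < k" and e: "bij_betw e {i. enat i < k} Q"
    by blast
  define idx where "idx = inv_into {i. enat i < k} e"
  have idx: "bij_betw idx Q {i. enat i < k}"
    using e by (simp add: idx_def bij_betw_inv_into)
  have "\<forall>c\<in>Q. \<exists>\<phi>. graph_iso \<phi> (induced G c) H"
    using iso[unfolded weak_components_def isomorphic_graphs_def, OF imageI] by (auto simp: Q_def)
  then obtain \<phi> where \<phi>: "\<And>c. c \<in> Q \<Longrightarrow> graph_iso (\<phi> c) (induced G c) H"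
    using bchoice[of Q] by metis
  have \<phi>b: "bij_betw (\<phi> c) c (verts H)" if "c \<in> Q" for c
    using \<phi>[OF that] by (simp add: graph_iso_def)
  have \<phi>a: "(x, y) \<in> arcs G \<longleftrightarrow> (\<phi> c x, \<phi> c y) \<in> arcs H" if "c \<in> Q" "x \<in> c" "y \<in> c" for c x y
    using \<phi>[OF that(1)] that by (simp add: graph_iso_def)
  define f where "f x = (idx (cls x), \<phi> (cls x) x)" for x
  have "graph_iso f G (copies k H)"
  proof (rule graph_isoI)
    have "inj_on f (verts G)"
    proof (rule inj_onI)
      fix x y assume x: "x \<in> verts G" and y: "y \<in> verts G" and "f x = f y"
      then have "cls x = cls y"
        using idx cls by (auto simp: f_def bij_betw_def dest: inj_onD)
      then show "x = y"
        using \<open>f x = f y\<close> \<phi>b[OF cls(1)[OF x]] cls(2)[OF x] cls(2)[OF y]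
        by (auto simp: f_def bij_betw_def dest: inj_onD)
    qed
    moreover have "f ` verts G = {i. enat i < k} \<times> verts H"
    proof (intro equalityI subsetI)
      fix z assume "z \<in> f ` verts G"
      then obtain x where x: "x \<in> verts G" "z = f x"
        by blast
      then show "z \<in> {i. enat i < k} \<times> verts H"
        using bij_betwE[OF idx] bij_betwE[OF \<phi>b] cls unfolding f_def by blast
    next
      fix z assume "z \<in> {i. enat i < k} \<times> verts H"
      then obtain i h where z: "z = (i, h)" "enat i < k" "h \<in> verts H"
        by auto
      then obtain c where c: "c \<in> Q" "i = idx c"
        using bij_betw_imp_surj_on[OF idx] by blast
      then obtain x where x: "x \<in> c" "h = \<phi> c x"
        using bij_betw_imp_surj_on[OF \<phi>b[OF c(1)]] z(3) by blast
      then have "z = f x"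
        using z c Qcls[OF c(1) x(1)] by (simp add: f_def)
      then show "z \<in> f ` verts G"
        using Qcls[OF c(1) x(1)] by blast
    qed
    ultimately show "bij_betw f (verts G) (verts (copies k H))"
      by (simp add: bij_betw_def copies_def)
    fix x y assume x: "x \<in> verts G" and y: "y \<in> verts G"
    have i: "enat (idx (cls x)) < k"
      using bij_betwE[OF idx] cls(1)[OF x] by blast
    show "(x, y) \<in> arcs G \<longleftrightarrow> (f x, f y) \<in> arcs (copies k H)"
    proof (cases "cls x = cls y")
      case True
      then show ?thesis
        using \<phi>a[OF cls(1)[OF x] cls(2)[OF x], of y] cls(2)[OF y] i by (simp add: f_def copies_def)
    next
      case False
      then have "(x, y) \<notin> arcs G"
        using weakly_joined_arc(1)[OF oriented, of x y] equiv_class_eq[OF equiv_joined, of x y]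
        unfolding cls_def by blast
      moreover have "idx (cls x) \<noteq> idx (cls y)"
        using False idx cls(1)[OF x] cls(1)[OF y] by (auto simp: bij_betw_def dest: inj_onD)
      ultimately show ?thesis
        by (simp add: f_def copies_def)
    qed
  qed
  then show ?thesis
    using k by (auto simp: isomorphic_graphs_def)
qed

end

section \<open>Coloured dense orders and local orders\<close>

text \<open>Density is required only for colours that occur. One colour gives the order of the
  rationals; two colours give a partition of it into two dense sets.\<close>

locale coloured_dense_order =
  fixes X :: "'a set" and lt :: "'a \<Rightarrow> 'a \<Rightarrow> bool" and col :: "'a \<Rightarrow> bool"
  assumes countable: "countable X" and nonempty: "X \<noteq> {}"
    and irrefl: "x \<in> X \<Longrightarrow> \<not> lt x x"
    and trans: "x \<in> X \<Longrightarrow> y \<in> X \<Longrightarrow> z \<in> X \<Longrightarrow> lt x y \<Longrightarrow> lt y z \<Longrightarrow> lt x z"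
    and total: "x \<in> X \<Longrightarrow> y \<in> X \<Longrightarrow> x \<noteq> y \<Longrightarrow> lt x y \<or> lt y x"
    and below: "c \<in> col ` X \<Longrightarrow> x \<in> X \<Longrightarrow> \<exists>z\<in>X. col z = c \<and> lt z x"
    and above: "c \<in> col ` X \<Longrightarrow> x \<in> X \<Longrightarrow> \<exists>z\<in>X. col z = c \<and> lt x z"
    and between: "c \<in> col ` X \<Longrightarrow> x \<in> X \<Longrightarrow> y \<in> X \<Longrightarrow> lt x y \<Longrightarrow> \<exists>z\<in>X. col z = c \<and> lt x z \<and> lt z y"
begin

lemma asym: "x \<in> X \<Longrightarrow> y \<in> X \<Longrightarrow> lt x y \<Longrightarrow> \<not> lt y x"
  using irrefl trans by blast

lemma maximal: "finite A \<Longrightarrow> A \<noteq> {} \<Longrightarrow> A \<subseteq> X \<Longrightarrow> \<exists>m\<in>A. \<forall>a\<in>A. a = m \<or> lt a m"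
proof (induction A rule: finite_ne_induct)
  case (insert x A)
  then obtain m where m: "m \<in> A" "\<forall>a\<in>A. a = m \<or> lt a m"
    by auto
  have "x \<in> X" "m \<in> X" "A \<subseteq> X"
    using insert.prems m(1) by auto
  then consider "x = m" | "lt x m" | "lt m x"
    using total by blast
  then show ?case
  proof cases
    case 3
    then have "\<forall>a\<in>A. lt a x"
      using m \<open>x \<in> X\<close> \<open>m \<in> X\<close> \<open>A \<subseteq> X\<close> trans[of _ m x] by (metis subsetD)
    then show ?thesis by blast
  qed (use m in blast)+
qed simp

lemma minimal: "finite A \<Longrightarrow> A \<noteq> {} \<Longrightarrow> A \<subseteq> X \<Longrightarrow> \<exists>m\<in>A. \<forall>a\<in>A. a = m \<or> lt m a"
proof (induction A rule: finite_ne_induct)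
  case (insert x A)
  then obtain m where m: "m \<in> A" "\<forall>a\<in>A. a = m \<or> lt m a"
    by auto
  have "x \<in> X" "m \<in> X" "A \<subseteq> X"
    using insert.prems m(1) by auto
  then consider "x = m" | "lt m x" | "lt x m"
    using total by blast
  then show ?case
  proof cases
    case 3
    then have "\<forall>a\<in>A. lt x a"
      using m \<open>x \<in> X\<close> \<open>m \<in> X\<close> \<open>A \<subseteq> X\<close> trans[of x m] by (metis subsetD)
    then show ?thesis by blast
  qed (use m in blast)+
qed simp

lemma finite_between:
  assumes "finite A" "finite B" "A \<subseteq> X" "B \<subseteq> X" "\<And>a b. a \<in> A \<Longrightarrow> b \<in> B \<Longrightarrow> lt a b" "c \<in> col ` X"
  shows "\<exists>z\<in>X. col z = c \<and> (\<forall>a\<in>A. lt a z) \<and> (\<forall>b\<in>B. lt z b)"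
proof -
  have "\<exists>z\<in>X. col z = c \<and> (A \<noteq> {} \<longrightarrow> (\<exists>m\<in>A. (\<forall>a\<in>A. a = m \<or> lt a m) \<and> lt m z)) \<and>
      (B \<noteq> {} \<longrightarrow> (\<exists>m\<in>B. (\<forall>b\<in>B. b = m \<or> lt m b) \<and> lt z m))"
  proof (cases "A = {}")
    case True
    show ?thesis
    proof (cases "B = {}")
      case False
      then obtain m where m: "m \<in> B" "\<forall>b\<in>B. b = m \<or> lt m b"
        using minimal assms by meson
      then show ?thesis
        using below[OF assms(6), of m] assms(4) True by blast
    qed (use True assms(6) in blast)
  next
    case False
    then obtain m where m: "m \<in> A" "\<forall>a\<in>A. a = m \<or> lt a m"
      using maximal assms by meson
    show ?thesis
    proof (cases "B = {}")
      case True
      then show ?thesis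
        using above[OF assms(6), of m] m assms(3) by blast
    next
      case False
      then obtain m' where m': "m' \<in> B" "\<forall>b\<in>B. b = m' \<or> lt m' b"
        using minimal assms by meson
      then show ?thesis
        using between[OF assms(6), of m m'] m assms(3,4,5) by blast
    qed
  qed
  then obtain z where z: "z \<in> X" "col z = c"
    "A \<noteq> {} \<Longrightarrow> \<exists>m\<in>A. (\<forall>a\<in>A. a = m \<or> lt a m) \<and> lt m z"
    "B \<noteq> {} \<Longrightarrow> \<exists>m\<in>B. (\<forall>b\<in>B. b = m \<or> lt m b) \<and> lt z m"
    by blast
  have "lt a z" if "a \<in> A" for a
    using z(1,3) that assms(3) trans[of a _ z] by (metis empty_iff subsetD)
  moreover have "lt z b" if "b \<in> B" for b
    using z(1,4) that assms(4) trans[of z _ b] by (metis empty_iff subsetD)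
  ultimately show ?thesis
    using z by blast
qed

text \<open>The colour is put on the diagonal, so that partial isomorphisms preserve it.\<close>

definition coloured_lt :: "'a \<Rightarrow> 'a \<Rightarrow> bool" where
  "coloured_lt x y \<longleftrightarrow> (if x = y then col x else lt x y)"

end

lemma coloured_dense_order_step:
  assumes X: "coloured_dense_order X lt col" and Y: "coloured_dense_order Y lt' col'"
    and cols: "col ` X = col' ` Y" and p: "finite p" "p \<subseteq> X \<times> Y"
    "partial_iso (coloured_dense_order.coloured_lt lt col) (coloured_dense_order.coloured_lt lt' col') p" and x: "x \<in> X"
  shows "\<exists>y\<in>Y. partial_iso (coloured_dense_order.coloured_lt lt col) (coloured_dense_order.coloured_lt lt' col') (insert (x, y) p)"
proof (cases "x \<in> Domain p")
  case True
  then obtain y where "(x, y) \<in> p" by blast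
  then have "insert (x, y) p = p" "y \<in> Y"
    using p(2) by auto
  then show ?thesis
    using p(3) by metis
next
  case False
  interpret X: coloured_dense_order X lt col by fact
  interpret Y: coloured_dense_order Y lt' col' by fact
  have iso: "(a = a' \<longleftrightarrow> b = b') \<and> (X.coloured_lt a a' \<longleftrightarrow> Y.coloured_lt b b')" if "(a, b) \<in> p" "(a', b') \<in> p" for a b a' b'
    using p(3) that unfolding partial_iso_def by blast
  define A where "A = {b. \<exists>a. (a, b) \<in> p \<and> lt a x}"
  define B where "B = {b. \<exists>a. (a, b) \<in> p \<and> lt x a}"
  have "A \<subseteq> Range p" "B \<subseteq> Range p" "Range p \<subseteq> Y"
    using p(2) by (auto simp: A_def B_def)
  then have AB: "finite A" "finite B" "A \<subseteq> Y" "B \<subseteq> Y"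
    using finite_Range[OF p(1)] finite_subset by blast+
  have lt: "lt' b b'" if bb: "b \<in> A" "b' \<in> B" for b b'
  proof -
    obtain a a' where a: "(a, b) \<in> p" "lt a x" "(a', b') \<in> p" "lt x a'"
      using bb unfolding A_def B_def by blast
    then have aX: "a \<in> X" "a' \<in> X"
      using p(2) by auto
    then have "lt a a'"
      using a(2,4) x X.trans[of a x a'] by blast
    moreover have "a \<noteq> a'"
      using \<open>lt a a'\<close> X.irrefl aX by blast
    ultimately show ?thesis
      using iso[OF a(1,3)] by (auto simp: X.coloured_lt_def Y.coloured_lt_def)
  qed
  have "col x \<in> col' ` Y"
    using x cols by blast
  then obtain y where y: "y \<in> Y" "col' y = col x" "\<forall>b\<in>A. lt' b y" "\<forall>b\<in>B. lt' y b"
    using Y.finite_between[OF AB lt] by blast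
  have "partial_iso X.coloured_lt Y.coloured_lt (insert (x, y) p)"
  proof (rule partial_iso_insert[OF p(3)])
    show "X.coloured_lt x x \<longleftrightarrow> Y.coloured_lt y y"
      using y(2) by (simp add: X.coloured_lt_def Y.coloured_lt_def)
    fix a b assume ab: "(a, b) \<in> p"
    then have mem: "a \<in> X" "b \<in> Y" "a \<noteq> x"
      using p(2) False by auto
    then consider "lt a x" "\<not> lt x a" "b \<in> A" | "lt x a" "\<not> lt a x" "b \<in> B"
      using X.total[of a x] X.asym[of a x] X.asym[of x a] x ab unfolding A_def B_def by blast
    then show "(a = x \<longleftrightarrow> b = y) \<and> (X.coloured_lt a x \<longleftrightarrow> Y.coloured_lt b y) \<and> (X.coloured_lt x a \<longleftrightarrow> Y.coloured_lt y b)"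
    proof cases
      case 1
      then have "lt' b y" "\<not> lt' y b" "b \<noteq> y"
        using y(1,3) mem Y.asym Y.irrefl by blast+
      then show ?thesis
        using 1 mem by (auto simp: X.coloured_lt_def Y.coloured_lt_def)
    next
      case 2
      then have "lt' y b" "\<not> lt' b y" "b \<noteq> y"
        using y(1,4) mem Y.asym Y.irrefl by blast+
      then show ?thesis
        using 2 mem by (auto simp: X.coloured_lt_def Y.coloured_lt_def)
    qed
  qed
  then show ?thesis
    using y(1) by blast
qed

lemma coloured_dense_order_iso:
  assumes X: "coloured_dense_order X lt col" and Y: "coloured_dense_order Y lt' col'"
    and cols: "col ` X = col' ` Y"
  shows "\<exists>g. bij_betw g X Y \<and> (\<forall>x\<in>X. col x = col' (g x)) \<and> (\<forall>x\<in>X. \<forall>y\<in>X. lt x y \<longleftrightarrow> lt' (g x) (g y))"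
proof -
  interpret X: coloured_dense_order X lt col by fact
  interpret Y: coloured_dense_order Y lt' col' by fact
  define P where "P p \<longleftrightarrow> p \<subseteq> X \<times> Y \<and> partial_iso X.coloured_lt Y.coloured_lt p" for p
  have "\<exists>g. bij_betw g X Y \<and> (\<forall>x\<in>X. \<forall>y\<in>X. X.coloured_lt x y \<longleftrightarrow> Y.coloured_lt (g x) (g y)) \<and> (\<forall>(a, b)\<in>{}. g a = b)"
  proof (rule back_and_forth[where P = P])
    fix p x assume "finite p" "P p" "x \<in> X"
    then show "\<exists>y. P (insert (x, y) p)"
      using coloured_dense_order_step[OF X Y cols, of p x] unfolding P_def by blast
  next
    fix p y assume p: "finite p" "P p" and y: "y \<in> Y"
    have "finite (p\<inverse>)" "p\<inverse> \<subseteq> Y \<times> X" "partial_iso Y.coloured_lt X.coloured_lt (p\<inverse>)"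
      using p by (auto simp: P_def partial_iso_converse)
    then obtain x where x: "x \<in> X" "partial_iso Y.coloured_lt X.coloured_lt (insert (y, x) (p\<inverse>))"
      using coloured_dense_order_step[OF Y X cols[symmetric] _ _ _ y, of "p\<inverse>"] by blast
    moreover have "insert (y, x) (p\<inverse>) = (insert (x, y) p)\<inverse>"
      by auto
    ultimately have "partial_iso X.coloured_lt Y.coloured_lt (insert (x, y) p)"
      by (simp only: partial_iso_converse)
    then show "\<exists>x. P (insert (x, y) p)"
      using x(1) y p(2) unfolding P_def by blast
  qed (auto simp: P_def partial_iso_def X.countable Y.countable X.nonempty)
  then obtain g where g: "bij_betw g X Y" "\<And>x y. x \<in> X \<Longrightarrow> y \<in> X \<Longrightarrow> X.coloured_lt x y \<longleftrightarrow> Y.coloured_lt (g x) (g y)"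
    by blast
  have "col x = col' (g x)" if "x \<in> X" for x
    using g(2)[OF that that] by (simp add: X.coloured_lt_def Y.coloured_lt_def)
  moreover have "lt x y \<longleftrightarrow> lt' (g x) (g y)" if "x \<in> X" "y \<in> X" for x y
  proof (cases "x = y")
    case True
    then show ?thesis
      using X.irrefl Y.irrefl bij_betwE[OF g(1)] that by blast
  next
    case False
    then have "g x \<noteq> g y"
      using g(1) that by (auto simp: bij_betw_def dest: inj_onD)
    then show ?thesis
      using g(2)[OF that] False by (simp add: X.coloured_lt_def Y.coloured_lt_def)
  qed
  ultimately show ?thesis
    using g(1) by blast
qed

section \<open>Tournaments with transitive in- and out-neighbourhoods\<close>

locale circular_tournament =
  fixes V :: "'a set" and R :: "'a \<Rightarrow> 'a \<Rightarrow> bool"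
  assumes countable: "countable V" and carrier: "R a b \<Longrightarrow> a \<in> V \<and> b \<in> V"
    and asym: "R a b \<Longrightarrow> \<not> R b a" and total: "a \<in> V \<Longrightarrow> b \<in> V \<Longrightarrow> a \<noteq> b \<Longrightarrow> R a b \<or> R b a"
    and arc: "\<exists>a b. R a b"
    and out_trans: "R x a \<Longrightarrow> R x b \<Longrightarrow> R x c \<Longrightarrow> R a b \<Longrightarrow> R b c \<Longrightarrow> R a c"
    and in_trans: "R a x \<Longrightarrow> R b x \<Longrightarrow> R c x \<Longrightarrow> R a b \<Longrightarrow> R b c \<Longrightarrow> R a c"
    and ex_between: "R a b \<Longrightarrow> \<exists>c. R a c \<and> R c b" and ex_after: "R a b \<Longrightarrow> \<exists>c. R a c \<and> R b c"
    and ex_before: "R a b \<Longrightarrow> \<exists>c. R c a \<and> R c b" and ex_cycle: "R a b \<Longrightarrow> \<exists>c. R b c \<and> R c a"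
begin

text \<open>Replacing the in-neighbours of \<open>p\<close> by their antipodes turns the circle into a line.\<close>

definition flip :: "'a \<Rightarrow> 'a \<Rightarrow> 'a \<Rightarrow> bool" where
  "flip p x y \<longleftrightarrow> (if R p x = R p y then R x y else R y x)"

lemma irrefl: "\<not> R x x"
  using asym by blast

text \<open>In each of the eight distributions of \<open>x\<close>, \<open>y\<close>,
  \<open>z\<close> on the two sides of \<open>p\<close>, a failure would put a 3-cycle among these
  four vertices into the in- or out-neighbourhood of the remaining one.\<close>

lemma flip_trans:
  assumes V: "x \<in> V - {p}" "y \<in> V - {p}" "z \<in> V - {p}" "p \<in> V" and "flip p x y" "flip p y z"
  shows "flip p x z"
proof -
  have t: "R a b \<or> R b a" if "a \<noteq> b" "a \<in> {x, y, z, p}" "b \<in> {x, y, z, p}" for a b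
    using total that V by blast
  have p: "R p a \<or> R a p" if "a \<in> {x, y, z}" for a
    using t[of a p] that V by auto
  have xz: "x \<noteq> z"
    using assms(5,6) asym unfolding flip_def by metis
  then have xz': "R x z \<or> R z x"
    using t by blast
  show ?thesis
  proof (cases "R p x"; cases "R p y"; cases "R p z")
    assume c: "R p x" "R p y" "R p z"
    then have "R x y" "R y z"
      using assms(5,6) by (simp_all add: flip_def)
    then have "R x z"
      using c xz'  out_trans[of p x y z] asym by blast
    then show ?thesis
      using c by (simp add: flip_def)
  next
    assume c: "R p x" "R p y" "\<not> R p z"
    then have "R x y" "R z y"
      using assms(5,6) by (simp_all add: flip_def)
    then have "R z x"
      using c xz' p[of z] in_trans[of z y p x] asym by blast
    then show ?thesis
      using c by (simp add: flip_def)
  next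
    assume c: "R p x" "\<not> R p y" "R p z"
    then have "R y x" "R z y"
      using assms(5,6) by (simp_all add: flip_def)
    then have "R x z"
      using c xz' p[of y] in_trans[of z x y p] asym by blast
    then show ?thesis
      using c by (simp add: flip_def)
  next
    assume c: "R p x" "\<not> R p y" "\<not> R p z"
    then have "R y x" "R y z"
      using assms(5,6) by (simp_all add: flip_def)
    then have "R z x"
      using c xz' p[of y] p[of z] out_trans[of y x z p] asym by blast
    then show ?thesis
      using c by (simp add: flip_def)
  next
    assume c: "\<not> R p x" "R p y" "R p z"
    then have "R y x" "R y z"
      using assms(5,6) by (simp_all add: flip_def)
    then have "R z x"
      using c xz' p[of x] in_trans[of p z y x] asym by blast
    then show ?thesis
      using c by (simp add: flip_def)
  next
    assume c: "\<not> R p x" "R p y" "\<not> R p z"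
    then have "R y x" "R z y"
      using assms(5,6) by (simp_all add: flip_def)
    then have "R x z"
      using c xz' p[of x] p[of z] out_trans[of z x p y] asym by blast
    then show ?thesis
      using c by (simp add: flip_def)
  next
    assume c: "\<not> R p x" "\<not> R p y" "R p z"
    then have "R x y" "R z y"
      using assms(5,6) by (simp_all add: flip_def)
    then have "R z x"
      using c xz' p[of x] p[of y] out_trans[of x p z y] asym by blast
    then show ?thesis
      using c by (simp add: flip_def)
  next
    assume c: "\<not> R p x" "\<not> R p y" "\<not> R p z"
    then have "R x y" "R y z"
      using assms(5,6) by (simp_all add: flip_def)
    then have "R x z"
      using c xz' p[of x] p[of y] p[of z] in_trans[of x p y z] asym by blast
    then show ?thesis
      using c by (simp add: flip_def)
  qed
qed

end

context circular_tournament
begin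

text \<open>The four \<open>ex_\<close> axioms realise all positions of a third vertex over an arc.
  The sides of \<open>x\<close> and \<open>y\<close> and the wanted side \<open>c\<close> tell which
  position over the arc between \<open>x\<close> and \<open>y\<close> is needed. The vertex found
  lies on side \<open>c\<close>, since otherwise a 3-cycle would lie in the neighbourhood of a
  vertex.\<close>

lemma flip_between:
  assumes V: "x \<in> V - {p}" "y \<in> V - {p}" "p \<in> V" and xy: "flip p x y"
  shows "\<exists>z\<in>V - {p}. R p z = c \<and> flip p x z \<and> flip p z y"
proof -
  have p: "R p x \<or> R x p" "R p y \<or> R y p" and tot: "z = p \<or> R p z \<or> R z p" if "z \<in> V" for z
    using total V that by auto
  note p = p[OF V(3)]
  show ?thesis
  proof (cases "R p x"; cases "R p y"; cases c)
    assume c: "R p x" "R p y" "c"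
    then have "R x y"
      using xy by (simp add: flip_def)
    from ex_between[OF this] obtain z where z: "R x z" "R z y"
      by blast
    then have "z \<in> V" "z \<noteq> p"
      using carrier c p asym by blast+
    moreover have "R p z"
      using tot[OF \<open>z \<in> V\<close>] \<open>z \<noteq> p\<close> z \<open>R x y\<close> c p in_trans[of x y z p] asym by blast
    ultimately show ?thesis
      using z c by (intro bexI[of _ z]) (simp_all add: flip_def)
  next
    assume c: "R p x" "R p y" "\<not> c"
    then have "R x y"
      using xy by (simp add: flip_def)
    from ex_cycle[OF this] obtain z where z: "R y z" "R z x"
      by blast
    then have "z \<in> V" "z \<noteq> p"
      using carrier c p asym by blast+
    moreover have "\<not> R p z"
      using tot[OF \<open>z \<in> V\<close>] \<open>z \<noteq> p\<close> z \<open>R x y\<close> c p out_trans[of p x y z] asym by blast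
    ultimately show ?thesis
      using z c by (intro bexI[of _ z]) (simp_all add: flip_def)
  next
    assume c: "R p x" "\<not> R p y" "c"
    then have "R y x"
      using xy by (simp add: flip_def)
    from ex_after[OF this] obtain z where z: "R y z" "R x z"
      by blast
    then have "z \<in> V" "z \<noteq> p"
      using carrier c p asym by blast+
    moreover have "R p z"
      using tot[OF \<open>z \<in> V\<close>] \<open>z \<noteq> p\<close> z \<open>R y x\<close> c p out_trans[of y x z p] asym by blast
    ultimately show ?thesis
      using z c by (intro bexI[of _ z]) (simp_all add: flip_def)
  next
    assume c: "R p x" "\<not> R p y" "\<not> c"
    then have "R y x"
      using xy by (simp add: flip_def)
    from ex_before[OF this] obtain z where z: "R z y" "R z x"
      by blast
    then have "z \<in> V" "z \<noteq> p"
      using carrier c p asym by blast+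
    moreover have "\<not> R p z"
      using tot[OF \<open>z \<in> V\<close>] \<open>z \<noteq> p\<close> z \<open>R y x\<close> c p in_trans[of z x y p] asym by blast
    ultimately show ?thesis
      using z c by (intro bexI[of _ z]) (simp_all add: flip_def)
  next
    assume c: "\<not> R p x" "R p y" "c"
    then have "R y x"
      using xy by (simp add: flip_def)
    from ex_before[OF this] obtain z where z: "R z y" "R z x"
      by blast
    then have "z \<in> V" "z \<noteq> p"
      using carrier c p asym by blast+
    moreover have "R p z"
      using tot[OF \<open>z \<in> V\<close>] \<open>z \<noteq> p\<close> z \<open>R y x\<close> c p out_trans[of z y x p] asym by blast
    ultimately show ?thesis
      using z c by (intro bexI[of _ z]) (simp_all add: flip_def)
  next
    assume c: "\<not> R p x" "R p y" "\<not> c"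
    then have "R y x"
      using xy by (simp add: flip_def)
    from ex_after[OF this] obtain z where z: "R y z" "R x z"
      by blast
    then have "z \<in> V" "z \<noteq> p"
      using carrier c p asym by blast+
    moreover have "\<not> R p z"
      using tot[OF \<open>z \<in> V\<close>] \<open>z \<noteq> p\<close> z \<open>R y x\<close> c p in_trans[of x z p y] asym by blast
    ultimately show ?thesis
      using z c by (intro bexI[of _ z]) (simp_all add: flip_def)
  next
    assume c: "\<not> R p x" "\<not> R p y" "c"
    then have "R x y"
      using xy by (simp add: flip_def)
    from ex_cycle[OF this] obtain z where z: "R y z" "R z x"
      by blast
    then have "z \<in> V" "z \<noteq> p"
      using carrier c p asym by blast+
    moreover have "R p z"
      using tot[OF \<open>z \<in> V\<close>] \<open>z \<noteq> p\<close> z \<open>R x y\<close> c p in_trans[of x p y z] asym by blast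
    ultimately show ?thesis
      using z c by (intro bexI[of _ z]) (simp_all add: flip_def)
  next
    assume c: "\<not> R p x" "\<not> R p y" "\<not> c"
    then have "R x y"
      using xy by (simp add: flip_def)
    from ex_between[OF this] obtain z where z: "R x z" "R z y"
      by blast
    then have "z \<in> V" "z \<noteq> p"
      using carrier c p asym by blast+
    moreover have "\<not> R p z"
      using tot[OF \<open>z \<in> V\<close>] \<open>z \<noteq> p\<close> z \<open>R x y\<close> c p out_trans[of x p z y] asym by blast
    ultimately show ?thesis
      using z c by (intro bexI[of _ z]) (simp_all add: flip_def)
  qed
qed

text \<open>For each side of \<open>x\<close> and each wanted side \<open>c\<close>, one of the four
  positions over the arc between \<open>p\<close> and \<open>x\<close> is exactly what is
  asked.\<close>

lemma flip_below:
  assumes V: "x \<in> V - {p}" "p \<in> V"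
  shows "\<exists>z\<in>V - {p}. R p z = c \<and> flip p z x"
proof -
  have p: "R p x \<or> R x p"
    using total V by auto
  show ?thesis
  proof (cases "R p x"; cases c)
    assume c: "R p x" "c"
    then show ?thesis
      using ex_between[of p x] p carrier asym irrefl unfolding flip_def by (metis Diff_iff empty_iff insert_iff)
  next
    assume c: "R p x" "\<not> c"
    then show ?thesis
      using ex_cycle[of p x] p carrier asym irrefl unfolding flip_def by (metis Diff_iff empty_iff insert_iff)
  next
    assume c: "\<not> R p x" "c"
    then show ?thesis
      using ex_after[of x p] p carrier asym irrefl unfolding flip_def by (metis Diff_iff empty_iff insert_iff)
  next
    assume c: "\<not> R p x" "\<not> c"
    then show ?thesis
      using ex_before[of x p] p carrier asym irrefl unfolding flip_def by (metis Diff_iff empty_iff insert_iff)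
  qed
qed

lemma flip_above:
  assumes V: "x \<in> V - {p}" "p \<in> V"
  shows "\<exists>z\<in>V - {p}. R p z = c \<and> flip p x z"
proof -
  have p: "R p x \<or> R x p"
    using total V by auto
  show ?thesis
  proof (cases "R p x"; cases c)
    assume c: "R p x" "c"
    then show ?thesis
      using ex_after[of p x] p carrier asym irrefl unfolding flip_def by (metis Diff_iff empty_iff insert_iff)
  next
    assume c: "R p x" "\<not> c"
    then show ?thesis
      using ex_before[of p x] p carrier asym irrefl unfolding flip_def by (metis Diff_iff empty_iff insert_iff)
  next
    assume c: "\<not> R p x" "c"
    then show ?thesis
      using ex_cycle[of x p] p carrier asym irrefl unfolding flip_def by (metis Diff_iff empty_iff insert_iff)
  next
    assume c: "\<not> R p x" "\<not> c"
    then show ?thesis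
      using ex_between[of x p] p carrier asym irrefl unfolding flip_def by (metis Diff_iff empty_iff insert_iff)
  qed
qed

lemma flip_coloured_dense_order:
  assumes "p \<in> V"
  shows "coloured_dense_order (V - {p}) (flip p) (R p)" and "R p ` (V - {p}) = UNIV"
proof -
  obtain a b where ab: "R a b"
    using arc by blast
  have "V - {p} \<noteq> {}"
    using ab carrier[OF ab] irrefl by blast
  then obtain x where x: "x \<in> V - {p}"
    by blast
  have "c \<in> R p ` (V - {p})" for c
    using flip_below[OF x assms, of c] by blast
  then show "R p ` (V - {p}) = UNIV"
    by blast
  show "coloured_dense_order (V - {p}) (flip p) (R p)"
  proof
    show "countable (V - {p})"
      using countable by simp
    show "V - {p} \<noteq> {}" by fact
    show "\<not> flip p x x" for x
      using irrefl by (simp add: flip_def)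
    show "flip p x y \<or> flip p y x" if "x \<in> V - {p}" "y \<in> V - {p}" "x \<noteq> y" for x y
      using total[of x y] that by (auto simp: flip_def)
    show "flip p x z" if "x \<in> V - {p}" "y \<in> V - {p}" "z \<in> V - {p}" "flip p x y" "flip p y z" for x y z
      using flip_trans[OF that(1-3) assms that(4,5)] .
    show "\<exists>z\<in>V - {p}. R p z = c \<and> flip p z x" if "x \<in> V - {p}" for c x
      using flip_below[OF that assms] .
    show "\<exists>z\<in>V - {p}. R p z = c \<and> flip p x z" if "x \<in> V - {p}" for c x
      using flip_above[OF that assms] .
    show "\<exists>z\<in>V - {p}. R p z = c \<and> flip p x z \<and> flip p z y"
      if "x \<in> V - {p}" "y \<in> V - {p}" "flip p x y" for c x y
      using flip_between[OF that(1,2) assms that(3)] .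
  qed
qed

end

text \<open>Colour and flipped order determine the tournament: the colour of a vertex is its arc
  with the removed point, and flipping a second time restores the other arcs. So an isomorphism of
  the coloured orders extends by sending \<open>p\<close> to \<open>p'\<close>.\<close>

lemma circular_tournament_iso:
  assumes "circular_tournament V R" "circular_tournament V' R'"
  shows "\<exists>g. bij_betw g V V' \<and> (\<forall>x\<in>V. \<forall>y\<in>V. R x y \<longleftrightarrow> R' (g x) (g y))"
proof -
  interpret A: circular_tournament V R by fact
  interpret B: circular_tournament V' R' by fact
  obtain p p' where p: "p \<in> V" "p' \<in> V'"
    using A.arc A.carrier B.arc B.carrier by blast
  obtain g where g: "bij_betw g (V - {p}) (V' - {p'})" "\<And>x. x \<in> V - {p} \<Longrightarrow> R p x = R' p' (g x)"
    "\<And>x y. x \<in> V - {p} \<Longrightarrow> y \<in> V - {p} \<Longrightarrow> A.flip p x y \<longleftrightarrow> B.flip p' (g x) (g y)"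
    using coloured_dense_order_iso[OF A.flip_coloured_dense_order(1)[OF p(1)] B.flip_coloured_dense_order(1)[OF p(2)]]
      A.flip_coloured_dense_order(2)[OF p(1)] B.flip_coloured_dense_order(2)[OF p(2)] by auto
  have gV: "g x \<in> V' - {p'}" if "x \<in> V - {p}" for x
    using bij_betwE[OF g(1)] that by blast
  define h where "h = g(p := p')"
  have h: "h p = p'" "\<And>x. x \<noteq> p \<Longrightarrow> h x = g x"
    by (simp_all add: h_def)
  have "bij_betw h (V - {p}) (V' - {p'})"
    using g(1) by (rule bij_betw_cong[THEN iffD1, rotated]) (simp add: h_def)
  then have "bij_betw h (insert p (V - {p})) (insert p' (V' - {p'}))"
    using h(1) by (metis Diff_iff insertI1 notIn_Un_bij_betw insert_is_Un sup_commute)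
  then have "bij_betw h V V'"
    using p by (simp add: insert_absorb)
  moreover have "R x y \<longleftrightarrow> R' (h x) (h y)" if "x \<in> V" "y \<in> V" for x y
  proof -
    consider "x = p" "y = p" | "x = p" "y \<in> V - {p}" | "x \<in> V - {p}" "y = p" | "x \<in> V - {p}" "y \<in> V - {p}"
      using \<open>x \<in> V\<close> \<open>y \<in> V\<close> by blast
    then show ?thesis
    proof cases
      case 1
      then show ?thesis using A.irrefl B.irrefl by simp
    next
      case 2
      then show ?thesis using g(2) h by simp
    next
      case 3
      then have "R x p \<longleftrightarrow> \<not> R p x" "R' (g x) p' \<longleftrightarrow> \<not> R' p' (g x)"
        using A.total[of x p] A.asym B.total[of "g x" p'] B.asym gV[of x] p by blast+
      then show ?thesis using 3 g(2) h by simp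
    next
      case 4
      then have "h x = g x" "h y = g y"
        using h by auto
      then show ?thesis using g(2)[OF 4(1)] g(2)[OF 4(2)] g(3)[OF 4] g(3)[OF 4(2,1)]
        by (auto simp: A.flip_def B.flip_def split: if_splits)
    qed
  qed
  ultimately show ?thesis
    by blast
qed

section \<open>The circular tournament \<open>S2\<close> in terms of cross products\<close>

definition cross :: "complex \<Rightarrow> complex \<Rightarrow> real" where
  "cross x y = Re x * Im y - Im x * Re y"

lemma cross_minus: "cross y x = - cross x y"
  by (simp add: cross_def)

lemma cross_add: "cross x (y + z) = cross x y + cross x z" "cross (y + z) x = cross y x + cross z x"
  by (simp_all add: cross_def algebra_simps)

lemma cross_diff: "cross x (y - z) = cross x y - cross x z" "cross (y - z) x = cross y x - cross z x"
  by (simp_all add: cross_def algebra_simps)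

lemma cross_uminus: "cross x (- y) = - cross x y" "cross (- y) x = - cross y x"
  by (simp_all add: cross_def)

lemma cross_self: "cross x x = 0"
  by (simp add: cross_def)

lemma cross_scale: "cross x (y /\<^sub>R c) = cross x y / c" "cross (y /\<^sub>R c) x = cross y x / c"
  by (simp_all add: cross_def divide_simps)

text \<open>The three-term Grassmann-Pluecker relation. Read as a statement about signs, it says
  that the points in an open half circle after \<open>x\<close> are linearly ordered.\<close>

lemma plucker: "cross x b * cross a c = cross x a * cross b c + cross x c * cross a b"
  by (simp add: cross_def algebra_simps)

text \<open>For unit vectors \<open>cross x y\<close> is the imaginary part of \<open>y / x\<close>,
  that is, the sine of the angle from \<open>x\<close> to \<open>y\<close>. The angle 0 has to be
  excluded separately and occurs only for equal points.\<close>

lemma Arg2pi_less_pi_iff: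
  assumes "norm x = 1" "norm y = 1"
  shows "x \<noteq> y \<and> Arg2pi (y / x) < pi \<longleftrightarrow> 0 < cross x y"
proof -
  have "(Re x)\<^sup>2 + (Im x)\<^sup>2 = 1"
    using assms(1) cmod_power2[of x] by simp
  then have im: "Im (y / x) = cross x y"
    by (simp add: Im_divide cross_def)
  have "Arg2pi (y / x) \<noteq> 0" if "x \<noteq> y"
  proof
    assume "Arg2pi (y / x) = 0"
    then have "y / x \<in> \<real>" "0 \<le> Re (y / x)"
      by (simp_all add: Arg2pi_eq_0)
    then obtain t where t: "y / x = of_real t" "0 \<le> t"
      by (auto elim: Reals_cases)
    then have "t = 1"
      using assms by (metis abs_of_nonneg div_by_1 norm_divide norm_of_real)
    then show False
      using t(1) that assms(1) by auto
  qed
  then show ?thesis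
    using Arg2pi_lt_pi[of "y / x"] Arg2pi_ge_0[of "y / x"] im cross_self[of x] by force
qed

lemma circular_graph_arcs:
  assumes "S2_vertex_set D"
  shows "(x, y) \<in> arcs (circular_graph D) \<longleftrightarrow> x \<in> D \<and> y \<in> D \<and> 0 < cross x y"
proof -
  have "norm z = 1" if "z \<in> D" for z
    using assms that by (auto simp: S2_vertex_set_def)
  then show ?thesis
    using Arg2pi_less_pi_iff[of x y] by (auto simp: circular_graph_def)
qed

text \<open>The factors \<open>s\<close> and \<open>t\<close> carry the wanted signs. The two sign
  conditions define an open set stable under positive scaling, so it contains the projection of
  \<open>w\<close> to the circle, and \<open>D\<close> meets it by density.\<close>

lemma S2_dense:
  assumes "S2_vertex_set D" and w: "w \<noteq> 0" "0 < s * cross a w" "0 < t * cross b w"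
  shows "\<exists>z\<in>D. 0 < s * cross a z \<and> 0 < t * cross b z"
proof -
  let ?U = "{z. 0 < s * cross a z} \<inter> {z. 0 < t * cross b z}"
  let ?w = "w /\<^sub>R norm w"
  have "open ?U"
    unfolding cross_def by (intro open_Int open_Collect_less continuous_intros)
  moreover have "?w \<in> ?U"
    using w by (simp add: cross_scale zero_less_divide_iff)
  moreover have "?w \<in> closure D"
    using assms(1) w(1) by (auto simp: S2_vertex_set_def)
  ultimately have "D \<inter> ?U \<noteq> {}"
    using open_Int_closure_eq_empty[of ?U D] by blast
  then show ?thesis
    by blast
qed

lemma circular_S2:
  assumes D: "S2_vertex_set D"
  shows "circular_tournament D (\<lambda>x y. (x, y) \<in> arcs (circular_graph D))"
  unfolding circular_graph_arcs[OF D]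
proof
  have norm: "norm z = 1" and minus: "- z \<notin> D" if "z \<in> D" for z
    using D that by (auto simp: S2_vertex_set_def)
  show "countable D"
    using D by (simp add: S2_vertex_set_def)
  fix a b c x
  show "a \<in> D \<and> b \<in> D \<and> 0 < cross a b \<Longrightarrow> a \<in> D \<and> b \<in> D"
    by simp
  show "\<not> (b \<in> D \<and> a \<in> D \<and> 0 < cross b a)" if "a \<in> D \<and> b \<in> D \<and> 0 < cross a b"
    using that cross_minus[of a b] by simp
  show "(a \<in> D \<and> b \<in> D \<and> 0 < cross a b) \<or> (b \<in> D \<and> a \<in> D \<and> 0 < cross b a)"
    if ab: "a \<in> D" "b \<in> D" "a \<noteq> b"
  proof (rule ccontr)
    assume "\<not> ?thesis"
    \<comment> \<open>Parallel unit vectors are equal or antipodal, and \<open>D\<close> contains no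
      antipodal pair.\<close>
    then have "cross a b = 0"
      using ab cross_minus[of a b] by auto
    then have "Im (b * cnj a) = 0"
      by (simp add: cross_def algebra_simps)
    then obtain r where r: "b * cnj a = of_real r"
      by (metis complex_is_Real_iff Reals_cases)
    have "norm (b * cnj a) = 1"
      using norm ab by (simp add: norm_mult)
    then have "\<bar>r\<bar> = 1"
      by (simp add: r)
    then have "r = 1 \<or> r = - 1"
      by linarith
    then have "b * cnj a = 1 \<or> b * cnj a = - 1"
      using r by auto
    moreover have "b * cnj a * a = b"
      using norm[OF ab(1)] by (simp add: mult.assoc mult.commute[of "cnj a"] complex_norm_square[symmetric])
    ultimately have "b = a \<or> b = - a"
      by (metis mult_1 mult_minus_left)
    then show False
      using ab minus by auto
  qed
  show "\<exists>a b. a \<in> D \<and> b \<in> D \<and> 0 < cross a b"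
  proof -
    have "closure D \<noteq> {}"
      using D by (auto simp: S2_vertex_set_def)
    then obtain d where d: "d \<in> D"
      by auto
    \<comment> \<open>A quarter turn from \<open>d\<close> is a witness for the existence of an
      arc.\<close>
    have "cross d (\<i> * d) = (norm d)\<^sup>2"
      unfolding cmod_power2 by (simp add: cross_def power2_eq_square)
    then have "\<exists>z\<in>D. 0 < 1 * cross d z \<and> 0 < 1 * cross d z"
      using norm[OF d] by (intro S2_dense[OF D, of "\<i> * d"]) auto
    then show ?thesis
      using d by auto
  qed
  show "a \<in> D \<and> c \<in> D \<and> 0 < cross a c" if "x \<in> D \<and> a \<in> D \<and> 0 < cross x a" "x \<in> D \<and> b \<in> D \<and> 0 < cross x b"
    "x \<in> D \<and> c \<in> D \<and> 0 < cross x c" "a \<in> D \<and> b \<in> D \<and> 0 < cross a b" "b \<in> D \<and> c \<in> D \<and> 0 < cross b c"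
  proof -
    have "0 < cross x a * cross b c + cross x c * cross a b"
      using that by (intro add_pos_pos mult_pos_pos) auto
    then have "0 < cross x b * cross a c"
      by (simp only: plucker[of x b a c])
    then show ?thesis
      using that by (simp add: zero_less_mult_iff)
  qed
  show "a \<in> D \<and> c \<in> D \<and> 0 < cross a c" if "a \<in> D \<and> x \<in> D \<and> 0 < cross a x" "b \<in> D \<and> x \<in> D \<and> 0 < cross b x"
    "c \<in> D \<and> x \<in> D \<and> 0 < cross c x" "a \<in> D \<and> b \<in> D \<and> 0 < cross a b" "b \<in> D \<and> c \<in> D \<and> 0 < cross b c"
  proof -
    have "cross b x * cross a c = cross a x * cross b c + cross c x * cross a b"
      by (simp add: cross_def algebra_simps)
    moreover have "0 < cross a x * cross b c + cross c x * cross a b"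
      using that by (intro add_pos_pos mult_pos_pos) auto
    ultimately have "0 < cross b x * cross a c"
      by simp
    then show ?thesis
      using that by (simp add: zero_less_mult_iff)
  qed
  \<comment> \<open>The lines through \<open>a\<close> and \<open>b\<close> cut the plane into four
    sectors, one for each position of a third point. The vectors \<open>a + b\<close>,
    \<open>b - a\<close>, \<open>a - b\<close> and \<open>- a - b\<close> lie in these
    sectors.\<close>
  assume ab: "a \<in> D \<and> b \<in> D \<and> 0 < cross a b"
  then have ba: "cross b a < 0" and ne: "a + b \<noteq> 0" "b - a \<noteq> 0"
    using cross_minus[of a b] cross_self[of a] by (auto simp: add_eq_0_iff cross_uminus)
  show "\<exists>c. (a \<in> D \<and> c \<in> D \<and> 0 < cross a c) \<and> c \<in> D \<and> b \<in> D \<and> 0 < cross c b"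
  proof -
    have "\<exists>c\<in>D. 0 < 1 * cross a c \<and> 0 < - 1 * cross b c"
      by (rule S2_dense[OF D, of "a + b"]) (use ab ba ne in \<open>auto simp: cross_add cross_diff cross_uminus cross_self add_eq_0_iff\<close>)
    then obtain c where "c \<in> D" "0 < 1 * cross a c" "0 < - 1 * cross b c"
      by blast
    then show ?thesis
      using ab cross_minus[of c a] cross_minus[of c b] by (intro exI[of _ c]) simp
  qed
  show "\<exists>c. (a \<in> D \<and> c \<in> D \<and> 0 < cross a c) \<and> b \<in> D \<and> c \<in> D \<and> 0 < cross b c"
  proof -
    have "\<exists>c\<in>D. 0 < 1 * cross a c \<and> 0 < 1 * cross b c"
      by (rule S2_dense[OF D, of "b - a"]) (use ab ba ne in \<open>auto simp: cross_add cross_diff cross_uminus cross_self add_eq_0_iff\<close>)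
    then obtain c where "c \<in> D" "0 < 1 * cross a c" "0 < 1 * cross b c"
      by blast
    then show ?thesis
      using ab cross_minus[of c a] cross_minus[of c b] by (intro exI[of _ c]) simp
  qed
  show "\<exists>c. (c \<in> D \<and> a \<in> D \<and> 0 < cross c a) \<and> c \<in> D \<and> b \<in> D \<and> 0 < cross c b"
  proof -
    have "\<exists>c\<in>D. 0 < - 1 * cross a c \<and> 0 < - 1 * cross b c"
      by (rule S2_dense[OF D, of "a - b"]) (use ab ba ne in \<open>auto simp: cross_add cross_diff cross_uminus cross_self add_eq_0_iff\<close>)
    then obtain c where "c \<in> D" "0 < - 1 * cross a c" "0 < - 1 * cross b c"
      by blast
    then show ?thesis
      using ab cross_minus[of c a] cross_minus[of c b] by (intro exI[of _ c]) simp
  qed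
  show "\<exists>c. (b \<in> D \<and> c \<in> D \<and> 0 < cross b c) \<and> c \<in> D \<and> a \<in> D \<and> 0 < cross c a"
  proof -
    have "\<exists>c\<in>D. 0 < 1 * cross b c \<and> 0 < - 1 * cross a c"
      by (rule S2_dense[OF D, of "- a - b"]) (use ab ba ne in \<open>auto simp: cross_add cross_diff cross_uminus cross_self add_eq_0_iff\<close>)
    then obtain c where "c \<in> D" "0 < 1 * cross b c" "0 < - 1 * cross a c"
      by blast
    then show ?thesis
      using ab cross_minus[of c a] cross_minus[of c b] by (intro exI[of _ c]) simp
  qed
qed

text \<open>By homogeneity every arc can be moved to every other, so each position that a third
  vertex takes over some arc is taken over all arcs. A 3-cycle and a transitive triple together give
  all four positions, hence the circle; if only one of the two kinds of triple is possible, the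
  result is \<open>C3\<close> or the rationals.\<close>

lemma homogeneous_local_order:
  fixes G :: "'a graph"
  assumes G: "tournament G" "homogeneous G" "countable (verts G)"
    and out: "\<And>x a b c. (x, a) \<in> arcs G \<Longrightarrow> (x, b) \<in> arcs G \<Longrightarrow> (x, c) \<in> arcs G \<Longrightarrow>
      (a, b) \<in> arcs G \<Longrightarrow> (b, c) \<in> arcs G \<Longrightarrow> (a, c) \<in> arcs G"
    and inn: "\<And>x a b c. (a, x) \<in> arcs G \<Longrightarrow> (b, x) \<in> arcs G \<Longrightarrow> (c, x) \<in> arcs G \<Longrightarrow>
      (a, b) \<in> arcs G \<Longrightarrow> (b, c) \<in> arcs G \<Longrightarrow> (a, c) \<in> arcs G"
  shows "isomorphic_graphs G I1 \<or> isomorphic_graphs G C3 \<or> isomorphic_graphs G rat_order \<or> isomorphic_graphs G S2"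
proof -
  define R where "R x y \<longleftrightarrow> (x, y) \<in> arcs G" for x y
  let ?V = "verts G"
  have carrier: "x \<in> ?V \<and> y \<in> ?V" if "R x y" for x y
    using G(1) that by (auto simp: R_def tournament_def oriented_graph_def)
  have asym: "\<not> R y x" if "R x y" for x y
    using G(1) that by (auto simp: R_def tournament_def oriented_graph_def dest: asymD)
  have total: "R x y \<or> R y x" if "x \<in> ?V" "y \<in> ?V" "x \<noteq> y" for x y
    using G(1) that by (auto simp: R_def tournament_def)
  have move: "\<exists>g. g a = a' \<and> g b = b' \<and> (\<forall>x y. R x y \<longrightarrow> R (g x) (g y))" if ab: "R a b" "R a' b'" for a b a' b'
  proof -
    have "partial_iso (adjacent G) (adjacent G) {(a, a'), (b, b')}"
      using ab asym unfolding partial_iso_def R_def[symmetric] by blast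
    then obtain g where g: "graph_iso g G G" "g a = a'" "g b = b'"
      using homogeneous_extend[OF G(2), of "{(a, a'), (b, b')}"] carrier[OF ab(1)] carrier[OF ab(2)] by auto
    have "R (g x) (g y)" if "R x y" for x y
      using g(1) carrier[OF that] that by (simp add: graph_iso_def R_def)
    then show ?thesis
      using g by blast
  qed
  have move1: "\<exists>g. g a = a' \<and> (\<forall>x y. R x y \<longrightarrow> R (g x) (g y))" if mem: "a \<in> ?V" "a' \<in> ?V" for a a'
  proof -
    have "partial_iso (adjacent G) (adjacent G) {(a, a')}"
      using asym unfolding partial_iso_def R_def[symmetric] by blast
    then obtain g where g: "graph_iso g G G" "g a = a'"
      using homogeneous_extend[OF G(2), of "{(a, a')}"] mem by auto
    have "R (g x) (g y)" if "R x y" for x y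
      using g(1) carrier[OF that] that by (simp add: graph_iso_def R_def)
    then show ?thesis
      using g by blast
  qed
  obtain v where v: "v \<in> ?V"
    using G(1) by (auto simp: tournament_def oriented_graph_def)
  consider "\<And>a b. \<not> R a b"
    | a b c x y z where "R a b" "R b c" "R c a" "R x y" "R y z" "R x z"
    | a b c where "R a b" "R b c" "R c a" "\<And>x y z. R x y \<Longrightarrow> R y z \<Longrightarrow> \<not> R x z"
    | a b where "R a b" "\<And>a b c. R a b \<Longrightarrow> R b c \<Longrightarrow> \<not> R c a"
    by metis
  then show ?thesis
  proof cases
    case 1
    then have "?V = {v}" "arcs G = {}"
      using total v G(1) by (auto simp: R_def)
    then have "graph_iso (\<lambda>_. 0) G I1"
      by (auto simp: graph_iso_def I1_def bij_betw_def)
    then show ?thesis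
      by (auto simp: isomorphic_graphs_def)
  next
    case 2
    have "circular_tournament ?V R"
    proof
      show "countable ?V" by (rule G(3))
      show "\<exists>a b. R a b" using 2 by blast
      show "R a b \<Longrightarrow> a \<in> ?V \<and> b \<in> ?V" "R a b \<Longrightarrow> \<not> R b a" for a b
        using carrier asym by blast+
      show "a \<in> ?V \<Longrightarrow> b \<in> ?V \<Longrightarrow> a \<noteq> b \<Longrightarrow> R a b \<or> R b a" for a b
        using total by blast
      show "R x a \<Longrightarrow> R x b \<Longrightarrow> R x c \<Longrightarrow> R a b \<Longrightarrow> R b c \<Longrightarrow> R a c"
        "R a x \<Longrightarrow> R b x \<Longrightarrow> R c x \<Longrightarrow> R a b \<Longrightarrow> R b c \<Longrightarrow> R a c" for x a b c
        using out inn unfolding R_def by blast+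
      fix u w assume uw: "R u w"
      show "\<exists>c. R u c \<and> R c w"
        using move[OF 2(6) uw] 2(4,5) by metis
      show "\<exists>c. R u c \<and> R w c"
        using move[OF 2(4) uw] 2(5,6) by metis
      show "\<exists>c. R c u \<and> R c w"
        using move[OF 2(5) uw] 2(4,6) by metis
      show "\<exists>c. R w c \<and> R c u"
        using move[OF 2(1) uw] 2(2,3) by metis
    qed
    moreover have "S2_vertex_set (SOME D. S2_vertex_set D)"
      using ex_S2_vertex_set by (rule someI_ex)
    ultimately obtain g where "bij_betw g ?V (SOME D. S2_vertex_set D)"
      "\<forall>x\<in>?V. \<forall>y\<in>?V. R x y \<longleftrightarrow> (g x, g y) \<in> arcs S2"
      using circular_tournament_iso[OF _ circular_S2] unfolding S2_def by blast
    then have "graph_iso g G S2"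
      by (simp add: graph_iso_def R_def S2_def circular_graph_def)
    then show ?thesis
      by (auto simp: isomorphic_graphs_def)
  next
    case 3
    have mem: "a \<in> ?V" "b \<in> ?V" "c \<in> ?V"
      using 3 carrier by blast+
    have ne: "a \<noteq> b" "b \<noteq> c" "a \<noteq> c"
      using 3 asym by blast+
    \<comment> \<open>A fourth vertex would form a transitive triple with two vertices of the
      3-cycle.\<close>
    have "w = a \<or> w = b \<or> w = c" if "w \<in> ?V" for w
      using total[OF that mem(1)] total[OF that mem(2)] total[OF that mem(3)] 3 asym by metis
    then have V: "?V = {a, b, c}"
      using mem by blast
    define f :: "'a \<Rightarrow> nat" where "f x = (if x = a then 0 else if x = b then 1 else 2)" for x
    have f: "f a = 0" "f b = 1" "f c = 2"
      using ne by (simp_all add: f_def)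
    have r: "R a b" "R b c" "R c a" "\<not> R b a" "\<not> R c b" "\<not> R a c" "\<not> R a a" "\<not> R b b" "\<not> R c c"
      using 3 asym by blast+
    have "graph_iso f G C3"
    proof (rule graph_isoI)
      show "bij_betw f ?V (verts C3)"
        using ne unfolding V by (auto simp: bij_betw_def f_def C3_def)
      fix x y assume "x \<in> ?V" "y \<in> ?V"
      then show "(x, y) \<in> arcs G \<longleftrightarrow> (f x, f y) \<in> arcs C3"
        unfolding V R_def[symmetric] by (elim insertE emptyE) (simp_all add: r f C3_def)
    qed
    then show ?thesis
      by (auto simp: isomorphic_graphs_def)
  next
    case 4
    have trans: "R x z" if "R x y" "R y z" for x y z
      using 4(2)[OF that] total[of x z] carrier that asym by blast
    have ab: "a \<in> ?V" "b \<in> ?V"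
      using carrier 4(1) by auto
    have above: "\<exists>z. R x z" and below: "\<exists>z. R z x" if "x \<in> ?V" for x
      using move1[OF ab(1) that] move1[OF ab(2) that] 4(1) by metis+
    have between: "\<exists>z. R x z \<and> R z y" if "R x y" for x y
    \<comment> \<open>The arc from \<open>a\<close> to \<open>d\<close> has \<open>b\<close> in
      between, and it can be moved to the arc from \<open>x\<close> to \<open>y\<close>.\<close>
    proof -
      obtain d where "R b d"
        using above[OF ab(2)] by blast
      then show ?thesis
        using move[OF trans[OF 4(1)] that] 4(1) by metis
    qed
    have G_order: "coloured_dense_order ?V R (\<lambda>_. True)"
    proof
      show "countable ?V" "?V \<noteq> {}"
        using G(3) v by auto
      fix x y z
      show "\<not> R x x" using asym by blast
      show "R x y \<Longrightarrow> R y z \<Longrightarrow> R x z" by (rule trans)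
      show "x \<in> ?V \<Longrightarrow> y \<in> ?V \<Longrightarrow> x \<noteq> y \<Longrightarrow> R x y \<or> R y x" by (rule total)
    next
      fix c x assume "c \<in> (\<lambda>_. True) ` ?V" "x \<in> ?V"
      then show "\<exists>z\<in>?V. True = c \<and> R z x" "\<exists>z\<in>?V. True = c \<and> R x z"
        using above below carrier by blast+
      fix y assume "R x y"
      then show "\<exists>z\<in>?V. True = c \<and> R x z \<and> R z y"
        using between carrier \<open>c \<in> _\<close> by blast
    qed
    have rat_order: "coloured_dense_order (UNIV :: rat set) (<) (\<lambda>_. True)"
      by standard (auto intro: lt_ex gt_ex dense)
    have "(\<lambda>_. True) ` ?V = (\<lambda>_. True) ` (UNIV :: rat set)"
      using v by auto
    from coloured_dense_order_iso[OF G_order rat_order this] obtain g where "bij_betw g ?V (UNIV :: rat set)" "\<forall>x\<in>?V. \<forall>y\<in>?V. R x y \<longleftrightarrow> g x < g y"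
      by blast
    then have "graph_iso g G rat_order"
      by (simp add: graph_iso_def R_def rat_order_def)
    then show ?thesis
      by (auto simp: isomorphic_graphs_def)
  qed
qed

section \<open>The generic tournament and the classification\<close>

text \<open>The age of \<open>G\<close>, in the form required by
  \<open>amalgamation_class\<close>.\<close>

definition embeds :: "'a graph \<Rightarrow> nat set \<Rightarrow> (nat \<Rightarrow> nat \<Rightarrow> bool) \<Rightarrow> bool" where
  "embeds G S r \<longleftrightarrow> finite S \<and>
     (\<exists>f. inj_on f S \<and> f ` S \<subseteq> verts G \<and> (\<forall>x\<in>S. \<forall>y\<in>S. r x y \<longleftrightarrow> (f x, f y) \<in> arcs G))"

text \<open>An automorphism carries the copy of \<open>S\<close> in the second embedding to the copy
  in the first. The second new point then becomes a vertex \<open>w\<close> over the common copy,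
  distinct from the first new point because \<open>s\<close> distinguishes them, and the arc between
  the two decides the orientation.\<close>

lemma embeds_class:
  assumes G: "tournament G" "homogeneous G"
  shows "amalgamation_class (embeds G)"
proof
  show "embeds G S r \<Longrightarrow> finite S" for S r
    by (simp add: embeds_def)
next
  fix S r assume "embeds G S r"
  then obtain f where f: "inj_on f S" "f ` S \<subseteq> verts G" "\<And>x y. x \<in> S \<Longrightarrow> y \<in> S \<Longrightarrow> r x y \<longleftrightarrow> (f x, f y) \<in> arcs G"
    unfolding embeds_def by blast
  show "tourn S r"
    unfolding tourn_def
  proof (intro ballI)
    fix x y assume xy: "x \<in> S" "y \<in> S"
    then have "f x \<in> verts G" "f y \<in> verts G" "f x = f y \<longleftrightarrow> x = y"
      using f(1,2) by (auto dest: inj_onD)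
    then show "(x \<noteq> y \<longrightarrow> r x y \<or> r y x) \<and> \<not> (r x y \<and> r y x)"
      using tournament_arc_iff[OF G(1), of "f x" "f y"] f(3)[OF xy] f(3)[OF xy(2,1)] by blast
  qed
next
  fix T r' and f :: "nat \<Rightarrow> nat" and S r
  assume *: "embeds G T r'" "inj_on f S" "f ` S \<subseteq> T"
    "\<And>x y. x \<in> S \<Longrightarrow> y \<in> S \<Longrightarrow> r x y \<longleftrightarrow> r' (f x) (f y)"
  obtain g where g: "inj_on g T" "g ` T \<subseteq> verts G" "\<And>x y. x \<in> T \<Longrightarrow> y \<in> T \<Longrightarrow> r' x y \<longleftrightarrow> (g x, g y) \<in> arcs G"
    using *(1) unfolding embeds_def by blast
  have "finite T"
    using *(1) by (simp add: embeds_def)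
  then have "finite S"
    using *(2,3) by (metis finite_imageD finite_subset)
  moreover have "inj_on (g \<circ> f) S"
    using *(2,3) g(1) by (meson comp_inj_on inj_on_subset)
  moreover have "(g \<circ> f) ` S \<subseteq> verts G"
    using *(3) g(2) by auto
  moreover have "r x y \<longleftrightarrow> ((g \<circ> f) x, (g \<circ> f) y) \<in> arcs G" if "x \<in> S" "y \<in> S" for x y
    using *(3) *(4)[OF that] g(3)[of "f x" "f y"] that by auto
  ultimately show "embeds G S r"
    unfolding embeds_def by blast
next
  fix a b s :: nat and S r
  assume *: "embeds G (insert a S) r" "embeds G (insert b S) r" "a \<notin> S" "b \<notin> S" "s \<in> S" "r s a \<noteq> r s b"
  obtain f where f: "inj_on f (insert a S)" "f ` insert a S \<subseteq> verts G"
    "\<And>x y. x \<in> insert a S \<Longrightarrow> y \<in> insert a S \<Longrightarrow> r x y \<longleftrightarrow> (f x, f y) \<in> arcs G"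
    using *(1) unfolding embeds_def by blast
  obtain g where g: "inj_on g (insert b S)" "g ` insert b S \<subseteq> verts G"
    "\<And>x y. x \<in> insert b S \<Longrightarrow> y \<in> insert b S \<Longrightarrow> r x y \<longleftrightarrow> (g x, g y) \<in> arcs G"
    using *(2) unfolding embeds_def by blast
  have fin: "finite S"
    using *(1) by (simp add: embeds_def)
  define p where "p = (\<lambda>s. (g s, f s)) ` S"
  have feq: "f x = f y \<longleftrightarrow> x = y" if "x \<in> insert a S" "y \<in> insert a S" for x y
    using inj_on_eq_iff[OF f(1) that] .
  have geq: "g x = g y \<longleftrightarrow> x = y" if "x \<in> insert b S" "y \<in> insert b S" for x y
    using inj_on_eq_iff[OF g(1) that] .
  have "partial_iso (adjacent G) (adjacent G) p"
    unfolding partial_iso_def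
  proof (intro allI impI)
    fix u u' v v' assume "(u, u') \<in> p" "(v, v') \<in> p"
    then obtain x y where xy: "x \<in> S" "y \<in> S" and eq: "u = g x" "u' = f x" "v = g y" "v' = f y"
      unfolding p_def by blast
    then show "(u = v \<longleftrightarrow> u' = v') \<and> ((u, v) \<in> arcs G \<longleftrightarrow> (u', v') \<in> arcs G)"
      using f(3)[of x y] g(3)[of x y] feq[of x y] geq[of x y] by auto
  qed
  moreover have "finite p" "p \<subseteq> verts G \<times> verts G"
    using fin f(2) g(2) by (auto simp: p_def)
  ultimately obtain h where h: "graph_iso h G G" "\<And>u v. (u, v) \<in> p \<Longrightarrow> h u = v"
    using homogeneous_extend[OF G(2)] by meson
  have hg: "h (g x) = f x" if "x \<in> S" for x
    using that by (intro h(2)) (simp add: p_def)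
  define w where "w = h (g b)"
  have gV: "g x \<in> verts G" if "x \<in> insert b S" for x
    using g(2) that by auto
  have w: "w \<in> verts G"
    using h(1) gV[of b] by (auto simp: w_def graph_iso_def dest: bij_betwE)
  have ws: "r x b \<longleftrightarrow> (f x, w) \<in> arcs G" "r b x \<longleftrightarrow> (w, f x) \<in> arcs G" if "x \<in> S" for x
    using h(1) gV[of b] gV[of x] g(3)[of x b] g(3)[of b x] hg[OF that] that by (auto simp: w_def graph_iso_def)
  have wf: "w \<noteq> f x" if "x \<in> S" for x
  proof
    assume "w = f x"
    then have "h (g b) = h (g x)"
      using hg[OF that] by (simp add: w_def)
    then have "g b = g x"
      using h(1) gV[of b] gV[of x] that by (auto simp: graph_iso_def bij_betw_def dest: inj_onD)
    then show False
      using geq[of b x] that *(4) by auto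
  qed
  have wa: "w \<noteq> f a"
    using *(5,6) f(3)[of s a] ws(1)[of s] by auto
  have ab: "a \<noteq> b"
    using *(6) by auto
  define k where "k = f(b := w)"
  have k: "k b = w" "k a = f a" "\<And>x. x \<in> S \<Longrightarrow> k x = f x"
    using ab *(4) by (auto simp: k_def)
  have inj: "inj_on k (insert a (insert b S))"
    unfolding inj_on_def using k wa wf feq *(3) by (metis insert_iff)
  have kV: "k ` insert a (insert b S) \<subseteq> verts G"
    using k w f(2) by auto
  have irr: "\<not> r a a" "(f a, f a) \<notin> arcs G" "\<not> r b b" "(w, w) \<notin> arcs G"
    using f(3)[of a a] g(3)[of b b] tournament_arc_iff[OF G(1), of "f a" "f a"] tournament_arc_iff[OF G(1), of "g b" "g b"]
      tournament_arc_iff[OF G(1), of w w] f(2) gV[of b] w by auto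
  have fS: "r x y \<longleftrightarrow> (k x, k y) \<in> arcs G" if "x \<in> insert a (insert b S)" "y \<in> insert a (insert b S)"
    "\<not> (x = a \<and> y = b)" "\<not> (x = b \<and> y = a)" for x y
    using that k f(3)[of x y] ws[of x] ws[of y] irr by (elim insertE) simp_all
  have arcs: "(f a, w) \<in> arcs G \<longleftrightarrow> (w, f a) \<notin> arcs G"
    using tournament_arc_iff[OF G(1), of "f a" w] f(2) w wa by auto
  have "embeds G (insert a (insert b S)) (set_arc r c d)" if cd: "c = a \<and> d = b \<or> c = b \<and> d = a" "(k c, k d) \<in> arcs G" for c d
    unfolding embeds_def
  proof (intro conjI exI[of _ k] ballI)
    show "finite (insert a (insert b S))"
      using fin by simp
    fix x y assume xy: "x \<in> insert a (insert b S)" "y \<in> insert a (insert b S)"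
    have dc: "(k d, k c) \<notin> arcs G"
      using cd arcs k by auto
    show "set_arc r c d x y \<longleftrightarrow> (k x, k y) \<in> arcs G"
      using fS[OF xy] cd dc ab unfolding set_arc_def by metis
  qed (fact inj kV)+
  then show "embeds G (insert a (insert b S)) (set_arc r a b) \<or> embeds G (insert a (insert b S)) (set_arc r b a)"
    using arcs k(1,2) by metis
qed

text \<open>The tournament consisting of \<open>A\<close> and one further point with the prescribed
  arcs embeds somewhere. Homogeneity moves the copy of \<open>A\<close> back onto \<open>A\<close>,
  and the further point along with it.\<close>

lemma extension_property:
  assumes G: "tournament G" "homogeneous G" and univ: "\<And>n r. tourn {..<Suc n} r \<Longrightarrow> embeds G {..<Suc n} r"
    and A: "finite A" "A \<subseteq> verts G"
  shows "\<exists>v\<in>verts G. v \<notin> A \<and> (\<forall>a\<in>A. (a, v) \<in> arcs G \<longleftrightarrow> Q a)"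
proof -
  define n where "n = card A"
  obtain e where "bij_betw e {0..<n} A"
    using ex_bij_betw_nat_finite[OF A(1)] by (auto simp: n_def)
  then have e: "bij_betw e {..<n} A"
    by (simp add: atLeast0LessThan)
  have eA: "e i \<in> A" if "i < n" for i
    using bij_betwE[OF e] that by blast
  have eV: "e i \<in> verts G" if "i < n" for i
    using eA[OF that] A(2) by blast
  have einj: "e i = e j \<longleftrightarrow> i = j" if "i < n" "j < n" for i j
    using e that by (auto simp: bij_betw_def dest: inj_onD)
  define r where "r i j \<longleftrightarrow> (if i < n then if j < n then (e i, e j) \<in> arcs G else Q (e i)
    else j < n \<and> \<not> Q (e j))" for i j
  have "tourn {..<Suc n} r"
    unfolding tourn_def
  proof (intro ballI)
    fix i j assume "i \<in> {..<Suc n}" "j \<in> {..<Suc n}"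
    then consider "i < n" "j < n" | "i < n" "j = n" | "i = n" "j < n" | "i = n" "j = n"
      by fastforce
    then show "(i \<noteq> j \<longrightarrow> r i j \<or> r j i) \<and> \<not> (r i j \<and> r j i)"
    proof cases
      case 1
      then show ?thesis
        using tournament_arc_iff[OF G(1) eV[OF 1(1)] eV[OF 1(2)]] einj[OF 1] unfolding r_def by auto
    qed (auto simp: r_def)
  qed
  then obtain f where f: "inj_on f {..<Suc n}" "f ` {..<Suc n} \<subseteq> verts G"
    "\<And>x y. x \<in> {..<Suc n} \<Longrightarrow> y \<in> {..<Suc n} \<Longrightarrow> r x y \<longleftrightarrow> (f x, f y) \<in> arcs G"
    using univ[of n r] unfolding embeds_def by blast
  have finj: "f i = f j \<longleftrightarrow> i = j" if "i \<le> n" "j \<le> n" for i j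
    using f(1) that by (auto dest: inj_onD)
  have fV: "f i \<in> verts G" if "i \<le> n" for i
    using f(2) that by auto
  define p where "p = (\<lambda>i. (f i, e i)) ` {..<n}"
  have "partial_iso (adjacent G) (adjacent G) p"
    unfolding partial_iso_def
  proof (intro allI impI)
    fix u u' v v' assume "(u, u') \<in> p" "(v, v') \<in> p"
    then obtain i j where ij: "i < n" "j < n" and eq: "u = f i" "u' = e i" "v = f j" "v' = e j"
      by (auto simp: p_def)
    then show "(u = v \<longleftrightarrow> u' = v') \<and> ((u, v) \<in> arcs G \<longleftrightarrow> (u', v') \<in> arcs G)"
      using f(3)[of i j] finj[of i j] einj[OF ij] by (simp add: r_def)
  qed
  moreover have "finite p" "p \<subseteq> verts G \<times> verts G"
    using fV eV by (auto simp: p_def)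
  ultimately obtain h where h: "graph_iso h G G" "\<And>u v. (u, v) \<in> p \<Longrightarrow> h u = v"
    using homogeneous_extend[OF G(2)] by meson
  have hf: "h (f i) = e i" if "i < n" for i
    using that by (intro h(2)) (simp add: p_def)
  let ?v = "h (f n)"
  have hinj: "h x = h y \<longleftrightarrow> x = y" if "x \<in> verts G" "y \<in> verts G" for x y
    using h(1) that by (auto simp: graph_iso_def bij_betw_def dest: inj_onD)
  have v: "?v \<in> verts G"
    using h(1) fV[of n] by (auto simp: graph_iso_def dest: bij_betwE)
  have key: "e i \<noteq> ?v \<and> ((e i, ?v) \<in> arcs G \<longleftrightarrow> Q (e i))" if i: "i < n" for i
  proof -
    have "f i \<in> verts G" "f n \<in> verts G" "f i \<noteq> f n"
      using fV[of i] fV[of n] finj[of i n] i by auto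
    then have "h (f i) \<noteq> ?v" "(h (f i), ?v) \<in> arcs G \<longleftrightarrow> (f i, f n) \<in> arcs G"
      using hinj h(1) by (auto simp: graph_iso_def)
    then show ?thesis
      using f(3)[of i n] i hf[OF i] by (simp add: r_def)
  qed
  have "\<exists>i<n. a = e i" if "a \<in> A" for a
    using bij_betw_imp_surj_on[OF e] that by blast
  then have "?v \<notin> A \<and> (\<forall>a\<in>A. (a, ?v) \<in> arcs G \<longleftrightarrow> Q a)"
    using key by metis
  then show ?thesis
    using v by blast
qed

lemma extension_property_step:
  assumes G: "tournament G" and H: "tournament H"
    and ext: "\<And>A Q. finite A \<Longrightarrow> A \<subseteq> verts H \<Longrightarrow> \<exists>v\<in>verts H. v \<notin> A \<and> (\<forall>a\<in>A. (a, v) \<in> arcs H \<longleftrightarrow> Q a)"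
    and p: "finite p" "p \<subseteq> verts G \<times> verts H" "partial_iso (adjacent G) (adjacent H) p"
    and x: "x \<in> verts G"
  shows "\<exists>y\<in>verts H. partial_iso (adjacent G) (adjacent H) (insert (x, y) p)"
proof (cases "x \<in> Domain p")
  case True
  then obtain y where "(x, y) \<in> p" by blast
  then have "insert (x, y) p = p" "y \<in> verts H"
    using p(2) by auto
  then show ?thesis
    using p(3) by metis
next
  case False
  have "finite (Range p)" "Range p \<subseteq> verts H"
    using p(1,2) by (auto simp: finite_Range)
  from ext[OF this, of "\<lambda>b. \<exists>a. (a, b) \<in> p \<and> (a, x) \<in> arcs G"]
  obtain y where y: "y \<in> verts H" "y \<notin> Range p"
    "\<forall>b\<in>Range p. (b, y) \<in> arcs H \<longleftrightarrow> (\<exists>a. (a, b) \<in> p \<and> (a, x) \<in> arcs G)"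
    by blast
  have "partial_iso (adjacent G) (adjacent H) (insert (x, y) p)"
  proof (rule partial_iso_insert[OF p(3)])
    show "(x, x) \<in> arcs G \<longleftrightarrow> (y, y) \<in> arcs H"
      using tournament_arc_iff[OF G x x] tournament_arc_iff[OF H y(1) y(1)] by blast
    fix a b assume ab: "(a, b) \<in> p"
    then have mem: "a \<in> verts G" "b \<in> verts H" "a \<noteq> x" "b \<noteq> y"
      using p(2) False y(2) by auto
    have "a' = a" if "(a', b) \<in> p" for a'
      using p(3) ab that unfolding partial_iso_def by blast
    then have "(b, y) \<in> arcs H \<longleftrightarrow> (a, x) \<in> arcs G"
      using y(3) ab by blast
    then show "(a = x \<longleftrightarrow> b = y) \<and> ((a, x) \<in> arcs G \<longleftrightarrow> (b, y) \<in> arcs H) \<and> ((x, a) \<in> arcs G \<longleftrightarrow> (y, b) \<in> arcs H)"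
      using tournament_arc_iff[OF G mem(1) x] tournament_arc_iff[OF H mem(2) y(1)] mem(3,4) by blast
  qed
  then show ?thesis
    using y(1) by blast
qed

lemma extension_property_iso:
  assumes G: "tournament G" "countable (verts G)" and H: "tournament H" "countable (verts H)"
    and extG: "\<And>A Q. finite A \<Longrightarrow> A \<subseteq> verts G \<Longrightarrow> \<exists>v\<in>verts G. v \<notin> A \<and> (\<forall>a\<in>A. (a, v) \<in> arcs G \<longleftrightarrow> Q a)"
    and extH: "\<And>A Q. finite A \<Longrightarrow> A \<subseteq> verts H \<Longrightarrow> \<exists>v\<in>verts H. v \<notin> A \<and> (\<forall>a\<in>A. (a, v) \<in> arcs H \<longleftrightarrow> Q a)"
  shows "isomorphic_graphs G H"
proof -
  let ?r = "\<lambda>x y. (x, y) \<in> arcs G" and ?s = "\<lambda>x y. (x, y) \<in> arcs H"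
  define P where "P p \<longleftrightarrow> p \<subseteq> verts G \<times> verts H \<and> partial_iso ?r ?s p" for p
  have "\<exists>g. bij_betw g (verts G) (verts H) \<and> (\<forall>x\<in>verts G. \<forall>y\<in>verts G. ?r x y \<longleftrightarrow> ?s (g x) (g y)) \<and> (\<forall>(a, b)\<in>{}. g a = b)"
  proof (rule back_and_forth[where P = P])
    fix p x assume "finite p" "P p" "x \<in> verts G"
    then show "\<exists>y. P (insert (x, y) p)"
      using extension_property_step[OF G(1) H(1) extH, of p x] unfolding P_def by blast
  next
    fix p y assume p: "finite p" "P p" and y: "y \<in> verts H"
    have "finite (p\<inverse>)" "p\<inverse> \<subseteq> verts H \<times> verts G" "partial_iso ?s ?r (p\<inverse>)"
      using p by (auto simp: P_def partial_iso_converse)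
    then obtain x where x: "x \<in> verts G" "partial_iso ?s ?r (insert (y, x) (p\<inverse>))"
      using extension_property_step[OF H(1) G(1) extG _ _ _ y, of "p\<inverse>"] by blast
    moreover have "insert (y, x) (p\<inverse>) = (insert (x, y) p)\<inverse>"
      by auto
    ultimately have "partial_iso ?r ?s (insert (x, y) p)"
      by (simp only: partial_iso_converse)
    then show "\<exists>x. P (insert (x, y) p)"
      using x(1) y p(2) unfolding P_def by blast
  next
    show "verts G \<noteq> {}"
      using G(1) by (simp add: tournament_def oriented_graph_def)
  qed (use G(2) H(2) in \<open>auto simp: P_def partial_iso_def\<close>)
  then show ?thesis
    by (auto simp: isomorphic_graphs_def graph_iso_def)
qed

text \<open>Its two-vertex induced subgraphs belong to the age, so all pairs are adjacent. The
  vertex number \<open>Suc n\<close> reflects that graphs are nonempty, so the age contains only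
  nonempty tournaments.\<close>

lemma T_inf:
  shows "tournament T_inf" "homogeneous T_inf" "tourn {..<Suc n} r \<Longrightarrow> embeds T_inf {..<Suc n} r"
proof -
  have "fraisse_limit T_inf {H. tournament H \<and> finite (verts H)}"
    unfolding T_inf_def using ex_fraisse_limit_tournaments by (rule someI_ex)
  then have T: "oriented_graph T_inf" "homogeneous T_inf" and age: "age T_inf = {H. tournament H \<and> finite (verts H)}"
    by (simp_all add: fraisse_limit_def)
  show "homogeneous T_inf" by fact
  have "(x, y) \<in> arcs T_inf \<or> (y, x) \<in> arcs T_inf" if "x \<in> verts T_inf" "y \<in> verts T_inf" "x \<noteq> y" for x y
  proof -
    have "oriented_graph (induced T_inf {x, y})"
      using T(1) by (auto simp: oriented_graph_def induced_def asym_iff)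
    moreover have "graph_iso id (induced T_inf {x, y}) (induced T_inf {x, y})"
      by (simp add: graph_iso_def)
    ultimately have "induced T_inf {x, y} \<in> age T_inf"
      using that unfolding age_def isomorphic_graphs_def by (auto intro!: exI[of _ "{x, y}"])
    then show ?thesis
      using that(3) unfolding age by (auto simp: tournament_def)
  qed
  then show "tournament T_inf"
    using T(1) by (simp add: tournament_def)
  show "embeds T_inf {..<Suc n} r" if r: "tourn {..<Suc n} r"
  proof -
    define H where "H = ({..<Suc n}, {(i, j). i < Suc n \<and> j < Suc n \<and> r i j})"
    have "tournament H"
      using r unfolding tournament_def oriented_graph_def tourn_def H_def by (auto intro!: asymI)
    then have "H \<in> age T_inf"
      by (simp add: age H_def)
    then obtain A f where f: "A \<subseteq> verts T_inf" "graph_iso f H (induced T_inf A)"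
      by (auto simp: age_def isomorphic_graphs_def)
    then have "inj_on f {..<Suc n}" "f ` {..<Suc n} = A"
      by (auto simp: graph_iso_def bij_betw_def H_def)
    moreover have "r i j \<longleftrightarrow> (f i, f j) \<in> arcs T_inf" if "i \<in> {..<Suc n}" "j \<in> {..<Suc n}" for i j
      using f(2) that \<open>f ` _ = A\<close> unfolding graph_iso_def H_def by auto
    ultimately show ?thesis
      using f(1) unfolding embeds_def by blast
  qed
qed

text \<open>If every finite tournament embeds, the extension property identifies \<open>G\<close>
  with \<open>T_inf\<close>. Otherwise no neighbourhood contains a 3-cycle, since such a cycle would
  put \<open>W\<close> into the age or into its reversal, and then all finite tournaments would
  embed after all.\<close>

theorem homogeneous_tournament_classification:
  fixes G :: "'a graph"
  assumes G: "tournament G" "homogeneous G" "countable (verts G)"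
  shows "isomorphic_graphs G I1 \<or> isomorphic_graphs G C3 \<or> isomorphic_graphs G rat_order \<or>
    isomorphic_graphs G S2 \<or> isomorphic_graphs G T_inf"
proof -
  interpret K: amalgamation_class "embeds G"
    using G(1,2) by (rule embeds_class)
  have carrier: "x \<in> verts G \<and> y \<in> verts G" if "(x, y) \<in> arcs G" for x y
    using G(1) that by (auto simp: tournament_def oriented_graph_def)
  have asym: "(y, x) \<notin> arcs G" if "(x, y) \<in> arcs G" for x y
    using G(1) that by (auto simp: tournament_def oriented_graph_def dest: asymD)
  have embed4: "embeds G {..<4} r" if V: "a \<in> verts G" "b \<in> verts G" "c \<in> verts G" "d \<in> verts G"
    and dist: "distinct [a, b, c, d]"
    and r: "\<And>i j. i < 4 \<Longrightarrow> j < 4 \<Longrightarrow> r i j \<longleftrightarrow> ([a, b, c, d] ! i, [a, b, c, d] ! j) \<in> arcs G" for r a b c d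
    unfolding embeds_def
  proof (intro conjI exI[of _ "(!) [a, b, c, d]"] ballI)
    show "inj_on ((!) [a, b, c, d]) {..<4}"
      using dist by (intro inj_on_nth) auto
    show "(!) [a, b, c, d] ` {..<4} \<subseteq> verts G"
      using V by (auto simp: lt_4)
  qed (use r in auto)
  have dominating: "embeds G {..<n} r"
    if bad: "(x, a) \<in> arcs G" "(x, b) \<in> arcs G" "(x, c) \<in> arcs G" "(a, b) \<in> arcs G" "(b, c) \<in> arcs G" "(a, c) \<notin> arcs G"
      and r: "tourn {..<n} r" for x a b c n r
  proof -
    have ca: "(c, a) \<in> arcs G"
      using bad tournament_arc_iff[OF G(1), of a c] carrier asym by blast
    have no: "(a, x) \<notin> arcs G" "(b, x) \<notin> arcs G" "(c, x) \<notin> arcs G" "(b, a) \<notin> arcs G" "(c, b) \<notin> arcs G"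
      "(x, x) \<notin> arcs G" "(a, a) \<notin> arcs G" "(b, b) \<notin> arcs G" "(c, c) \<notin> arcs G"
      using bad asym by blast+
    have "embeds G {..<4} (adj W)"
    proof (rule embed4[of a b c x])
      show "distinct [a, b, c, x]"
        using bad ca no by auto
      show "adj W i j \<longleftrightarrow> ([a, b, c, x] ! i, [a, b, c, x] ! j) \<in> arcs G" if "i < 4" "j < 4" for i j
        using that bad ca no by (auto simp: lt_4 adj_def W_def)
    qed (use bad carrier in blast)+
    then show ?thesis
      using class_of_all_tournaments[OF K.amalgamation_class_axioms _ r] by (simp add: has_def)
  qed
  have dominated: "embeds G {..<n} r"
    if bad: "(a, x) \<in> arcs G" "(b, x) \<in> arcs G" "(c, x) \<in> arcs G" "(a, b) \<in> arcs G" "(b, c) \<in> arcs G" "(a, c) \<notin> arcs G"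
      and r: "tourn {..<n} r" for x a b c n r
  proof -
    have ca: "(c, a) \<in> arcs G"
      using bad tournament_arc_iff[OF G(1), of a c] carrier asym by blast
    have no: "(x, a) \<notin> arcs G" "(x, b) \<notin> arcs G" "(x, c) \<notin> arcs G" "(b, a) \<notin> arcs G" "(c, b) \<notin> arcs G"
      "(x, x) \<notin> arcs G" "(a, a) \<notin> arcs G" "(b, b) \<notin> arcs G" "(c, c) \<notin> arcs G"
      using bad asym by blast+
    have "embeds G {..<4} (\<lambda>i j. adj W j i)"
    \<comment> \<open>Listing the 3-cycle backwards matches it with the reversed arcs of
      \<open>W\<close>.\<close>
    proof (rule embed4[of c b a x])
      show "distinct [c, b, a, x]"
        using bad ca no by auto
      show "adj W j i \<longleftrightarrow> ([c, b, a, x] ! i, [c, b, a, x] ! j) \<in> arcs G" if "i < 4" "j < 4" for i j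
        using that bad ca no by (auto simp: lt_4 adj_def W_def)
    qed (use bad carrier in blast)+
    then have "has (reverse_class (embeds G)) W"
      by (simp add: has_def reverse_class_def)
    moreover have "tourn {..<n} (\<lambda>i j. r j i)"
      using r unfolding tourn_def by blast
    ultimately show ?thesis
      using class_of_all_tournaments[OF K.reverse_class, of n "\<lambda>i j. r j i"] by (simp add: reverse_class_def)
  qed
  show ?thesis
  proof (cases "\<forall>n r. tourn {..<n} r \<longrightarrow> embeds G {..<n} r")
    case True
    have "isomorphic_graphs G T_inf"
    proof (rule extension_property_iso[OF G(1,3) T_inf(1)])
      show "\<exists>v\<in>verts G. v \<notin> A \<and> (\<forall>a\<in>A. (a, v) \<in> arcs G \<longleftrightarrow> Q a)" if "finite A" "A \<subseteq> verts G" for A Q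
        using True by (intro extension_property[OF G(1,2) _ that]) blast
      show "\<exists>v\<in>verts T_inf. v \<notin> A \<and> (\<forall>a\<in>A. (a, v) \<in> arcs T_inf \<longleftrightarrow> Q a)"
        if "finite A" "A \<subseteq> verts T_inf" for A Q
        by (intro extension_property[OF T_inf that])
    qed simp
    then show ?thesis by blast
  next
    case False
    then obtain n r where no: "tourn {..<n} r" "\<not> embeds G {..<n} r"
      by blast
    have out_trans: "(a, c) \<in> arcs G" if "(x, a) \<in> arcs G" "(x, b) \<in> arcs G" "(x, c) \<in> arcs G"
      "(a, b) \<in> arcs G" "(b, c) \<in> arcs G" for x a b c
      using dominating[OF that _ no(1)] no(2) by blast
    have in_trans: "(a, c) \<in> arcs G" if "(a, x) \<in> arcs G" "(b, x) \<in> arcs G" "(c, x) \<in> arcs G"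
      "(a, b) \<in> arcs G" "(b, c) \<in> arcs G" for x a b c
      using dominated[OF that _ no(1)] no(2) by blast
    have "isomorphic_graphs G I1 \<or> isomorphic_graphs G C3 \<or> isomorphic_graphs G rat_order \<or> isomorphic_graphs G S2"
      by (rule homogeneous_local_order[OF G]) (fact out_trans in_trans)+
    then show ?thesis
      by blast
  qed
qed

lemma (in disconnected_graph) components_isomorphic_copies:
  assumes "isomorphic_graphs D H" "\<forall>C\<in>weak_components G. isomorphic_graphs C D"
  shows "\<exists>k>1. isomorphic_graphs G (copies k H)"
  by (rule components_copies) (use assms in \<open>blast intro: isomorphic_graphs_trans\<close>)

theorem theorem4p5:
  fixes \<Gamma> :: "'a graph"
  assumes "oriented_graph \<Gamma>" and "countable (verts \<Gamma>)" and "disconnected \<Gamma>"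
  shows "(hom_homogeneous \<Gamma> \<longleftrightarrow>
           (\<exists>\<Delta> :: 'a graph. tournament \<Delta> \<and> homogeneous \<Delta> \<and>
              (\<forall>C\<in>weak_components \<Gamma>. isomorphic_graphs C \<Delta>))) \<and>
         (hom_homogeneous \<Gamma> \<longrightarrow>
           (\<exists>k :: enat. 1 < k \<and> k \<le> \<infinity> \<and>
              (isomorphic_graphs \<Gamma> (copies k I1) \<or>
               isomorphic_graphs \<Gamma> (copies k C3) \<or>
               isomorphic_graphs \<Gamma> (copies k rat_order) \<or>
               isomorphic_graphs \<Gamma> (copies k S2) \<or>
               isomorphic_graphs \<Gamma> (copies k T_inf))))"
proof -
  interpret disconnected_graph \<Gamma>
    using assms by unfold_locales
  show ?thesis
  proof (intro conjI iffI impI)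
    assume "hom_homogeneous \<Gamma>"
    then obtain \<Delta> :: "'a graph" where \<Delta>: "tournament \<Delta>" "homogeneous \<Delta>" "countable (verts \<Delta>)"
      "\<forall>C\<in>weak_components \<Gamma>. isomorphic_graphs C \<Delta>"
      using hom_homogeneous_components by blast
    then show "\<exists>\<Delta> :: 'a graph. tournament \<Delta> \<and> homogeneous \<Delta> \<and> (\<forall>C\<in>weak_components \<Gamma>. isomorphic_graphs C \<Delta>)"
      by blast
    from homogeneous_tournament_classification[OF \<Delta>(1-3)]
    show "\<exists>k :: enat. 1 < k \<and> k \<le> \<infinity> \<and>
        (isomorphic_graphs \<Gamma> (copies k I1) \<or> isomorphic_graphs \<Gamma> (copies k C3) \<or>
         isomorphic_graphs \<Gamma> (copies k rat_order) \<or> isomorphic_graphs \<Gamma> (copies k S2) \<or>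
         isomorphic_graphs \<Gamma> (copies k T_inf))"
      using components_isomorphic_copies[OF _ \<Delta>(4), of I1] components_isomorphic_copies[OF _ \<Delta>(4), of C3]
        components_isomorphic_copies[OF _ \<Delta>(4), of rat_order] components_isomorphic_copies[OF _ \<Delta>(4), of S2]
        components_isomorphic_copies[OF _ \<Delta>(4), of T_inf] enat_ord_simps(3)
      by meson
  next
    assume "\<exists>\<Delta> :: 'a graph. tournament \<Delta> \<and> homogeneous \<Delta> \<and> (\<forall>C\<in>weak_components \<Gamma>. isomorphic_graphs C \<Delta>)"
    then show "hom_homogeneous \<Gamma>"
      using components_hom_homogeneous by blast
  qed
qed

end
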